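(* For every $r>2$ and $\epsilon>0$ there is a constant $C_{r,\epsilon}<\infty$ such that for every $N\ge1$, all real numbers $\xi_1<\dots<\xi_N$, and every $f\in L^2(\mathbb R)$, $$\Big\|\,\|\Pi_k[f](x)\|_{V^r_k(\mathbb Z)}\Big\|_{L^2_x(\mathbb R)}\le C_{r,\epsilon}N^{\epsilon}\|f\|_{L^2(\mathbb R)} .$$
   Context: For $k\in\mathbb Z$, $\Pi_k[f]=\mathcal F^{-1}[1_{R_k}\widehat f\,]$ where $R_k=\bigcup_{j=1}^N(\xi_j-2^{-k},\xi_j+2^{-k})$, and $\widehat h(\xi)=\mathcal F[h](\xi)=\int_{\mathbb R}e^{-2\pi i\xi x}h(x)\,dx$. For $D\subset\mathbb R$ and $a:D\to\mathbb C$, $$\|a(t)\|_{V^r_t(D)}=\sup_{n,\;N_0<\dots<N_n}\Big(|a(N_0)|^r+\sum_{j=1}^n|a(N_j)-a(N_{j-1})|^r\Big)^{1/r},$$ the supremum being over all $n$ and all $N_0<\dots<N_n$ in $D$. *)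

theory Defs
  imports "HOL-Analysis.Analysis"
begin

text \<open>
  The norm of \<open>L\<^sup>2(\<real>)\<close> is taken with values in the extended nonnegative reals, since a variation
  norm is a priori only \<open>[0, \<infinity>]\<close>-valued. For a complex-valued \<open>f\<close> the argument is \<open>|f|\<close>.
\<close>

definition L2norm :: "(real \<Rightarrow> ennreal) \<Rightarrow> ennreal" where
  "L2norm g =
    (let I = \<integral>\<^sup>+x. (g x)\<^sup>2 \<partial>lebesgue
     in if I = \<infinity> then \<infinity> else ennreal (sqrt (enn2real I)))"

abbreviation cL2norm :: "(real \<Rightarrow> complex) \<Rightarrow> ennreal" where
  "cL2norm f \<equiv> L2norm (\<lambda>x. ennreal (cmod (f x)))"

definition L2 :: "(real \<Rightarrow> complex) set" where
  "L2 = {f. f \<in> borel_measurable lebesgue \<and> cL2norm f < \<infinity>}"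

definition fourier_L1 :: "(real \<Rightarrow> complex) \<Rightarrow> real \<Rightarrow> complex" where
  "fourier_L1 h \<xi> = (LINT x|lebesgue. exp (- 2 * of_real pi * \<i> * of_real \<xi> * of_real x) * h x)"

definition inv_fourier_L1 :: "(real \<Rightarrow> complex) \<Rightarrow> real \<Rightarrow> complex" where
  "inv_fourier_L1 h x = (LINT \<xi>|lebesgue. exp (2 * of_real pi * \<i> * of_real \<xi> * of_real x) * h \<xi>)"

text \<open>
  On \<open>L\<^sup>2(\<real>)\<close> the Fourier transform is Plancherel's extension: the limit in \<open>L\<^sup>2\<close> of the integral
  transforms of the truncations of \<open>f\<close> to \<open>[-n, n]\<close>. This limit exists and is determined up to null
  sets; the choice operator merely selects a representative.
\<close>

definition is_fourier_L2 :: "(real \<Rightarrow> complex) \<Rightarrow> (real \<Rightarrow> complex) \<Rightarrow> bool" where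
  "is_fourier_L2 f g \<longleftrightarrow> g \<in> L2 \<and>
     (\<lambda>n::nat. cL2norm (\<lambda>\<xi>. fourier_L1 (\<lambda>x. indicator {- real n..real n} x * f x) \<xi> - g \<xi>))
       \<longlonglongrightarrow> 0"

definition fourier_L2 :: "(real \<Rightarrow> complex) \<Rightarrow> real \<Rightarrow> complex" where
  "fourier_L2 f = (SOME g. is_fourier_L2 f g)"

definition freq_nbhd :: "nat \<Rightarrow> (nat \<Rightarrow> real) \<Rightarrow> int \<Rightarrow> real set" where
  "freq_nbhd N \<xi> k = (\<Union>j\<in>{1..N}. {\<xi> j - 2 powi (- k)<..<\<xi> j + 2 powi (- k)})"

text \<open>
  The set \<open>freq_nbhd N \<xi> k\<close> has finite measure, so the restriction of the transform of \<open>f \<in> L\<^sup>2\<close> to it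
  is integrable by Cauchy-Schwarz. Its inverse transform is therefore given by the absolutely convergent
  integral, which is the continuous representative and does not depend on the choices made above.
\<close>

definition freq_proj :: "nat \<Rightarrow> (nat \<Rightarrow> real) \<Rightarrow> int \<Rightarrow> (real \<Rightarrow> complex) \<Rightarrow> real \<Rightarrow> complex" where
  "freq_proj N \<xi> k f = inv_fourier_L1 (\<lambda>\<eta>. indicator (freq_nbhd N \<xi> k) \<eta> * fourier_L2 f \<eta>)"

definition Vnorm :: "real \<Rightarrow> 'a::linorder set \<Rightarrow> ('a \<Rightarrow> complex) \<Rightarrow> ennreal" where
  "Vnorm r D a =
    (SUP (n, t) \<in> {(n::nat, t::nat \<Rightarrow> 'a). strict_mono_on {..n} t \<and> t ` {..n} \<subseteq> D}.
       ennreal ((cmod (a (t 0)) powr r + (\<Sum>j=1..n. cmod (a (t j) - a (t (j - 1))) powr r)) powr (1 / r)))"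

end

theory Submission
  imports Defs "HOL-Probability.Characteristic_Functions"
begin

text \<open>
  Put \<open>R\<^sub>k\<close> for the set of frequencies at distance less than \<open>2\<^sup>-\<^sup>k\<close> from some \<open>\<xi>\<^sub>j\<close>. These sets decrease in
  \<open>k\<close>, so by Bessel's inequality the increments of \<open>\<Pi>\<^sub>k[f](x)\<close> over disjoint ranges of \<open>k\<close> are estimated by
  disjoint pieces of the energy of the transform of \<open>f\<close>. The argument has three layers.

  \<^emph>\<open>Merging of intervals.\<close> As \<open>k\<close> decreases, neighbouring intervals merge at most \<open>N - 1\<close> times. This cuts
  the integers into at most \<open>N\<close> blocks of scales. The values of \<open>\<Pi>\<^sub>k[f]\<close> at the ends of the blocks form a
  sequence of length \<open>N\<close> of partial sums over disjoint frequency sets, and the Rademacher-Menshov argument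
  (lemma \<open>rademacher_menshov\<close>) bounds its 2-variation with a loss of \<open>log N\<close>. Inside a block nothing merges:
  \<open>R\<^sub>k\<close> minus the smallest set of the block consists of one-sided shells, of width less than \<open>2\<^sup>-\<^sup>k\<close>, at the
  right ends and the left ends of the clusters of intervals (lemma \<open>restr_shells\<close>), and these ends are
  separated by the largest width that occurs in the block. The blocks use disjoint sets of frequencies, so
  it suffices to estimate each block with a bound that does not depend on the block.

  \<^emph>\<open>Separated frequencies.\<close> In a block one studies \<open>\<Sum>\<^sub>j e(\<eta>\<^sub>j x) (P\<^sub>k g\<^sub>j)(x)\<close>, where \<open>e(t) = exp(2\<pi>it)\<close>, the \<open>\<eta>\<^sub>j\<close> are
  \<open>1/L\<close>-separated and \<open>P\<^sub>k\<close> cuts off to low frequencies, at scales \<open>L, 2L, 4L, \<dots>\<close>. The large sieve (lemma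
  \<open>large_sieve\<close>) says that the \<open>e(\<eta>\<^sub>j x)\<close> are almost orthogonal on every interval of length at least \<open>L\<close>.
  It allows one to replace \<open>P\<^sub>k g\<^sub>j\<close> by the averages \<open>E\<^sub>k g\<^sub>j\<close> over dyadic intervals: the deviations are square
  summable in \<open>k\<close>, since \<open>P\<^sub>k - E\<^sub>k\<close> is small on frequencies far from the scale \<open>k\<close> (lemma
  \<open>sum_deviation_energy_le\<close>).

  \<^emph>\<open>The martingale.\<close> The vectors \<open>(E\<^sub>k g\<^sub>j)\<^sub>j\<close> form a dyadic martingale. For each \<open>m\<close> let the \<open>m\<close>-th anchor
  follow it, jumping to the current value whenever the distance reaches \<open>2\<^sup>-\<^sup>m\<close> times the running
  maximum. The expected sum of the squared jumps is at most the energy, for every \<open>m\<close>. The difference of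
  the anchors of the levels \<open>m\<close> and \<open>m - 1\<close> is piecewise constant, and the square sum of its values is bounded
  by the squared jumps and the square of the initial value; hence by the large sieve the exponential sums with these coefficients have a
  2-variation bounded in \<open>L\<^sup>2\<close>, uniformly in \<open>m\<close>. By Cauchy-Schwarz these sums are also at most
  \<open>3 \<surd>N 2\<^sup>-\<^sup>m\<close> times the running maximum. Interpolation between the two bounds gives the factor
  \<open>(3 \<surd>N 2\<^sup>-\<^sup>m)\<^sup>1\<^sup>-\<^sup>2\<^sup>/\<^sup>r\<close> for the \<open>r\<close>-variation (lemma \<open>chain_var_le\<close>), and the series in \<open>m\<close> has sum
  \<open>O(N\<^sup>1\<^sup>/\<^sup>2\<^sup>-\<^sup>1\<^sup>/\<^sup>r)\<close>.

  The \<open>r\<close>-variation decreases in \<open>r\<close>, so \<open>r\<close> may be taken as close to 2 as desired; both losses are then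
  \<open>O(N\<^sup>\<epsilon>)\<close>.
\<close>


section \<open>Variation sums\<close>

text \<open>
  Away from 0 this is the convexity of \<open>x powr r\<close>; if one of the points is 0, the inequality reduces to
  \<open>u powr r \<le> u\<close> for \<open>u < 1\<close>.
\<close>

lemma powr_convex_nonneg:
  fixes x y u r :: real
  assumes "1 \<le> r" "0 \<le> x" "0 \<le> y" "0 < u" "u < 1"
  shows "(u * x + (1 - u) * y) powr r \<le> u * x powr r + (1 - u) * y powr r"
proof -
  have scale: "(v * z) powr r \<le> v * z powr r" if "0 < v" "v < 1" "0 \<le> z" for v z :: real
  proof -
    have "v powr r \<le> v powr 1"
      using that assms by (intro powr_mono') auto
    then have "v powr r * z powr r \<le> v * z powr r"
      using that by (intro mult_right_mono) auto
    then show ?thesis using that by (simp add: powr_mult)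
  qed
  consider "x = 0" | "y = 0" | "x > 0" "y > 0" using assms by linarith
  then show ?thesis
  proof cases
    case 1 then show ?thesis using scale[of "1-u" y] assms by simp
  next
    case 2 then show ?thesis using scale[of u x] assms by simp
  next
    case 3
    have "(\<lambda>x. x powr r) ((1 - (1-u)) *\<^sub>R x + (1-u) *\<^sub>R y) \<le> (1 - (1-u)) * x powr r + (1-u) * y powr r"
      using convex_onD[OF powr_convex[OF assms(1)], of "1-u" x y] 3 assms by auto
    then show ?thesis by simp
  qed
qed

text \<open>
  With \<open>F\<close> and \<open>G\<close> as bounds for the two \<open>r\<close>-norms, \<open>(f + g) / (F + G)\<close> is the convex combination of
  \<open>f / F\<close> and \<open>g / G\<close> with weights proportional to \<open>F\<close> and \<open>G\<close>, and one applies convexity entry by entry.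
\<close>

lemma minkowski_sum:
  fixes f g :: "'a \<Rightarrow> real"
  assumes r: "1 \<le> r" and fin: "finite A"
    and f: "\<And>i. i \<in> A \<Longrightarrow> 0 \<le> f i" and g: "\<And>i. i \<in> A \<Longrightarrow> 0 \<le> g i"
    and F: "0 \<le> F" "(\<Sum>i\<in>A. f i powr r) \<le> F powr r"
    and G: "0 \<le> G" "(\<Sum>i\<in>A. g i powr r) \<le> G powr r"
  shows "(\<Sum>i\<in>A. (f i + g i) powr r) \<le> (F + G) powr r"
proof -
  have zero: "h i = 0" if "(\<Sum>i\<in>A. h i powr r) \<le> 0 powr r" "i \<in> A" for h :: "'a \<Rightarrow> real" and i
  proof -
    have "(\<Sum>i\<in>A. h i powr r) = 0"
      using that(1) r by (intro antisym sum_nonneg) auto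
    then have "h i powr r = 0"
      using that(2) fin by (subst (asm) sum_nonneg_eq_0_iff) auto
    then show ?thesis using r by simp
  qed
  consider "F = 0" | "G = 0" | "F > 0" "G > 0" using F G by linarith
  then show ?thesis
  proof cases
    case 1
    then have "\<And>i. i \<in> A \<Longrightarrow> f i = 0" using zero[of f] F(2) by simp
    then show ?thesis using G(2) 1 by simp
  next
    case 2
    then have "\<And>i. i \<in> A \<Longrightarrow> g i = 0" using zero[of g] G(2) by simp
    then show ?thesis using F(2) 2 by simp
  next
    case 3
    define u where "u = F / (F + G)"
    have u: "0 < u" "u < 1" "1 - u = G / (F + G)"
      using 3 by (auto simp: u_def field_simps)
    have "((f i + g i) / (F + G)) powr r \<le> u * (f i powr r / F powr r) + (1 - u) * (g i powr r / G powr r)"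
      if "i \<in> A" for i
    proof -
      have "(f i + g i) / (F + G) = u * (f i / F) + (1 - u) * (g i / G)"
        using 3 by (simp add: u(3)) (simp add: u_def add_divide_distrib)?
      then show ?thesis
        using powr_convex_nonneg[OF r, of "f i / F" "g i / G" u] u 3 f[OF that] g[OF that]
        by (simp add: powr_divide)
    qed
    then have "(\<Sum>i\<in>A. ((f i + g i) / (F + G)) powr r)
        \<le> (\<Sum>i\<in>A. u * (f i powr r / F powr r) + (1 - u) * (g i powr r / G powr r))"
      by (rule sum_mono)
    also have "\<dots> = u * ((\<Sum>i\<in>A. f i powr r) / F powr r) + (1 - u) * ((\<Sum>i\<in>A. g i powr r) / G powr r)"
      by (simp add: sum.distrib sum_distrib_left sum_divide_distrib)
    also have "\<dots> \<le> u * 1 + (1 - u) * 1"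
      using F G 3 u by (intro add_mono mult_left_mono) (auto simp: divide_le_eq)
    finally have "(\<Sum>i\<in>A. ((f i + g i) / (F + G)) powr r) \<le> 1" by simp
    moreover have "(\<Sum>i\<in>A. ((f i + g i) / (F + G)) powr r) = (\<Sum>i\<in>A. (f i + g i) powr r) / (F + G) powr r"
      unfolding sum_divide_distrib
      using 3 f g by (intro sum.cong refl) (simp add: powr_divide)
    ultimately show ?thesis using 3 by (simp add: divide_le_eq)
  qed
qed

lemma sum_powr_le:
  fixes f :: "'a \<Rightarrow> real"
  assumes s: "0 < s" "s \<le> r" and fin: "finite A" and f: "\<And>i. i \<in> A \<Longrightarrow> 0 \<le> f i"
    and F: "0 \<le> F" "(\<Sum>i\<in>A. f i powr s) \<le> F powr s"
  shows "(\<Sum>i\<in>A. f i powr r) \<le> F powr r"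
proof -
  have le: "f i \<le> F" if "i \<in> A" for i
  proof -
    have "f i powr s \<le> (\<Sum>i\<in>A. f i powr s)"
      using that fin by (intro member_le_sum) auto
    then show ?thesis
      using F s f[OF that] by (meson leD le_less_linear order_trans powr_less_mono2)
  qed
  have "(\<Sum>i\<in>A. f i powr r) = (\<Sum>i\<in>A. f i powr s * f i powr (r - s))"
    by (simp flip: powr_add)
  also have "\<dots> \<le> (\<Sum>i\<in>A. f i powr s * F powr (r - s))"
    using le f s by (intro sum_mono mult_left_mono powr_mono2) auto
  also have "\<dots> = (\<Sum>i\<in>A. f i powr s) * F powr (r - s)"
    by (simp add: sum_distrib_right)
  also have "\<dots> \<le> F powr s * F powr (r - s)"
    using F by (intro mult_right_mono) auto
  also have "\<dots> = F powr r" by (simp flip: powr_add)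
  finally show ?thesis .
qed

text \<open>
  The chains are nondecreasing instead of strictly increasing, and they are infinite: repeated indices
  contribute zero, and in return the bound passes to \<open>a \<circ> \<phi>\<close> for every monotone \<open>\<phi>\<close>, for example for a clamping
  of the indices. There is no term for the first value, so constants have variation 0.
\<close>

definition var_le :: "real \<Rightarrow> ('i::linorder \<Rightarrow> complex) \<Rightarrow> real \<Rightarrow> bool" where
  "var_le r a X \<longleftrightarrow> 0 \<le> X \<and>
     (\<forall>t::nat \<Rightarrow> 'i. mono t \<longrightarrow> (\<forall>n. (\<Sum>j<n. cmod (a (t (Suc j)) - a (t j)) powr r) \<le> X powr r))"

lemma var_leI:
  assumes "0 \<le> X"
    "\<And>t n. mono t \<Longrightarrow> (\<Sum>j<n. cmod (a (t (Suc j)) - a (t j)) powr r) \<le> X powr r"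
  shows "var_le r a X"
  using assms by (simp add: var_le_def)

lemma var_leD:
  assumes "var_le r a X" "mono t"
  shows "(\<Sum>j<n. cmod (a (t (Suc j)) - a (t j)) powr r) \<le> X powr r"
  using assms by (simp add: var_le_def)

lemma var_le_nonneg: "var_le r a X \<Longrightarrow> 0 \<le> X"
  by (simp add: var_le_def)

lemma var_le_weaken: "var_le r a X \<Longrightarrow> X \<le> Y \<Longrightarrow> 0 < r \<Longrightarrow> var_le r a Y"
  unfolding var_le_def by (meson order_trans powr_mono2 less_imp_le)

lemma var_le_const: "var_le r (\<lambda>_. c) 0" if "0 < r"
  using that by (simp add: var_le_def)

lemma var_le_comp_mono: "var_le r a X \<Longrightarrow> mono \<phi> \<Longrightarrow> var_le r (\<lambda>k. a (\<phi> k)) X"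
  using var_leD[of r a X "\<lambda>j. \<phi> (t j)" for t] by (intro var_leI) (auto simp: mono_def var_le_nonneg)

text \<open>
  Reversing a chain turns it into a chain for the opposite order with the same increments. The index
  \<open>n - j\<close> reverses the first \<open>n\<close> steps.
\<close>

lemma var_le_comp_antimono:
  fixes \<phi> :: "'j::linorder \<Rightarrow> 'i::linorder"
  assumes a: "var_le r a X" and \<phi>: "antimono \<phi>"
  shows "var_le r (\<lambda>k. a (\<phi> k)) X"
proof (rule var_leI)
  show "0 \<le> X" using a by (rule var_le_nonneg)
  fix t :: "nat \<Rightarrow> 'j" and n assume t: "mono t"
  have "mono (\<lambda>j. \<phi> (t (n - j)))"
    using t \<phi> by (intro monoI) (simp add: mono_def antimono_def)
  from var_leD[OF a this, of n]
  have "(\<Sum>j<n. cmod (a (\<phi> (t (n - Suc j))) - a (\<phi> (t (n - j)))) powr r) \<le> X powr r" .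
  also have "(\<Sum>j<n. cmod (a (\<phi> (t (n - Suc j))) - a (\<phi> (t (n - j)))) powr r)
     = (\<Sum>j<n. cmod (a (\<phi> (t (Suc j))) - a (\<phi> (t j))) powr r)"
    by (rule sum.reindex_bij_witness[where i="\<lambda>j. n - Suc j" and j="\<lambda>j. n - Suc j"])
       (auto simp: Suc_diff_Suc norm_minus_commute)
  finally show "(\<Sum>j<n. cmod (a (\<phi> (t (Suc j))) - a (\<phi> (t j))) powr r) \<le> X powr r" .
qed

lemma var_le_add:
  assumes r: "1 \<le> r" and a: "var_le r a X" and b: "var_le r b Y"
  shows "var_le r (\<lambda>k. a k + b k) (X + Y)"
proof (rule var_leI)
  show "0 \<le> X + Y" using a b by (simp add: var_le_def)
  fix t :: "nat \<Rightarrow> 'a" and n assume t: "mono t"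
  have "(\<Sum>j<n. cmod ((a (t (Suc j)) + b (t (Suc j))) - (a (t j) + b (t j))) powr r)
     \<le> (\<Sum>j<n. (cmod (a (t (Suc j)) - a (t j)) + cmod (b (t (Suc j)) - b (t j))) powr r)"
    using r by (intro sum_mono powr_mono2) (auto intro: order_trans[OF _ norm_triangle_ineq] simp: algebra_simps)
  also have "\<dots> \<le> (X + Y) powr r"
    using var_leD[OF a t] var_leD[OF b t] var_le_nonneg[OF a] var_le_nonneg[OF b]
    by (intro minkowski_sum r) auto
  finally show "(\<Sum>j<n. cmod ((a (t (Suc j)) + b (t (Suc j))) - (a (t j) + b (t j))) powr r) \<le> (X + Y) powr r" .
qed

lemma var_le_sum:
  assumes r: "1 \<le> r" and "finite I" and "\<And>i. i \<in> I \<Longrightarrow> var_le r (a i) (X i)"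
  shows "var_le r (\<lambda>k. \<Sum>i\<in>I. a i k) (\<Sum>i\<in>I. X i)"
  using assms(2,3)
proof (induction I)
  case empty then show ?case using var_le_const[of r 0] r by simp
next
  case (insert i I)
  then show ?case using var_le_add[OF r, of "a i" "X i" "\<lambda>k. \<Sum>i\<in>I. a i k" "\<Sum>i\<in>I. X i"] by simp
qed

lemma var_le_exponent:
  assumes "var_le s a X" "0 < s" "s \<le> r"
  shows "var_le r a X"
proof (rule var_leI)
  show "0 \<le> X" using assms by (simp add: var_le_def)
  fix t :: "nat \<Rightarrow> 'a" and n assume t: "mono t"
  show "(\<Sum>j<n. cmod (a (t (Suc j)) - a (t j)) powr r) \<le> X powr r"
    using var_leD[OF assms(1) t] var_le_nonneg[OF assms(1)] assms
    by (intro sum_powr_le[of s r]) auto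
qed

lemma var_le_increment:
  assumes a: "var_le r a X" and r: "0 < r"
  shows "cmod (a i - a j) \<le> X"
proof -
  have *: "cmod (a i - a j) \<le> X" if "j \<le> i" for i j
  proof -
    have "mono (\<lambda>n::nat. if n = 0 then j else i)" using that by (auto simp: mono_def)
    from var_leD[OF a this, of 1] have "cmod (a i - a j) powr r \<le> X powr r" by simp
    then show ?thesis
      using r var_le_nonneg[OF a] by (meson norm_ge_zero leD le_less_linear order_trans powr_less_mono2)
  qed
  show ?thesis using *[of i j] *[of j i] by (metis linear norm_minus_commute)
qed

text \<open>
  An increment within one block is controlled by the variation of that block. An increment from one block to
  another is at most the sum of the bounds of the two blocks, and every block is left, and is entered, at
  most once along a chain. The factor 8 serves for all \<open>r \<ge> 1\<close>, because \<open>1 + 2 \<cdot> 2\<^sup>r \<le> 8\<^sup>r\<close>.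
\<close>

lemma var_le_blocks:
  fixes a :: "'i::linorder \<Rightarrow> complex" and \<beta> :: "'i \<Rightarrow> nat"
  assumes r: "1 \<le> r" and \<beta>: "mono \<beta>" "\<And>k. \<beta> k \<le> p"
    and a: "\<And>k. a k = A (\<beta> k) k"
    and W: "\<And>b. b \<le> p \<Longrightarrow> var_le r (A b) (W b)"
    and bound: "\<And>k. cmod (a k) \<le> W (\<beta> k)"
  shows "var_le r a (8 * (\<Sum>b\<le>p. W b powr r) powr (1 / r))"
proof (rule var_leI)
  have W0: "0 \<le> W b" if "b \<le> p" for b using var_le_nonneg[OF W[OF that]] .
  define S where "S = (\<Sum>b\<le>p. W b powr r)"
  have S0: "0 \<le> S" unfolding S_def by (intro sum_nonneg) auto
  show "0 \<le> 8 * (\<Sum>b\<le>p. W b powr r) powr (1 / r)" by simp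
  fix t :: "nat \<Rightarrow> 'i" and n assume t: "mono t"
  let ?\<Delta> = "\<lambda>j. cmod (a (t (Suc j)) - a (t j)) powr r"
  define same where "same = {j. j < n \<and> \<beta> (t j) = \<beta> (t (Suc j))}"
  define crs where "crs = {j. j < n \<and> \<beta> (t j) \<noteq> \<beta> (t (Suc j))}"
  have \<beta>t: "\<beta> (t i) \<le> \<beta> (t j)" if "i \<le> j" for i j
    using that t \<beta>(1) by (simp add: mono_def)
  have split: "{..<n} = same \<union> crs" "same \<inter> crs = {}" "finite same" "finite crs"
    by (auto simp: same_def crs_def)
  have "(\<Sum>j\<in>same. ?\<Delta> j) = (\<Sum>b\<le>p. \<Sum>j\<in>{j\<in>same. \<beta> (t j) = b}. ?\<Delta> j)"
    using split \<beta>(2) by (intro sum.group[symmetric]) auto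
  also have "\<dots> \<le> (\<Sum>b\<le>p. W b powr r)"
  proof (rule sum_mono)
    fix b assume b: "b \<in> {..p}"
    have "(\<Sum>j\<in>{j\<in>same. \<beta> (t j) = b}. ?\<Delta> j)
        = (\<Sum>j\<in>{j\<in>same. \<beta> (t j) = b}. cmod (A b (t (Suc j)) - A b (t j)) powr r)"
      by (intro sum.cong refl) (auto simp: same_def a)
    also have "\<dots> \<le> (\<Sum>j<n. cmod (A b (t (Suc j)) - A b (t j)) powr r)"
      by (intro sum_mono2) (auto simp: same_def)
    also have "\<dots> \<le> W b powr r" using var_leD[OF W t] b by auto
    finally show "(\<Sum>j\<in>{j\<in>same. \<beta> (t j) = b}. ?\<Delta> j) \<le> W b powr r" .
  qed
  finally have same_le: "(\<Sum>j\<in>same. ?\<Delta> j) \<le> S" by (simp add: S_def)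
  have inj1: "inj_on (\<lambda>j. \<beta> (t j)) crs"
  proof (rule linorder_inj_onI')
    fix i j assume "i \<in> crs" "j \<in> crs" "i < j"
    then have "\<beta> (t i) < \<beta> (t (Suc i))" "\<beta> (t (Suc i)) \<le> \<beta> (t j)"
      using \<beta>t[of i "Suc i"] \<beta>t[of "Suc i" j] by (auto simp: crs_def)
    then show "\<beta> (t i) \<noteq> \<beta> (t j)" by simp
  qed
  have inj2: "inj_on (\<lambda>j. \<beta> (t (Suc j))) crs"
  proof (rule linorder_inj_onI')
    fix i j assume "i \<in> crs" "j \<in> crs" "i < j"
    then have "\<beta> (t j) < \<beta> (t (Suc j))" "\<beta> (t (Suc i)) \<le> \<beta> (t j)"
      using \<beta>t[of j "Suc j"] \<beta>t[of "Suc i" j] by (auto simp: crs_def)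
    then show "\<beta> (t (Suc i)) \<noteq> \<beta> (t (Suc j))" by simp
  qed
  have crs_pt: "?\<Delta> j \<le> 2 powr r * (W (\<beta> (t (Suc j))) powr r + W (\<beta> (t j)) powr r)" for j
  proof -
    let ?x = "W (\<beta> (t (Suc j)))" and ?y = "W (\<beta> (t j))"
    have nn: "0 \<le> ?x" "0 \<le> ?y" using W0 \<beta>(2) by auto
    have "cmod (a (t (Suc j)) - a (t j)) \<le> cmod (a (t (Suc j))) + cmod (a (t j))"
      by (rule norm_triangle_ineq4)
    also have "\<dots> \<le> ?x + ?y" using bound by (intro add_mono)
    also have "\<dots> \<le> 2 * max ?x ?y" by simp
    finally have "?\<Delta> j \<le> (2 * max ?x ?y) powr r" using r by (intro powr_mono2) auto
    also have "\<dots> = 2 powr r * max ?x ?y powr r" using nn by (simp add: powr_mult)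
    also have "\<dots> \<le> 2 powr r * (?x powr r + ?y powr r)"
      by (intro mult_left_mono) (auto simp: max_def)
    finally show ?thesis .
  qed
  have reidx: "(\<Sum>j\<in>crs. W (h j) powr r) \<le> S" if "inj_on h crs" "h ` crs \<subseteq> {..p}" for h
  proof -
    have "(\<Sum>j\<in>crs. W (h j) powr r) = (\<Sum>b\<in>h ` crs. W b powr r)"
      using that by (simp add: sum.reindex)
    also have "\<dots> \<le> S" unfolding S_def using that by (intro sum_mono2) auto
    finally show ?thesis .
  qed
  have "(\<Sum>j\<in>crs. ?\<Delta> j) \<le> (\<Sum>j\<in>crs. 2 powr r * (W (\<beta> (t (Suc j))) powr r + W (\<beta> (t j)) powr r))"
    by (intro sum_mono crs_pt)
  also have "\<dots> = 2 powr r * ((\<Sum>j\<in>crs. W (\<beta> (t (Suc j))) powr r) + (\<Sum>j\<in>crs. W (\<beta> (t j)) powr r))"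
    by (simp only: sum_distrib_left sum.distrib distrib_left)
  also have "\<dots> \<le> 2 powr r * (S + S)"
    using reidx[OF inj1] reidx[OF inj2] \<beta>(2) by (intro mult_left_mono add_mono) auto
  finally have crs_le: "(\<Sum>j\<in>crs. ?\<Delta> j) \<le> 2 powr r * (S + S)" .
  have "(\<Sum>j<n. ?\<Delta> j) = (\<Sum>j\<in>same. ?\<Delta> j) + (\<Sum>j\<in>crs. ?\<Delta> j)"
    unfolding split(1) using split by (intro sum.union_disjoint) auto
  also have "\<dots> \<le> S + 2 powr r * (S + S)" using same_le crs_le by linarith
  also have "\<dots> \<le> 8 powr r * S"
  proof -
    have two: "2 \<le> (2::real) powr r" using powr_mono[of 1 r "2::real"] r by simp
    define q where "q = (2::real) powr r"
    have "(8::real) powr r = (2 * 2 * 2) powr r" by simp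
    then have e8: "(8::real) powr r = q * q * q" by (simp only: powr_mult q_def)
    have "1 + 2 * q \<le> q * q * q"
    proof -
      have q: "2 \<le> q" using two by (simp add: q_def)
      have "q * 4 \<le> q * (q * q)" using q mult_mono[of 2 q 2 q] by (intro mult_left_mono) auto
      moreover have "q * (q * q) = q * q * q" by (rule mult.assoc[symmetric])
      ultimately show ?thesis using q by linarith
    qed
    then have "(1 + 2 * q) * S \<le> (q * q * q) * S" using S0 by (rule mult_right_mono)
    then show ?thesis using e8 by (simp add: q_def algebra_simps)
  qed
  also have "\<dots> = (8 * S powr (1 / r)) powr r"
    using S0 r by (simp add: powr_mult powr_powr)
  finally show "(\<Sum>j<n. ?\<Delta> j) \<le> (8 * (\<Sum>b\<le>p. W b powr r) powr (1 / r)) powr r"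
    by (simp add: S_def)
qed

lemma var_le_step:
  fixes D :: "nat \<Rightarrow> complex" and \<beta> :: "'i::linorder \<Rightarrow> nat"
  assumes r: "1 \<le> r" and \<beta>: "mono \<beta>" "\<And>k. \<beta> k \<le> p"
  shows "var_le r (\<lambda>k. D (\<beta> k)) (8 * (\<Sum>b\<le>p. cmod (D b) powr r) powr (1 / r))"
  by (rule var_le_blocks[where A="\<lambda>b k. D b" and W="\<lambda>b. cmod (D b)", OF r \<beta>])
     (use r in \<open>auto intro: var_le_weaken[OF var_le_const]\<close>)

lemma powr_sum_le_l2:
  fixes f :: "'a \<Rightarrow> real"
  assumes r: "2 \<le> r" and fin: "finite A" and f: "\<And>i. i \<in> A \<Longrightarrow> 0 \<le> f i"
  shows "(\<Sum>i\<in>A. f i powr r) powr (1 / r) \<le> sqrt (\<Sum>i\<in>A. (f i)\<^sup>2)"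
proof -
  have nn: "0 \<le> (\<Sum>i\<in>A. (f i)\<^sup>2)" by (intro sum_nonneg) auto
  have "(\<Sum>i\<in>A. f i powr r) \<le> sqrt (\<Sum>i\<in>A. (f i)\<^sup>2) powr r"
    using r fin f nn by (intro sum_powr_le[of 2 r]) auto
  then have "(\<Sum>i\<in>A. f i powr r) powr (1 / r) \<le> (sqrt (\<Sum>i\<in>A. (f i)\<^sup>2) powr r) powr (1 / r)"
    using r by (intro powr_mono2 sum_nonneg) auto
  also have "\<dots> = sqrt (\<Sum>i\<in>A. (f i)\<^sup>2)" using r nn by (simp add: powr_powr)
  finally show ?thesis .
qed

text \<open>
  The \<open>r\<close>-norm is interpolated between the supremum, which is at most \<open>w B\<close>, and the 2-norm. The product of
  the powers of \<open>B\<close> and of the 2-norm is bounded by the power of their sum, so that only sums of squares have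
  to be integrated later.
\<close>

lemma powr_sum_interpolate:
  fixes f :: "'a \<Rightarrow> real"
  assumes r: "2 \<le> r" and fin: "finite A" and f: "\<And>i. i \<in> A \<Longrightarrow> 0 \<le> f i"
    and B: "0 \<le> B" and w: "0 \<le> w" and le: "\<And>i. i \<in> A \<Longrightarrow> f i \<le> w * B"
  shows "(\<Sum>i\<in>A. f i powr r) powr (1 / r) \<le> w powr (1 - 2 / r) * (B + sqrt (\<Sum>i\<in>A. (f i)\<^sup>2))"
proof -
  define Y where "Y = sqrt (\<Sum>i\<in>A. (f i)\<^sup>2)"
  have Y: "0 \<le> Y" "Y powr 2 = (\<Sum>i\<in>A. (f i)\<^sup>2)"
    unfolding Y_def by (simp_all add: sum_nonneg)
  have "(\<Sum>i\<in>A. f i powr r) = (\<Sum>i\<in>A. f i powr (r - 2) * (f i)\<^sup>2)"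
  proof (rule sum.cong[OF refl])
    fix i assume "i \<in> A"
    then have "f i powr r = f i powr (r - 2) * f i powr 2" by (simp flip: powr_add)
    then show "f i powr r = f i powr (r - 2) * (f i)\<^sup>2" using f[OF \<open>i \<in> A\<close>] by simp
  qed
  also have "\<dots> \<le> (\<Sum>i\<in>A. (w * B) powr (r - 2) * (f i)\<^sup>2)"
    using f le r by (intro sum_mono mult_right_mono powr_mono2) auto
  also have "\<dots> = w powr (r - 2) * B powr (r - 2) * Y powr 2"
    using w B by (simp add: Y powr_mult sum_distrib_left)
  also have "\<dots> \<le> w powr (r - 2) * (B + Y) powr (r - 2) * (B + Y) powr 2"
    using r B Y(1) w by (intro mult_mono mult_nonneg_nonneg powr_mono2) auto
  also have "\<dots> = w powr (r - 2) * (B + Y) powr r" by (simp add: mult.assoc flip: powr_add)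
  finally have "(\<Sum>i\<in>A. f i powr r) powr (1 / r) \<le> (w powr (r - 2) * (B + Y) powr r) powr (1 / r)"
    using r by (intro powr_mono2 sum_nonneg) auto
  also have "\<dots> = w powr ((r - 2) / r) * (B + Y)"
    using r B Y(1) by (simp add: powr_mult powr_powr)
  also have "(r - 2) / r = 1 - 2 / r" using r by (simp add: field_simps)
  finally show ?thesis by (simp add: Y_def)
qed


section \<open>Gaussian weights and the inequality of Bessel\<close>

lemma measurable_cis[measurable]: "cis \<in> borel_measurable borel"
  by (intro borel_measurable_continuous_onI continuous_intros)

lemma measurable_cnj[measurable]: "cnj \<in> borel_measurable borel"
  by (intro borel_measurable_continuous_onI continuous_intros)

text \<open>
  This is the characteristic function of the normal distribution in another normalization.
\<close>

lemma gauss_fourier: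
  fixes \<sigma> t :: real
  assumes "0 < \<sigma>"
  shows "integrable lborel (\<lambda>x. exp (- (x / \<sigma>)\<^sup>2 / 2))"
    and "(LINT x|lborel. complex_of_real (exp (- (x / \<sigma>)\<^sup>2 / 2)) * cis (t * x))
      = complex_of_real (sqrt (2 * pi) * \<sigma> * exp (- (\<sigma> * t)\<^sup>2 / 2))"
proof -
  have dens: "exp (- x\<^sup>2 / 2) = sqrt (2 * pi) * std_normal_density x" for x :: real
    by (simp add: std_normal_density_def)
  have int1: "integrable lborel (\<lambda>x::real. exp (- x\<^sup>2 / 2))"
    unfolding dens by (intro integrable_mult_right integrable_normal_density) simp
  show "integrable lborel (\<lambda>x. exp (- (x / \<sigma>)\<^sup>2 / 2))"
    using lborel_integrable_real_affine[OF int1, of "1 / \<sigma>" 0] assms by simp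
  have "(LINT x|lborel. complex_of_real (exp (- (x / \<sigma>)\<^sup>2 / 2)) * cis (t * x))
     = \<sigma> *\<^sub>R (LINT x|lborel. complex_of_real (exp (- x\<^sup>2 / 2)) * cis (\<sigma> * t * x))"
    using assms by (subst lborel_integral_real_affine[where c=\<sigma> and t=0]) (simp_all add: mult_ac)
  also have "(LINT x|lborel. complex_of_real (exp (- x\<^sup>2 / 2)) * cis (\<sigma> * t * x))
      = complex_of_real (sqrt (2 * pi)) * (LINT x|lborel. std_normal_density x *\<^sub>R iexp (\<sigma> * t * x))"
    unfolding dens by (subst integral_mult_right_zero[symmetric])
      (simp add: scaleR_conv_of_real mult_ac cis_conv_exp)
  also have "(LINT x|lborel. std_normal_density x *\<^sub>R iexp (\<sigma> * t * x)) = char std_normal_distribution (\<sigma> * t)"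
    unfolding char_def by (subst integral_density) auto
  also have "\<dots> = complex_of_real (exp (- (\<sigma> * t)\<^sup>2 / 2))"
    by (simp add: char_std_normal_distribution)
  finally show "(LINT x|lborel. complex_of_real (exp (- (x / \<sigma>)\<^sup>2 / 2)) * cis (t * x))
      = complex_of_real (sqrt (2 * pi) * \<sigma> * exp (- (\<sigma> * t)\<^sup>2 / 2))"
    by (simp add: scaleR_conv_of_real mult_ac)
qed

text \<open>
  Squaring out and integrating against the Gaussian gives a quadratic form in \<open>h\<close> with the positive
  kernel \<open>exp(-(\<sigma>(\<eta>\<^sub>i - \<eta>\<^sub>j))\<^sup>2/2)\<close>, and Schur's test bounds it by the largest row sum \<open>S\<close>. With Lebesgue measure for
  \<open>M\<close> this yields Bessel's inequality as \<open>\<sigma>\<close> tends to infinity; with a counting measure it yields the large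
  sieve.
\<close>

lemma gauss_quadratic_form:
  fixes M :: "'a measure" and \<eta> :: "'a \<Rightarrow> real" and h :: "'a \<Rightarrow> complex" and S :: ennreal
  assumes M: "sigma_finite_measure M" and \<eta>[measurable]: "\<eta> \<in> borel_measurable M"
    and h: "integrable M h" and \<sigma>: "0 < \<sigma>"
    and S: "\<And>i. i \<in> space M \<Longrightarrow> (\<integral>\<^sup>+j. ennreal (exp (- (\<sigma> * (\<eta> i - \<eta> j))\<^sup>2 / 2)) \<partial>M) \<le> S"
  shows "(\<integral>\<^sup>+x. ennreal ((cmod (LINT i|M. h i * cis (\<eta> i * x)))\<^sup>2 * exp (- (x / \<sigma>)\<^sup>2 / 2)) \<partial>lborel)
    \<le> ennreal (sqrt (2 * pi) * \<sigma>) * (S * (\<integral>\<^sup>+i. ennreal ((cmod (h i))\<^sup>2) \<partial>M))"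
proof -
  interpret M: sigma_finite_measure M by fact
  interpret MM: pair_sigma_finite M M ..
  interpret Q: pair_sigma_finite "M \<Otimes>\<^sub>M M" lborel ..
  have hm[measurable]: "h \<in> borel_measurable M" using h by auto
  define F where "F = (\<lambda>x. LINT i|M. h i * cis (\<eta> i * x))"
  define w where "w = (\<lambda>x::real. exp (- (x / \<sigma>)\<^sup>2 / 2))"
  define k where "k = (\<lambda>p. h (fst p) * cnj (h (snd p)))"
  define d where "d = (\<lambda>p. \<eta> (fst p) - \<eta> (snd p))"
  define c where "c = sqrt (2 * pi) * \<sigma>"
  define g where "g = (\<lambda>i j. exp (- (\<sigma> * (\<eta> i - \<eta> j))\<^sup>2 / 2))"
  have S': "(\<integral>\<^sup>+j. ennreal (g i j) \<partial>M) \<le> S" if "i \<in> space M" for i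
    using S[OF that] by (simp add: g_def)
  have S'': "(\<integral>\<^sup>+i. ennreal (g i j) \<partial>M) \<le> S" if "j \<in> space M" for j
    using S'[OF that] by (simp add: g_def power2_commute power_mult_distrib)
  have [measurable]: "w \<in> borel_measurable borel" unfolding w_def by measurable
  have [measurable]: "k \<in> borel_measurable (M \<Otimes>\<^sub>M M)" unfolding k_def by measurable
  have [measurable]: "d \<in> borel_measurable (M \<Otimes>\<^sub>M M)" unfolding d_def by measurable
  have [measurable]: "(\<lambda>(i, j). g i j) \<in> borel_measurable (M \<Otimes>\<^sub>M M)" unfolding g_def by measurable
  have w: "integrable lborel w" "\<And>x. 0 \<le> w x" "integral\<^sup>L lborel w = c"
    using gauss_fourier(1)[OF \<sigma>] gauss_fourier(2)[OF \<sigma>, of 0] unfolding w_def c_def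
    by (auto simp del: of_real_mult)
  have c0: "0 \<le> c" using \<sigma> by (simp add: c_def)
  have hx: "integrable M (\<lambda>i. h i * cis (\<eta> i * x))" for x
    by (rule Bochner_Integration.integrable_bound[OF h]) (auto simp: norm_mult)
  have kint: "integrable (M \<Otimes>\<^sub>M M) k"
  proof (rule MM.Fubini_integrable)
    show "integrable M (\<lambda>x. LINT y|M. norm (k (x, y)))"
      using h by (simp add: k_def norm_mult)
    show "AE x in M. integrable M (\<lambda>y. k (x, y))"
      using h by (simp add: k_def)
  qed measurable
  have kx: "integrable (M \<Otimes>\<^sub>M M) (\<lambda>p. k p * cis (d p * x))" for x
    by (rule Bochner_Integration.integrable_bound[OF kint]) (auto simp: norm_mult)
  have F2: "(LINT p|(M \<Otimes>\<^sub>M M). k p * cis (d p * x)) = complex_of_real ((cmod (F x))\<^sup>2)" for x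
  proof -
    have "(LINT p|(M \<Otimes>\<^sub>M M). k p * cis (d p * x)) = (LINT i|M. LINT j|M. k (i, j) * cis (d (i, j) * x))"
      by (rule MM.integral_fst'[OF kx, symmetric])
    also have "\<dots> = (LINT i|M. LINT j|M. (h i * cis (\<eta> i * x)) * cnj (h j * cis (\<eta> j * x)))"
      by (simp add: k_def d_def cis_cnj left_diff_distrib right_diff_distrib mult_ac cis_mult)
    also have "\<dots> = (LINT i|M. (h i * cis (\<eta> i * x)) * cnj (F x))"
    proof (intro Bochner_Integration.integral_cong refl)
      fix i
      have "(LINT j|M. (h i * cis (\<eta> i * x)) * cnj (h j * cis (\<eta> j * x)))
        = (h i * cis (\<eta> i * x)) * (LINT j|M. cnj (h j * cis (\<eta> j * x)))"
        by (rule integral_mult_right_zero)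
      also have "(LINT j|M. cnj (h j * cis (\<eta> j * x))) = cnj (F x)"
        unfolding F_def by (rule Bochner_Integration.integral_cnj)
      finally show "(LINT j|M. (h i * cis (\<eta> i * x)) * cnj (h j * cis (\<eta> j * x)))
        = (h i * cis (\<eta> i * x)) * cnj (F x)" .
    qed
    also have "\<dots> = F x * cnj (F x)" unfolding F_def by (rule integral_mult_left_zero)
    also have "\<dots> = complex_of_real ((cmod (F x))\<^sup>2)" by (rule complex_norm_square[symmetric])
    finally show ?thesis .
  qed
  define f where "f = (\<lambda>(p, x). (k p * cis (d p * x)) * complex_of_real (w x))"
  have fm[measurable]: "f \<in> borel_measurable ((M \<Otimes>\<^sub>M M) \<Otimes>\<^sub>M lborel)"
    unfolding f_def by measurable
  have fint: "integrable ((M \<Otimes>\<^sub>M M) \<Otimes>\<^sub>M lborel) f"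
  proof (rule Q.Fubini_integrable)
    show "integrable (M \<Otimes>\<^sub>M M) (\<lambda>p. LINT x|lborel. norm (f (p, x)))"
      using kint w by (simp add: f_def norm_mult)
    show "AE p in (M \<Otimes>\<^sub>M M). integrable lborel (\<lambda>x. f (p, x))"
    proof (rule AE_I2)
      fix p
      have "integrable lborel (\<lambda>x. k p * complex_of_real (w x))" using w by simp
      then show "integrable lborel (\<lambda>x. f (p, x))"
        by (rule Bochner_Integration.integrable_bound) (auto simp: norm_mult f_def)
    qed
  qed measurable
  have fint': "integrable ((M \<Otimes>\<^sub>M M) \<Otimes>\<^sub>M lborel) (\<lambda>(p, x). f (p, x))" using fint by simp
  have inner: "(LINT p|(M \<Otimes>\<^sub>M M). f (p, x)) = complex_of_real ((cmod (F x))\<^sup>2 * w x)" for x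
    using F2[of x] by (simp add: f_def)
  have outer: "(LINT x|lborel. f (p, x)) = k p * complex_of_real (c * g (fst p) (snd p))" for p
    using gauss_fourier(2)[OF \<sigma>, of "d p"]
    by (simp add: f_def w_def c_def g_def d_def mult_ac)
  have int_Fw: "integrable lborel (\<lambda>x. complex_of_real ((cmod (F x))\<^sup>2 * w x))"
    using Q.integrable_snd[OF fint'] by (simp add: inner)
  then have int_Fw': "integrable lborel (\<lambda>x. (cmod (F x))\<^sup>2 * w x)"
    using integrable_Re[OF int_Fw] by simp
  have eq: "complex_of_real (LINT x|lborel. (cmod (F x))\<^sup>2 * w x)
      = (LINT p|(M \<Otimes>\<^sub>M M). k p * complex_of_real (c * g (fst p) (snd p)))"
    using Q.Fubini_integral[OF fint'] by (simp add: inner outer del: of_real_mult flip: integral_of_real)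
  have kg: "integrable (M \<Otimes>\<^sub>M M) (\<lambda>p. k p * complex_of_real (c * g (fst p) (snd p)))"
    using Q.integrable_fst[OF fint'] by (simp add: outer)
  have "(\<integral>\<^sup>+x. ennreal ((cmod (F x))\<^sup>2 * w x) \<partial>lborel) = ennreal (LINT x|lborel. (cmod (F x))\<^sup>2 * w x)"
    using int_Fw' w by (intro nn_integral_eq_integral) auto
  also have "\<dots> = ennreal (cmod (LINT p|(M \<Otimes>\<^sub>M M). k p * complex_of_real (c * g (fst p) (snd p))))"
    unfolding eq[symmetric] using w by (simp add: integral_nonneg_AE)
  also have "\<dots> \<le> (\<integral>\<^sup>+p. ennreal (cmod (k p * complex_of_real (c * g (fst p) (snd p)))) \<partial>(M \<Otimes>\<^sub>M M))"
    by (rule integral_norm_bound_ennreal[OF kg])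
  also have "\<dots> \<le> (\<integral>\<^sup>+p. ennreal (c / 2) * (ennreal ((cmod (h (fst p)))\<^sup>2) * ennreal (g (fst p) (snd p))
        + ennreal ((cmod (h (snd p)))\<^sup>2) * ennreal (g (fst p) (snd p))) \<partial>(M \<Otimes>\<^sub>M M))"
  proof (rule nn_integral_mono)
    fix p
    let ?a = "cmod (h (fst p))" and ?b = "cmod (h (snd p))" and ?g = "g (fst p) (snd p)"
    have g0: "0 \<le> ?g" by (simp add: g_def)
    have "?a * ?b \<le> (?a\<^sup>2 + ?b\<^sup>2) / 2"
      using sum_squares_bound[of ?a ?b] by simp
    then have "?a * ?b * (c * ?g) \<le> (?a\<^sup>2 + ?b\<^sup>2) / 2 * (c * ?g)"
      using c0 g0 by (intro mult_right_mono) auto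
    then have "cmod (k p * complex_of_real (c * ?g)) \<le> c / 2 * (?a\<^sup>2 * ?g + ?b\<^sup>2 * ?g)"
      using c0 g0 by (simp add: k_def norm_mult abs_mult algebra_simps add_divide_distrib)
    then show "ennreal (cmod (k p * complex_of_real (c * ?g)))
       \<le> ennreal (c / 2) * (ennreal (?a\<^sup>2) * ennreal ?g + ennreal (?b\<^sup>2) * ennreal ?g)"
      using c0 g0 by (simp add: ennreal_mult'[symmetric] ennreal_plus[symmetric] del: ennreal_plus)
  qed
  also have "\<dots> = ennreal (c / 2) * ((\<integral>\<^sup>+p. ennreal ((cmod (h (fst p)))\<^sup>2) * ennreal (g (fst p) (snd p)) \<partial>(M \<Otimes>\<^sub>M M))
        + (\<integral>\<^sup>+p. ennreal ((cmod (h (snd p)))\<^sup>2) * ennreal (g (fst p) (snd p)) \<partial>(M \<Otimes>\<^sub>M M)))"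
    unfolding g_def by (subst nn_integral_cmult, measurable, subst nn_integral_add) auto
  also have "(\<integral>\<^sup>+p. ennreal ((cmod (h (fst p)))\<^sup>2) * ennreal (g (fst p) (snd p)) \<partial>(M \<Otimes>\<^sub>M M))
     = (\<integral>\<^sup>+i. ennreal ((cmod (h i))\<^sup>2) * (\<integral>\<^sup>+j. ennreal (g i j) \<partial>M) \<partial>M)"
    unfolding g_def by (subst M.nn_integral_fst[symmetric], measurable, subst nn_integral_cmult[symmetric]) auto
  also have "(\<integral>\<^sup>+p. ennreal ((cmod (h (snd p)))\<^sup>2) * ennreal (g (fst p) (snd p)) \<partial>(M \<Otimes>\<^sub>M M))
     = (\<integral>\<^sup>+j. ennreal ((cmod (h j))\<^sup>2) * (\<integral>\<^sup>+i. ennreal (g i j) \<partial>M) \<partial>M)"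
    unfolding g_def by (subst MM.nn_integral_snd[symmetric], measurable, subst nn_integral_cmult[symmetric]) auto
  also have "ennreal (c / 2) * ((\<integral>\<^sup>+i. ennreal ((cmod (h i))\<^sup>2) * (\<integral>\<^sup>+j. ennreal (g i j) \<partial>M) \<partial>M)
     + (\<integral>\<^sup>+j. ennreal ((cmod (h j))\<^sup>2) * (\<integral>\<^sup>+i. ennreal (g i j) \<partial>M) \<partial>M))
     \<le> ennreal (c / 2) * ((\<integral>\<^sup>+i. ennreal ((cmod (h i))\<^sup>2) * S \<partial>M) + (\<integral>\<^sup>+i. ennreal ((cmod (h i))\<^sup>2) * S \<partial>M))"
    using S' S'' by (intro mult_left_mono add_mono nn_integral_mono) auto
  also have "\<dots> = ennreal c * (S * (\<integral>\<^sup>+i. ennreal ((cmod (h i))\<^sup>2) \<partial>M))"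
  proof -
    have 1: "(\<integral>\<^sup>+i. ennreal ((cmod (h i))\<^sup>2) * S \<partial>M) = S * (\<integral>\<^sup>+i. ennreal ((cmod (h i))\<^sup>2) \<partial>M)"
      by (subst nn_integral_multc) (auto simp: mult.commute)
    have "ennreal (c / 2) * (y + y) = ennreal c * y" for y
    proof -
      have "ennreal (c / 2) * (y + y) = (ennreal (c / 2) + ennreal (c / 2)) * y"
        by (simp add: distrib_left distrib_right)
      also have "ennreal (c / 2) + ennreal (c / 2) = ennreal c"
        using c0 by (simp add: ennreal_plus[symmetric] del: ennreal_plus)
      finally show ?thesis .
    qed
    then show ?thesis by (simp only: 1)
  qed
  finally show ?thesis by (simp add: F_def w_def c_def)
qed

definition energy :: "(real \<Rightarrow> complex) \<Rightarrow> ennreal" where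
  "energy f = (\<integral>\<^sup>+x. ennreal ((cmod (f x))\<^sup>2) \<partial>lborel)"

lemma nn_integral_le_of_tendsto:
  fixes f :: "nat \<Rightarrow> 'a \<Rightarrow> ennreal"
  assumes [measurable]: "\<And>n. f n \<in> borel_measurable M"
    and lim: "AE x in M. (\<lambda>n. f n x) \<longlonglongrightarrow> g x"
    and le: "eventually (\<lambda>n. (\<integral>\<^sup>+x. f n x \<partial>M) \<le> C) sequentially"
  shows "(\<integral>\<^sup>+x. g x \<partial>M) \<le> C"
proof -
  have "(\<integral>\<^sup>+x. g x \<partial>M) = (\<integral>\<^sup>+x. liminf (\<lambda>n. f n x) \<partial>M)"
    using lim by (intro nn_integral_cong_AE) (auto simp: lim_imp_Liminf)
  also have "\<dots> \<le> liminf (\<lambda>n. \<integral>\<^sup>+x. f n x \<partial>M)" by (rule nn_integral_liminf) measurable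
  also have "\<dots> \<le> C" using le by (intro Liminf_le) auto
  finally show ?thesis .
qed

lemma measurable_fourier[measurable]:
  assumes [measurable]: "h \<in> borel_measurable borel"
  shows "(\<lambda>x. LINT y|lborel. h y * cis (a * y * x)) \<in> borel_measurable borel"
  by measurable

text \<open>
  For every \<open>\<sigma>\<close> the Gaussian weight leads to the constant 1, since the normalizations of the weight and of its
  transform cancel; then \<open>\<sigma>\<close> tends to infinity. The sign \<open>s\<close> covers the transform and the inverse
  transform.
\<close>

lemma bessel:
  fixes h :: "real \<Rightarrow> complex"
  assumes h: "integrable lborel h" and s: "\<bar>s\<bar> = 1"
  shows "energy (\<lambda>x. LINT y|lborel. h y * cis (s * 2 * pi * y * x)) \<le> energy h"
proof -
  have [measurable]: "h \<in> borel_measurable borel" using h by auto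
  define F where "F = (\<lambda>x. LINT y|lborel. h y * cis (s * 2 * pi * y * x))"
  have [measurable]: "F \<in> borel_measurable borel" unfolding F_def by measurable
  have approx: "(\<integral>\<^sup>+x. ennreal ((cmod (F x))\<^sup>2 * exp (- (x / \<sigma>)\<^sup>2 / 2)) \<partial>lborel) \<le> energy h" if \<sigma>: "0 < \<sigma>" for \<sigma> :: real
  proof -
    define S where "S = ennreal (sqrt (2 * pi) / (2 * pi * \<sigma>))"
    have S: "(\<integral>\<^sup>+z. ennreal (exp (- (\<sigma> * (s * 2 * pi * y - s * 2 * pi * z))\<^sup>2 / 2)) \<partial>lborel) \<le> S" for y
    proof -
      define \<tau> where "\<tau> = 1 / (2 * pi * \<sigma>)"
      have \<tau>: "0 < \<tau>" using \<sigma> by (simp add: \<tau>_def)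
      have s2: "s * s = 1" using s by (metis abs_mult_self_eq mult_1)
      have e: "(\<sigma> * (s * 2 * pi * y - s * 2 * pi * z))\<^sup>2 = ((y - z) / \<tau>)\<^sup>2" for z
      proof -
        have "(\<sigma> * (s * 2 * pi * y - s * 2 * pi * z)) = s * ((y - z) / \<tau>)"
          using \<sigma> by (simp add: \<tau>_def field_simps)
        then show ?thesis using s2 by (simp add: power_mult_distrib power2_eq_square)
      qed
      have "(\<integral>\<^sup>+z. ennreal (exp (- ((y - z) / \<tau>)\<^sup>2 / 2)) \<partial>lborel) = (\<integral>\<^sup>+z. ennreal (exp (- (z / \<tau>)\<^sup>2 / 2)) \<partial>lborel)"
        by (subst nn_integral_real_affine[where c="-1" and t=y]) auto
      also have "\<dots> = ennreal (LINT z|lborel. exp (- (z / \<tau>)\<^sup>2 / 2))"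
        by (intro nn_integral_eq_integral gauss_fourier \<tau>) auto
      also have "(LINT z|lborel. exp (- (z / \<tau>)\<^sup>2 / 2)) = sqrt (2 * pi) * \<tau>"
        using gauss_fourier(2)[OF \<tau>, of 0] by (simp del: of_real_mult)
      finally show ?thesis unfolding e S_def \<tau>_def by simp
    qed
    have "(\<integral>\<^sup>+x. ennreal ((cmod (F x))\<^sup>2 * exp (- (x / \<sigma>)\<^sup>2 / 2)) \<partial>lborel)
      \<le> ennreal (sqrt (2 * pi) * \<sigma>) * (S * energy h)"
      unfolding F_def energy_def
      by (rule gauss_quadratic_form[where \<eta>="\<lambda>y. s * 2 * pi * y", OF _ _ h \<sigma> S])
         (auto intro: sigma_finite_lborel)
    also have "\<dots> = energy h"
    proof -
      have "sqrt (2 * pi) * \<sigma> * (sqrt (2 * pi) / (2 * pi * \<sigma>)) = 1" using \<sigma> by simp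
      then show ?thesis unfolding S_def mult.assoc[symmetric] using \<sigma>
        by (simp add: ennreal_mult'[symmetric])
    qed
    finally show ?thesis .
  qed
  show ?thesis unfolding F_def[symmetric] energy_def[of F]
  proof (rule nn_integral_le_of_tendsto)
    let ?f = "\<lambda>n x. ennreal ((cmod (F x))\<^sup>2 * exp (- (x / real (Suc n))\<^sup>2 / 2))"
    show "?f n \<in> borel_measurable lborel" for n by measurable
    show "\<forall>\<^sub>F n in sequentially. (\<integral>\<^sup>+x. ?f n x \<partial>lborel) \<le> energy h"
      using approx by (intro always_eventually) auto
    show "AE x in lborel. (\<lambda>n. ?f n x) \<longlonglongrightarrow> ennreal ((cmod (F x))\<^sup>2)"
    proof (rule AE_I2)
      fix x :: real
      have "(\<lambda>n. x / real (Suc n)) \<longlonglongrightarrow> 0"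
        by (rule LIMSEQ_Suc[OF lim_const_over_n])
      then have "(\<lambda>n. exp (- (x / real (Suc n))\<^sup>2 / 2)) \<longlonglongrightarrow> exp (- 0\<^sup>2 / 2)"
        by (intro tendsto_intros) auto
      then have "(\<lambda>n. (cmod (F x))\<^sup>2 * exp (- (x / real (Suc n))\<^sup>2 / 2)) \<longlonglongrightarrow> (cmod (F x))\<^sup>2 * 1"
        by (intro tendsto_mult tendsto_const) simp
      then show "(\<lambda>n. ?f n x) \<longlonglongrightarrow> ennreal ((cmod (F x))\<^sup>2)" by simp
    qed
  qed
qed


section \<open>The large sieve\<close>

definition trig_sum :: "(nat \<Rightarrow> real) \<Rightarrow> nat set \<Rightarrow> (nat \<Rightarrow> complex) \<Rightarrow> real \<Rightarrow> complex" where
  "trig_sum \<eta> J u x = (\<Sum>j\<in>J. u j * cis (2 * pi * \<eta> j * x))"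

text \<open>
  The factors come from bounding the indicator of an interval by a Gaussian, from the integral of the
  Gaussian and from the row sums of the kernel.
\<close>

definition sieve_const :: real where
  "sieve_const = exp (1 / 2) * (sqrt (2 * pi) * (4 * exp 1))"

lemma sieve_const_pos: "0 < sieve_const"
  by (simp add: sieve_const_def)

lemma sum_exp_neg_abs_le:
  assumes "finite P"
  shows "(\<Sum>p\<in>P. exp (- \<bar>real_of_int p\<bar>)) \<le> 4"
proof -
  have geo: "(\<Sum>n\<in>A. exp (- real n)) \<le> 2" if "finite A" for A
  proof -
    have e: "exp (- real n) = exp (- 1) ^ n" for n
      by (simp flip: exp_of_nat_mult)
    have half: "exp (- 1 :: real) \<le> 1 / 2"
      using exp_ge_add_one_self[of 1] by (simp add: exp_minus field_simps)
    have "(\<Sum>n\<in>A. exp (- real n)) \<le> (\<Sum>n. exp (- 1 :: real) ^ n)"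
      unfolding e using half that by (intro sum_le_suminf summable_geometric) auto
    also have "\<dots> = 1 / (1 - exp (- 1))" using half by (intro suminf_geometric) auto
    also have "\<dots> \<le> 2" using half by (simp add: field_simps)
    finally show ?thesis .
  qed
  have "(\<Sum>p\<in>P. exp (- \<bar>real_of_int p\<bar>))
     = (\<Sum>p\<in>{p\<in>P. 0 \<le> p}. exp (- \<bar>real_of_int p\<bar>)) + (\<Sum>p\<in>{p\<in>P. p < 0}. exp (- \<bar>real_of_int p\<bar>))"
    using assms by (subst sum.union_disjoint[symmetric]) (auto intro!: sum.cong)
  also have "(\<Sum>p\<in>{p\<in>P. 0 \<le> p}. exp (- \<bar>real_of_int p\<bar>)) = (\<Sum>n\<in>nat ` {p\<in>P. 0 \<le> p}. exp (- real n))"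
    by (subst sum.reindex) (auto simp: inj_on_def)
  also have "(\<Sum>p\<in>{p\<in>P. p < 0}. exp (- \<bar>real_of_int p\<bar>)) = (\<Sum>n\<in>(\<lambda>p. nat (- p)) ` {p\<in>P. p < 0}. exp (- real n))"
    by (subst sum.reindex) (auto simp: inj_on_def)
  finally show ?thesis
    using geo[of "nat ` {p\<in>P. 0 \<le> p}"] geo[of "(\<lambda>p. nat (- p)) ` {p\<in>P. p < 0}"] assms by simp
qed

text \<open>
  The integer parts of points with mutual distance at least 1 are distinct, so that the sum is dominated by
  a sum over distinct integers.
\<close>

lemma gauss_sum_separated:
  fixes y :: "nat \<Rightarrow> real"
  assumes J: "finite J" "i \<in> J" and sep: "\<And>i j. i \<in> J \<Longrightarrow> j \<in> J \<Longrightarrow> i \<noteq> j \<Longrightarrow> 1 \<le> \<bar>y i - y j\<bar>"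
  shows "(\<Sum>j\<in>J. exp (- (2 * pi * (y i - y j))\<^sup>2 / 2)) \<le> 4 * exp 1"
proof -
  define p where "p = (\<lambda>j. \<lfloor>y j\<rfloor> - \<lfloor>y i\<rfloor>)"
  have inj: "inj_on p J"
  proof (rule inj_onI)
    fix j k assume jk: "j \<in> J" "k \<in> J" "p j = p k"
    then have "\<lfloor>y j\<rfloor> = \<lfloor>y k\<rfloor>" by (simp add: p_def)
    then have "\<bar>y j - y k\<bar> < 1" by linarith
    then show "j = k" using sep[OF jk(1,2)] by force
  qed
  have le: "exp (- (2 * pi * (y i - y j))\<^sup>2 / 2) \<le> exp 1 * exp (- \<bar>real_of_int (p j)\<bar>)" for j
  proof -
    define u where "u = y i - y j"
    have u: "\<bar>real_of_int (p j)\<bar> - 1 \<le> \<bar>u\<bar>"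
      unfolding p_def u_def by linarith
    have "\<bar>real_of_int (p j)\<bar> - 1 \<le> u\<^sup>2"
    proof (cases "\<bar>p j\<bar> \<le> 1")
      case True
      then have "\<bar>real_of_int (p j)\<bar> - 1 \<le> 0" by linarith
      also have "0 \<le> u\<^sup>2" by simp
      finally show ?thesis .
    next
      case False
      then have "1 \<le> \<bar>real_of_int (p j)\<bar> - 1" by linarith
      then have "1 \<le> \<bar>u\<bar>" using u by linarith
      then have "\<bar>u\<bar> * 1 \<le> \<bar>u\<bar> * \<bar>u\<bar>" by (intro mult_left_mono) auto
      then show ?thesis using u by (simp add: power2_eq_square)
    qed
    moreover have "u\<^sup>2 \<le> (2 * pi * u)\<^sup>2 / 2"
    proof -
      have "1 * 1 \<le> pi * pi" using pi_gt3 by (intro mult_mono) auto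
      then have "1 * u\<^sup>2 \<le> (2 * (pi * pi)) * u\<^sup>2" by (intro mult_right_mono) auto
      then show ?thesis by (simp add: power2_eq_square mult_ac)
    qed
    ultimately have "- (2 * pi * u)\<^sup>2 / 2 \<le> 1 + - \<bar>real_of_int (p j)\<bar>" by linarith
    then show ?thesis by (simp add: u_def flip: exp_add)
  qed
  have "(\<Sum>j\<in>J. exp (- (2 * pi * (y i - y j))\<^sup>2 / 2)) \<le> (\<Sum>j\<in>J. exp 1 * exp (- \<bar>real_of_int (p j)\<bar>))"
    by (intro sum_mono le)
  also have "\<dots> = exp 1 * (\<Sum>q\<in>p ` J. exp (- \<bar>real_of_int q\<bar>))"
    using inj by (simp add: sum_distrib_left sum.reindex)
  also have "\<dots> \<le> exp 1 * 4" using J by (intro mult_left_mono sum_exp_neg_abs_le) auto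
  finally show ?thesis by simp
qed

text \<open>
  On an interval of length \<open>\<Lambda>\<close> the indicator function is dominated by \<open>exp(1/2)\<close> times a Gaussian of width
  \<open>\<Lambda>\<close>, placed at the left end point. In units of \<open>1/\<Lambda>\<close> the frequencies are 1-separated, and the row sums of the
  Gaussian kernel are bounded.
\<close>

lemma large_sieve:
  fixes c :: "nat \<Rightarrow> complex"
  assumes J: "finite J" and L: "0 < L" "L \<le> \<Lambda>"
    and sep: "\<And>i j. i \<in> J \<Longrightarrow> j \<in> J \<Longrightarrow> i \<noteq> j \<Longrightarrow> 1 / L \<le> \<bar>\<eta> i - \<eta> j\<bar>"
  shows "(\<integral>\<^sup>+x. ennreal ((cmod (trig_sum \<eta> J c x))\<^sup>2) * indicator {a..<a + \<Lambda>} x \<partial>lborel)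
    \<le> ennreal (sieve_const * \<Lambda> * (\<Sum>j\<in>J. (cmod (c j))\<^sup>2))"
proof -
  have \<Lambda>: "0 < \<Lambda>" using L by linarith
  define h where "h = (\<lambda>j. c j * cis (2 * pi * \<eta> j * a))"
  define \<theta> where "\<theta> = (\<lambda>j. 2 * pi * \<eta> j)"
  have cmh: "cmod (h j) = cmod (c j)" for j by (simp add: h_def norm_mult)
  have S: "(\<integral>\<^sup>+j. ennreal (exp (- (\<Lambda> * (\<theta> i - \<theta> j))\<^sup>2 / 2)) \<partial>count_space J) \<le> ennreal (4 * exp 1)"
    if "i \<in> space (count_space J)" for i
  proof -
    have "1 \<le> \<bar>\<Lambda> * \<eta> i - \<Lambda> * \<eta> j\<bar>" if "i \<in> J" "j \<in> J" "i \<noteq> j" for i j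
    proof -
      have "1 \<le> L * \<bar>\<eta> i - \<eta> j\<bar>" using sep[OF that] L by (simp add: field_simps)
      also have "\<dots> \<le> \<Lambda> * \<bar>\<eta> i - \<eta> j\<bar>" using L by (intro mult_right_mono) auto
      also have "\<dots> = \<bar>\<Lambda> * \<eta> i - \<Lambda> * \<eta> j\<bar>" using \<Lambda> by (simp add: abs_mult flip: right_diff_distrib)
      finally show ?thesis .
    qed
    from gauss_sum_separated[of J i "\<lambda>j. \<Lambda> * \<eta> j", OF J _ this]
    have "(\<Sum>j\<in>J. exp (- (2 * pi * (\<Lambda> * \<eta> i - \<Lambda> * \<eta> j))\<^sup>2 / 2)) \<le> 4 * exp 1" using that by simp
    also have "(\<lambda>j. 2 * pi * (\<Lambda> * \<eta> i - \<Lambda> * \<eta> j)) = (\<lambda>j. \<Lambda> * (\<theta> i - \<theta> j))"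
      by (simp add: \<theta>_def algebra_simps)
    finally show ?thesis
      using J by (simp add: nn_integral_count_space_finite sum_ennreal ennreal_leI)
  qed
  have meas: "(\<lambda>y. \<Sum>j\<in>J. h j * cis (\<theta> j * y)) \<in> borel_measurable borel" by measurable
  have shift: "trig_sum \<eta> J c (a + 1 * y) = (\<Sum>j\<in>J. h j * cis (\<theta> j * y))" for y
    by (simp add: trig_sum_def h_def \<theta>_def mult.assoc distrib_left cis_mult)
  have "(\<integral>\<^sup>+x. ennreal ((cmod (trig_sum \<eta> J c x))\<^sup>2) * indicator {a..<a + \<Lambda>} x \<partial>lborel)
    = (\<integral>\<^sup>+y. ennreal ((cmod (\<Sum>j\<in>J. h j * cis (\<theta> j * y)))\<^sup>2) * indicator {a..<a + \<Lambda>} (a + 1 * y) \<partial>lborel)"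
    unfolding shift[symmetric]
    by (subst nn_integral_real_affine[where c=1 and t=a]) (auto simp: trig_sum_def)
  also have "\<dots> \<le> (\<integral>\<^sup>+y. ennreal (exp (1/2)) * ennreal ((cmod (\<Sum>j\<in>J. h j * cis (\<theta> j * y)))\<^sup>2 * exp (- (y / \<Lambda>)\<^sup>2 / 2)) \<partial>lborel)"
  proof (rule nn_integral_mono)
    fix y :: real
    let ?A = "(cmod (\<Sum>j\<in>J. h j * cis (\<theta> j * y)))\<^sup>2"
    have "?A \<le> exp (1/2) * (?A * exp (- (y / \<Lambda>)\<^sup>2 / 2))" if "0 \<le> y" "y < \<Lambda>"
    proof -
      have "(y / \<Lambda>)\<^sup>2 \<le> 1\<^sup>2" using that \<Lambda> by (intro power_mono) auto
      then have "1 \<le> exp (1/2 + - (y / \<Lambda>)\<^sup>2 / 2)" by simp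
      then have "?A * 1 \<le> ?A * exp (1/2 + - (y / \<Lambda>)\<^sup>2 / 2)" by (intro mult_left_mono) auto
      then show ?thesis unfolding exp_add by (simp add: mult_ac)
    qed
    then show "ennreal ?A * indicator {a..<a + \<Lambda>} (a + 1 * y)
      \<le> ennreal (exp (1/2)) * ennreal (?A * exp (- (y / \<Lambda>)\<^sup>2 / 2))"
      by (auto simp: indicator_def ennreal_mult'[symmetric] intro!: ennreal_leI)
  qed
  also have "\<dots> = ennreal (exp (1/2)) * (\<integral>\<^sup>+y. ennreal ((cmod (\<Sum>j\<in>J. h j * cis (\<theta> j * y)))\<^sup>2 * exp (- (y / \<Lambda>)\<^sup>2 / 2)) \<partial>lborel)"
    by (subst nn_integral_cmult) (use meas in measurable)
  also have "(\<integral>\<^sup>+y. ennreal ((cmod (\<Sum>j\<in>J. h j * cis (\<theta> j * y)))\<^sup>2 * exp (- (y / \<Lambda>)\<^sup>2 / 2)) \<partial>lborel)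
     \<le> ennreal (sqrt (2 * pi) * \<Lambda>) * (ennreal (4 * exp 1) * (\<integral>\<^sup>+j. ennreal ((cmod (h j))\<^sup>2) \<partial>count_space J))"
    using gauss_quadratic_form[of "count_space J" \<theta> h \<Lambda> "ennreal (4 * exp 1)", OF _ _ _ \<Lambda> S] J
    by (simp add: sigma_finite_measure_count_space_finite integrable_count_space lebesgue_integral_count_space_finite)
  also have "ennreal (exp (1/2)) * (ennreal (sqrt (2 * pi) * \<Lambda>) * (ennreal (4 * exp 1) * (\<integral>\<^sup>+j. ennreal ((cmod (h j))\<^sup>2) \<partial>count_space J)))
    = ennreal (sieve_const * \<Lambda> * (\<Sum>j\<in>J. (cmod (c j))\<^sup>2))"
    using J \<Lambda> by (simp add: nn_integral_count_space_finite sum_ennreal sieve_const_def cmh sum_nonneg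
        ennreal_mult'[symmetric] mult_ac)
  finally show ?thesis by (simp add: mult_left_mono)
qed

section \<open>Synthesis of band-limited functions\<close>

definition synth :: "(real \<Rightarrow> complex) \<Rightarrow> real \<Rightarrow> complex" where
  "synth G x = (LINT \<omega>|lborel. G \<omega> * cis (2 * pi * \<omega> * x))"

definition bandlim :: "real \<Rightarrow> (real \<Rightarrow> complex) \<Rightarrow> bool" where
  "bandlim R G \<longleftrightarrow> G \<in> borel_measurable borel \<and> energy G < \<infinity> \<and> (\<forall>\<omega>. R < \<bar>\<omega>\<bar> \<longrightarrow> G \<omega> = 0)"

lemma bandlim_measurable: "bandlim R G \<Longrightarrow> G \<in> borel_measurable borel"
  by (simp add: bandlim_def)

lemma measurable_synth[measurable (raw)]:
  assumes "G \<in> borel_measurable borel"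
  shows "synth G \<in> borel_measurable borel"
  unfolding synth_def using assms by measurable

text \<open>
  On a bounded set, \<open>|G| \<le> 1 + |G|\<^sup>2\<close> suffices.
\<close>

lemma bandlim_integrable:
  assumes G: "bandlim R G"
  shows "integrable lborel G"
proof (rule integrableI_bounded)
  have [measurable]: "G \<in> borel_measurable borel" using G by (rule bandlim_measurable)
  show "G \<in> borel_measurable lborel" by simp
  have "(\<integral>\<^sup>+x. ennreal (norm (G x)) \<partial>lborel) \<le> (\<integral>\<^sup>+x. indicator {-R..R} x + ennreal ((cmod (G x))\<^sup>2) \<partial>lborel)"
  proof (rule nn_integral_mono)
    fix x
    have "cmod (G x) \<le> 1 + (cmod (G x))\<^sup>2"
      using sum_squares_bound[of "cmod (G x)" 1] norm_ge_zero[of "G x"] by (simp del: norm_ge_zero)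
    then have "ennreal (cmod (G x)) \<le> 1 + ennreal ((cmod (G x))\<^sup>2)"
      by (metis ennreal_1 ennreal_leI ennreal_plus zero_le_one zero_le_power2)
    then show "ennreal (norm (G x)) \<le> indicator {-R..R} x + ennreal ((cmod (G x))\<^sup>2)"
      using G by (cases "x \<in> {-R..R}") (auto simp: bandlim_def)
  qed
  also have "\<dots> = emeasure lborel {-R..R} + energy G"
    unfolding energy_def by (subst nn_integral_add) auto
  also have "\<dots> < \<infinity>" using G by (auto simp: bandlim_def emeasure_lborel_Icc_eq)
  finally show "(\<integral>\<^sup>+x. ennreal (norm (G x)) \<partial>lborel) < \<infinity>" .
qed

lemma energy_synth_le:
  assumes "integrable lborel G"
  shows "energy (synth G) \<le> energy G"
  using bessel[OF assms, of 1] by (simp add: synth_def[abs_def])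

lemma energy_mult_le:
  assumes [measurable]: "G \<in> borel_measurable borel"
    and le: "\<And>\<omega>. G \<omega> \<noteq> 0 \<Longrightarrow> cmod (\<phi> \<omega>) \<le> K"
  shows "energy (\<lambda>\<omega>. \<phi> \<omega> * G \<omega>) \<le> ennreal (K\<^sup>2) * energy G"
proof -
  have "energy (\<lambda>\<omega>. \<phi> \<omega> * G \<omega>) \<le> (\<integral>\<^sup>+x. ennreal (K\<^sup>2) * ennreal ((cmod (G x))\<^sup>2) \<partial>lborel)"
    unfolding energy_def
  proof (rule nn_integral_mono)
    fix x
    have "(cmod (\<phi> x * G x))\<^sup>2 \<le> K\<^sup>2 * (cmod (G x))\<^sup>2"
      using le[of x] by (cases "G x = 0") (auto simp: norm_mult power_mult_distrib intro!: mult_right_mono power_mono)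
    then show "ennreal ((cmod (\<phi> x * G x))\<^sup>2) \<le> ennreal (K\<^sup>2) * ennreal ((cmod (G x))\<^sup>2)"
      by (simp add: ennreal_mult'[symmetric] ennreal_leI)
  qed
  then show ?thesis unfolding energy_def by (simp add: nn_integral_cmult)
qed

lemma bandlim_mult:
  assumes G: "bandlim R G" and [measurable]: "\<phi> \<in> borel_measurable borel"
    and le: "\<And>\<omega>. G \<omega> \<noteq> 0 \<Longrightarrow> cmod (\<phi> \<omega>) \<le> K"
  shows "bandlim R (\<lambda>\<omega>. \<phi> \<omega> * G \<omega>)"
proof -
  have [measurable]: "G \<in> borel_measurable borel" using G by (rule bandlim_measurable)
  have "energy (\<lambda>\<omega>. \<phi> \<omega> * G \<omega>) \<le> ennreal (K\<^sup>2) * energy G"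
    using le by (intro energy_mult_le) auto
  also have "\<dots> < \<infinity>" using G by (auto simp: bandlim_def ennreal_mult_less_top)
  finally show ?thesis using G by (auto simp: bandlim_def)
qed

lemma energy_add_le:
  assumes [measurable]: "f \<in> borel_measurable borel" "g \<in> borel_measurable borel"
  shows "energy (\<lambda>x. f x + g x) \<le> 2 * energy f + 2 * energy g"
proof -
  have "energy (\<lambda>x. f x + g x) \<le> (\<integral>\<^sup>+x. 2 * ennreal ((cmod (f x))\<^sup>2) + 2 * ennreal ((cmod (g x))\<^sup>2) \<partial>lborel)"
    unfolding energy_def
  proof (rule nn_integral_mono)
    fix x
    have "(cmod (f x + g x))\<^sup>2 \<le> (cmod (f x) + cmod (g x))\<^sup>2"
      by (intro power_mono norm_triangle_ineq) auto
    also have "\<dots> \<le> 2 * (cmod (f x))\<^sup>2 + 2 * (cmod (g x))\<^sup>2"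
      using sum_squares_bound[of "cmod (f x)" "cmod (g x)"] by (simp add: power2_sum)
    finally have "ennreal ((cmod (f x + g x))\<^sup>2) \<le> ennreal (2 * (cmod (f x))\<^sup>2 + 2 * (cmod (g x))\<^sup>2)"
      by (rule ennreal_leI)
    then show "ennreal ((cmod (f x + g x))\<^sup>2) \<le> 2 * ennreal ((cmod (f x))\<^sup>2) + 2 * ennreal ((cmod (g x))\<^sup>2)"
      by (simp add: ennreal_plus ennreal_mult)
  qed
  then show ?thesis unfolding energy_def by (simp add: nn_integral_add nn_integral_cmult)
qed

lemma bandlim_sum:
  assumes "finite J" "\<And>j. j \<in> J \<Longrightarrow> bandlim R (G j)"
  shows "bandlim R (\<lambda>\<omega>. \<Sum>j\<in>J. G j \<omega>)"
  using assms
proof (induction J)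
  case empty then show ?case by (simp add: bandlim_def energy_def)
next
  case (insert i J)
  have b: "bandlim R (G i)" "bandlim R (\<lambda>\<omega>. \<Sum>j\<in>J. G j \<omega>)" using insert by auto
  note [measurable] = b[THEN bandlim_measurable]
  have "energy (\<lambda>\<omega>. G i \<omega> + (\<Sum>j\<in>J. G j \<omega>)) \<le> 2 * energy (G i) + 2 * energy (\<lambda>\<omega>. \<Sum>j\<in>J. G j \<omega>)"
    by (rule energy_add_le) measurable
  also have "\<dots> < \<infinity>" using b by (auto simp: bandlim_def ennreal_mult_less_top)
  finally show ?case using b insert(1,2) by (auto simp: bandlim_def)
qed

lemma integrable_mult_cis:
  fixes G :: "real \<Rightarrow> complex"
  assumes G: "integrable lborel G"
  shows "integrable lborel (\<lambda>\<omega>. G \<omega> * cis (2 * pi * \<omega> * x))"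
proof -
  have [measurable]: "G \<in> borel_measurable borel" using G by auto
  show ?thesis by (rule Bochner_Integration.integrable_bound[OF G]) (auto simp: norm_mult)
qed

lemma synth_sum:
  assumes "finite J" "\<And>j. j \<in> J \<Longrightarrow> integrable lborel (G j)"
  shows "synth (\<lambda>\<omega>. \<Sum>j\<in>J. c j * G j \<omega>) x = (\<Sum>j\<in>J. c j * synth (G j) x)"
proof -
  have "synth (\<lambda>\<omega>. \<Sum>j\<in>J. c j * G j \<omega>) x = (LINT \<omega>|lborel. (\<Sum>j\<in>J. c j * (G j \<omega> * cis (2 * pi * \<omega> * x))))"
    by (simp add: synth_def sum_distrib_right mult.assoc)
  also have "\<dots> = (\<Sum>j\<in>J. (LINT \<omega>|lborel. c j * (G j \<omega> * cis (2 * pi * \<omega> * x))))"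
    using assms by (intro Bochner_Integration.integral_sum integrable_mult_right integrable_mult_cis) auto
  finally show ?thesis by (simp add: synth_def)
qed

lemma synth_bounded:
  assumes "integrable lborel G"
  shows "cmod (synth G x) \<le> (LINT \<omega>|lborel. cmod (G \<omega>))"
proof -
  have "cmod (synth G x) \<le> (LINT \<omega>|lborel. cmod (G \<omega> * cis (2 * pi * \<omega> * x)))"
    unfolding synth_def by (rule integral_norm_bound)
  then show ?thesis by (simp add: norm_mult)
qed

lemma integrable_indicator_Ico:
  "integrable lborel (\<lambda>t. indicator {y..<x::real} t *\<^sub>R (c :: 'a :: {banach, second_countable_topology}))"
proof -
  have "emeasure lborel {y..<x} < \<infinity>"
    by (rule le_less_trans[OF emeasure_mono[of _ "{y..x}"]]) (auto simp: emeasure_lborel_Icc_eq)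
  then show ?thesis by (intro integrable_scaleR_left) simp
qed

lemma integral_cis_Ico:
  fixes \<omega> :: real
  assumes "y \<le> x"
  shows "(LINT t|lborel. indicator {y..<x} t *\<^sub>R (2 * pi * \<i> * \<omega> * cis (2 * pi * \<omega> * t)))
    = cis (2 * pi * \<omega> * x) - cis (2 * pi * \<omega> * y)"
proof -
  have "(LINT t|lborel. indicator {y..<x} t *\<^sub>R (2 * pi * \<i> * \<omega> * cis (2 * pi * \<omega> * t)))
     = (LINT t|lborel. indicator {y..x} t *\<^sub>R (2 * pi * \<i> * \<omega> * cis (2 * pi * \<omega> * t)))"
  proof (rule integral_cong_AE)
    have "AE t in lborel. t \<noteq> x" by (rule AE_lborel_singleton)
    then show "AE t in lborel. indicator {y..<x} t *\<^sub>R (2 * pi * \<i> * \<omega> * cis (2 * pi * \<omega> * t))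
      = indicator {y..x} t *\<^sub>R (2 * pi * \<i> * \<omega> * cis (2 * pi * \<omega> * t))"
      by eventually_elim (auto simp: indicator_def)
  qed measurable
  also have "\<dots> = cis (2 * pi * \<omega> * x) - cis (2 * pi * \<omega> * y)"
  proof (rule integral_FTC_atLeastAtMost[OF assms])
    fix t
    have "((\<lambda>t. cis (2 * pi * \<omega> * t)) has_vector_derivative (2 * pi * \<omega>) *\<^sub>R (\<i> * cis (2 * pi * \<omega> * t))) (at t within {y..x})"
      unfolding cis_conv_exp
      by (rule has_vector_derivative_eq_rhs,
          rule vector_diff_chain_within[where g=iexp and f="\<lambda>t. 2 * pi * \<omega> * t", unfolded o_def])
         (auto intro!: derivative_eq_intros)
    then show "((\<lambda>t. cis (2 * pi * \<omega> * t)) has_vector_derivative 2 * pi * \<i> * \<omega> * cis (2 * pi * \<omega> * t)) (at t within {y..x})"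
      by (simp add: scaleR_conv_of_real mult_ac)
  qed (intro continuous_intros)
  finally show ?thesis .
qed

text \<open>
  The multiplier of differentiation: \<open>synth (freq_deriv G)\<close> is the derivative of \<open>synth G\<close>.
\<close>

definition freq_deriv :: "(real \<Rightarrow> complex) \<Rightarrow> real \<Rightarrow> complex" where
  "freq_deriv G \<omega> = 2 * pi * \<i> * \<omega> * G \<omega>"

lemma bandlim_freq_deriv:
  assumes G: "bandlim R G"
  shows "bandlim R (freq_deriv G)" "energy (freq_deriv G) \<le> ennreal ((2 * pi * R)\<^sup>2) * energy G"
proof -
  have *: "cmod (2 * pi * \<i> * \<omega>) \<le> 2 * pi * R" if "G \<omega> \<noteq> 0" for \<omega>
    using G that by (force simp: bandlim_def norm_mult abs_mult)
  show "bandlim R (freq_deriv G)"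
    unfolding freq_deriv_def[abs_def] by (rule bandlim_mult[OF G _ *]) auto
  show "energy (freq_deriv G) \<le> ennreal ((2 * pi * R)\<^sup>2) * energy G"
    unfolding freq_deriv_def[abs_def] using bandlim_measurable[OF G] * by (intro energy_mult_le) auto
qed

text \<open>
  The exponentials satisfy the fundamental theorem of calculus, and the bounded support of \<open>G\<close> permits
  Fubini's theorem.
\<close>

lemma synth_FTC:
  assumes G: "bandlim R G" and yx: "y \<le> x"
  shows "(LINT t|lborel. indicator {y..<x} t *\<^sub>R synth (freq_deriv G) t) = synth G x - synth G y"
proof -
  have D: "bandlim R (freq_deriv G)" by (rule bandlim_freq_deriv[OF G])
  note Gi = bandlim_integrable[OF G] and Di = bandlim_integrable[OF D]
  note [measurable] = bandlim_measurable[OF G] bandlim_measurable[OF D]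
  define f where "f = (\<lambda>t \<omega>. indicator {y..<x} t *\<^sub>R (freq_deriv G \<omega> * cis (2 * pi * \<omega> * t)))"
  have fint: "integrable (lborel \<Otimes>\<^sub>M lborel) (\<lambda>(t, \<omega>). f t \<omega>)"
  proof (rule lborel_pair.Fubini_integrable)
    show "(\<lambda>(t, \<omega>). f t \<omega>) \<in> borel_measurable (lborel \<Otimes>\<^sub>M lborel)" unfolding f_def by measurable
    have "(\<lambda>t. LINT \<omega>|lborel. norm (case (t, \<omega>) of (t, \<omega>) \<Rightarrow> f t \<omega>))
        = (\<lambda>t. indicator {y..<x} t *\<^sub>R (LINT \<omega>|lborel. norm (freq_deriv G \<omega>)))"
      by (simp add: f_def norm_mult)
    then show "integrable lborel (\<lambda>t. LINT \<omega>|lborel. norm (case (t, \<omega>) of (t, \<omega>) \<Rightarrow> f t \<omega>))"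
      by (simp only: integrable_indicator_Ico)
    show "AE t in lborel. integrable lborel (\<lambda>\<omega>. case (t, \<omega>) of (t, \<omega>) \<Rightarrow> f t \<omega>)"
      using integrable_mult_cis[OF Di] by (simp add: f_def)
  qed
  have "(LINT t|lborel. indicator {y..<x} t *\<^sub>R synth (freq_deriv G) t) = (LINT t|lborel. LINT \<omega>|lborel. f t \<omega>)"
    by (simp add: f_def synth_def)
  also have "\<dots> = (LINT \<omega>|lborel. LINT t|lborel. f t \<omega>)"
    by (rule lborel_pair.Fubini_integral[OF fint, symmetric])
  also have "\<dots> = (LINT \<omega>|lborel. G \<omega> * cis (2 * pi * \<omega> * x) - G \<omega> * cis (2 * pi * \<omega> * y))"
  proof (rule Bochner_Integration.integral_cong[OF refl])
    fix \<omega>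
    have "(LINT t|lborel. f t \<omega>) = (LINT t|lborel. G \<omega> * (indicator {y..<x} t *\<^sub>R (2 * pi * \<i> * \<omega> * cis (2 * pi * \<omega> * t))))"
      by (simp add: f_def freq_deriv_def mult_ac)
    also have "\<dots> = G \<omega> * (cis (2 * pi * \<omega> * x) - cis (2 * pi * \<omega> * y))"
      unfolding integral_cis_Ico[OF yx, symmetric] by (rule integral_mult_right_zero)
    finally show "(LINT t|lborel. f t \<omega>) = G \<omega> * cis (2 * pi * \<omega> * x) - G \<omega> * cis (2 * pi * \<omega> * y)"
      by (simp add: right_diff_distrib)
  qed
  also have "\<dots> = synth G x - synth G y"
    unfolding synth_def by (intro Bochner_Integration.integral_diff integrable_mult_cis Gi)
  finally show ?thesis .
qed

lemma synth_set_integrable: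
  assumes "integrable lborel G"
  shows "integrable lborel (\<lambda>t. indicator {y..<x::real} t *\<^sub>R synth G t)"
proof -
  have [measurable]: "G \<in> borel_measurable borel" using assms by auto
  show ?thesis
    by (rule Bochner_Integration.integrable_bound[OF integrable_indicator_Ico[of y x "LINT \<omega>|lborel. cmod (G \<omega>)"]])
       (auto intro!: mult_left_mono synth_bounded[OF assms])
qed

lemma synth_diff_le:
  assumes G: "bandlim R G" and x: "x \<in> {c..c + \<delta>}" and y: "y \<in> {c..c + \<delta>}"
  shows "ennreal (cmod (synth G x - synth G y))
    \<le> (\<integral>\<^sup>+t. ennreal (cmod (synth (freq_deriv G) t)) * indicator {c..<c + \<delta>} t \<partial>lborel)"
proof -
  have *: "ennreal (cmod (synth G x - synth G y))
    \<le> (\<integral>\<^sup>+t. ennreal (cmod (synth (freq_deriv G) t)) * indicator {c..<c + \<delta>} t \<partial>lborel)"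
    if "y \<le> x" "x \<in> {c..c + \<delta>}" "y \<in> {c..c + \<delta>}" for x y
  proof -
    have "ennreal (cmod (synth G x - synth G y))
       \<le> (\<integral>\<^sup>+t. ennreal (cmod (indicator {y..<x} t *\<^sub>R synth (freq_deriv G) t)) \<partial>lborel)"
      unfolding synth_FTC[OF G that(1), symmetric]
      by (intro integral_norm_bound_ennreal synth_set_integrable bandlim_integrable[OF bandlim_freq_deriv(1)[OF G]])
    also have "\<dots> \<le> (\<integral>\<^sup>+t. ennreal (cmod (synth (freq_deriv G) t)) * indicator {c..<c + \<delta>} t \<partial>lborel)"
      using that by (intro nn_integral_mono) (auto simp: indicator_def)
    finally show ?thesis .
  qed
  show ?thesis using *[of x y] *[of y x] x y by (metis linear norm_minus_commute)
qed


section \<open>Anchors of vector-valued dyadic martingales\<close>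

text \<open>
  Vectors with index set \<open>J\<close> are functions on the natural numbers of which only the entries in \<open>J\<close> are looked
  at, because the number of frequencies varies.
\<close>

definition vsq :: "nat set \<Rightarrow> (nat \<Rightarrow> complex) \<Rightarrow> real" where
  "vsq J u = (\<Sum>j\<in>J. (cmod (u j))\<^sup>2)"

definition vnorm :: "nat set \<Rightarrow> (nat \<Rightarrow> complex) \<Rightarrow> real" where
  "vnorm J u = L2_set (\<lambda>j. cmod (u j)) J"

lemma vnorm_nonneg[simp]: "0 \<le> vnorm J u" by (simp add: vnorm_def)
lemma vsq_nonneg[simp]: "0 \<le> vsq J u" by (simp add: vsq_def sum_nonneg)
lemma vnorm_sq: "(vnorm J u)\<^sup>2 = vsq J u"
  by (simp add: vnorm_def vsq_def L2_set_def sum_nonneg)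

lemma vnorm_zero[simp]: "vnorm J (\<lambda>j. 0) = 0"
  by (simp add: vnorm_def L2_set_def)

lemma vnorm_triangle: "vnorm J (\<lambda>j. u j + v j) \<le> vnorm J u + vnorm J v"
  unfolding vnorm_def
  by (rule order_trans[OF L2_set_mono L2_set_triangle_ineq]) (auto intro: norm_triangle_ineq)

lemma vnorm_scale: "vnorm J (\<lambda>j. c * u j) = cmod c * vnorm J u"
  by (simp add: vnorm_def norm_mult L2_set_right_distrib)

lemma vnorm_minus_commute: "vnorm J (\<lambda>j. u j - v j) = vnorm J (\<lambda>j. v j - u j)"
  by (simp add: vnorm_def norm_minus_commute)

lemma vnorm_triangle_diff: "vnorm J (\<lambda>j. u j - w j) \<le> vnorm J (\<lambda>j. u j - v j) + vnorm J (\<lambda>j. v j - w j)"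
  using vnorm_triangle[of J "\<lambda>j. u j - v j" "\<lambda>j. v j - w j"] by simp

lemma trig_sum_le:
  assumes "finite J"
  shows "cmod (trig_sum \<eta> J u x) \<le> sqrt (card J) * vnorm J u"
proof -
  have "cmod (trig_sum \<eta> J u x) \<le> (\<Sum>j\<in>J. cmod (u j) * 1)"
    unfolding trig_sum_def by (rule order_trans[OF norm_sum]) (simp add: norm_mult)
  also have "\<dots> \<le> (\<Sum>j\<in>J. \<bar>cmod (u j)\<bar> * \<bar>1\<bar>)" by simp
  also have "\<dots> \<le> L2_set (\<lambda>j. cmod (u j)) J * L2_set (\<lambda>j. 1) J" by (rule L2_set_mult_ineq)
  finally show ?thesis by (simp add: vnorm_def L2_set_def mult.commute)
qed

lemma trig_sum_diff: "trig_sum \<eta> J (\<lambda>j. u j - v j) x = trig_sum \<eta> J u x - trig_sum \<eta> J v x"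
  by (simp add: trig_sum_def left_diff_distrib sum_subtractf)

primrec run_max :: "nat set \<Rightarrow> (nat \<Rightarrow> nat \<Rightarrow> complex) \<Rightarrow> nat \<Rightarrow> real" where
  "run_max J b 0 = vnorm J (b 0)"
| "run_max J b (Suc t) = max (run_max J b t) (vnorm J (b (Suc t)))"

text \<open>
  The anchor with threshold \<open>\<delta>\<close> stays where it is until the path \<open>b\<close> is at distance at least \<open>\<delta>\<close> times its
  running maximum, and then jumps to the current value. Comparing with the running maximum instead of a
  fixed number makes all levels \<open>\<delta>\<close> refer to the same maximal function.
\<close>

primrec anchor :: "nat set \<Rightarrow> real \<Rightarrow> (nat \<Rightarrow> nat \<Rightarrow> complex) \<Rightarrow> nat \<Rightarrow> nat \<Rightarrow> complex" where
  "anchor J \<delta> b 0 = b 0"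
| "anchor J \<delta> b (Suc t) =
     (if \<delta> * run_max J b (Suc t) \<le> vnorm J (\<lambda>j. b (Suc t) j - anchor J \<delta> b t j) then b (Suc t) else anchor J \<delta> b t)"

definition resets :: "nat set \<Rightarrow> real \<Rightarrow> (nat \<Rightarrow> nat \<Rightarrow> complex) \<Rightarrow> nat set" where
  "resets J \<delta> b = {Suc t |t. \<delta> * run_max J b (Suc t) \<le> vnorm J (\<lambda>j. b (Suc t) j - anchor J \<delta> b t j)}"

definition jump_sum :: "nat set \<Rightarrow> real \<Rightarrow> (nat \<Rightarrow> nat \<Rightarrow> complex) \<Rightarrow> nat \<Rightarrow> real" where
  "jump_sum J \<delta> b n = (\<Sum>t<n. if Suc t \<in> resets J \<delta> b then vsq J (\<lambda>j. b (Suc t) j - anchor J \<delta> b t j) else 0)"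

lemma Suc_in_resets: "Suc t \<in> resets J \<delta> b \<longleftrightarrow> \<delta> * run_max J b (Suc t) \<le> vnorm J (\<lambda>j. b (Suc t) j - anchor J \<delta> b t j)"
  by (auto simp: resets_def)

lemma run_max_mono: "s \<le> t \<Longrightarrow> run_max J b s \<le> run_max J b t"
  by (induction t) (auto simp: le_Suc_eq)

lemma vnorm_le_run_max: "vnorm J (b t) \<le> run_max J b t"
  by (cases t) auto

lemma run_max_nonneg[simp]: "0 \<le> run_max J b t"
  by (rule order_trans[OF vnorm_nonneg vnorm_le_run_max])

lemma anchor_close: "0 \<le> \<delta> \<Longrightarrow> vnorm J (\<lambda>j. b t j - anchor J \<delta> b t j) \<le> \<delta> * run_max J b t"
proof (cases t)
  case (Suc s)
  assume \<delta>: "0 \<le> \<delta>"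
  show ?thesis
  proof (cases "\<delta> * run_max J b (Suc s) \<le> vnorm J (\<lambda>j. b (Suc s) j - anchor J \<delta> b s j)")
    case True
    have "0 \<le> \<delta> * run_max J b (Suc s)" using \<delta> by (intro mult_nonneg_nonneg run_max_nonneg)
    with True show ?thesis unfolding Suc anchor.simps by (simp del: run_max.simps)
  next
    case False
    then show ?thesis unfolding Suc anchor.simps by (simp del: run_max.simps)
  qed
qed simp

text \<open>
  The three quantities are adapted: at time \<open>t\<close> they depend only on the path up to time \<open>t\<close>.
\<close>

lemma path_cong:
  assumes "\<And>s. s \<le> t \<Longrightarrow> b s = b' s"
  shows "run_max J b t = run_max J b' t" "anchor J \<delta> b t = anchor J \<delta> b' t"
    "jump_sum J \<delta> b t = jump_sum J \<delta> b' t"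
proof -
  have R: "run_max J b t = run_max J b' t" if "\<And>s. s \<le> t \<Longrightarrow> b s = b' s" for t
    using that by (induction t) auto
  have A: "anchor J \<delta> b t = anchor J \<delta> b' t" if "\<And>s. s \<le> t \<Longrightarrow> b s = b' s" for t
    using that
  proof (induction t)
    case 0 then show ?case by simp
  next
    case (Suc t)
    then have "anchor J \<delta> b t = anchor J \<delta> b' t" "b (Suc t) = b' (Suc t)" by auto
    with R[OF Suc.prems] show ?case by (simp only: anchor.simps)
  qed
  show "run_max J b t = run_max J b' t" "anchor J \<delta> b t = anchor J \<delta> b' t"
    using R A assms by auto
  show "jump_sum J \<delta> b t = jump_sum J \<delta> b' t"
    unfolding jump_sum_def
  proof (rule sum.cong[OF refl])
    fix s assume s: "s \<in> {..<t}"
    then have "run_max J b (Suc s) = run_max J b' (Suc s)" "anchor J \<delta> b s = anchor J \<delta> b' s"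
      "b (Suc s) = b' (Suc s)"
      using R[of "Suc s"] A[of s] assms by auto
    then show "(if Suc s \<in> resets J \<delta> b then vsq J (\<lambda>j. b (Suc s) j - anchor J \<delta> b s j) else 0)
      = (if Suc s \<in> resets J \<delta> b' then vsq J (\<lambda>j. b' (Suc s) j - anchor J \<delta> b' s j) else 0)"
      by (simp only: Suc_in_resets)
  qed
qed

lemma sum_resets_le:
  assumes "0 \<le> \<delta>" "0 \<le> c"
  shows "(\<Sum>t\<in>resets J \<delta> b \<inter> {1..n}. (c * \<delta> * run_max J b t)\<^sup>2) \<le> c\<^sup>2 * jump_sum J \<delta> b n"
proof -
  have "(\<Sum>t\<in>resets J \<delta> b \<inter> {1..n}. (c * \<delta> * run_max J b t)\<^sup>2)
    = (\<Sum>t\<in>{1..n}. if t \<in> resets J \<delta> b then (c * \<delta> * run_max J b t)\<^sup>2 else 0)"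
    by (simp add: sum.inter_restrict[symmetric] Int_commute)
  also have "\<dots> = (\<Sum>t<n. if Suc t \<in> resets J \<delta> b then (c * \<delta> * run_max J b (Suc t))\<^sup>2 else 0)"
    by (rule sum.reindex_bij_witness[where i=Suc and j="\<lambda>t. t - 1"]) auto
  also have "\<dots> \<le> (\<Sum>t<n. c\<^sup>2 * (if Suc t \<in> resets J \<delta> b then vsq J (\<lambda>j. b (Suc t) j - anchor J \<delta> b t j) else 0))"
  proof (rule sum_mono)
    fix t
    show "(if Suc t \<in> resets J \<delta> b then (c * \<delta> * run_max J b (Suc t))\<^sup>2 else 0)
      \<le> c\<^sup>2 * (if Suc t \<in> resets J \<delta> b then vsq J (\<lambda>j. b (Suc t) j - anchor J \<delta> b t j) else 0)"
    proof (cases "Suc t \<in> resets J \<delta> b")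
      case True
      then have "(\<delta> * run_max J b (Suc t))\<^sup>2 \<le> (vnorm J (\<lambda>j. b (Suc t) j - anchor J \<delta> b t j))\<^sup>2"
        unfolding Suc_in_resets using assms by (intro power_mono mult_nonneg_nonneg run_max_nonneg)
      then have "c\<^sup>2 * (\<delta> * run_max J b (Suc t))\<^sup>2 \<le> c\<^sup>2 * vsq J (\<lambda>j. b (Suc t) j - anchor J \<delta> b t j)"
        unfolding vnorm_sq by (intro mult_left_mono) auto
      then show ?thesis using True by (simp only: power_mult_distrib mult.assoc if_True)
    qed simp
  qed
  finally show ?thesis by (simp add: jump_sum_def sum_distrib_left)
qed

text \<open>
  Level 0 is the zero path, so that the differences of successive levels add up to the anchor itself.
\<close>

definition level_anchor :: "nat set \<Rightarrow> (nat \<Rightarrow> nat \<Rightarrow> complex) \<Rightarrow> nat \<Rightarrow> nat \<Rightarrow> nat \<Rightarrow> complex" where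
  "level_anchor J b m t = (case m of 0 \<Rightarrow> (\<lambda>j. 0) | Suc k \<Rightarrow> anchor J ((1/2) ^ k) b t)"

definition level_diff :: "nat set \<Rightarrow> (nat \<Rightarrow> nat \<Rightarrow> complex) \<Rightarrow> nat \<Rightarrow> nat \<Rightarrow> nat \<Rightarrow> complex" where
  "level_diff J b m t = (\<lambda>j. level_anchor J b (Suc m) t j - level_anchor J b m t j)"

definition level_resets :: "nat set \<Rightarrow> (nat \<Rightarrow> nat \<Rightarrow> complex) \<Rightarrow> nat \<Rightarrow> nat set" where
  "level_resets J b m = (case m of 0 \<Rightarrow> {} | Suc k \<Rightarrow> resets J ((1/2) ^ k) b)"

definition level_jumps :: "nat set \<Rightarrow> (nat \<Rightarrow> nat \<Rightarrow> complex) \<Rightarrow> nat \<Rightarrow> nat \<Rightarrow> real" where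
  "level_jumps J b n m = (case m of 0 \<Rightarrow> 0 | Suc k \<Rightarrow> jump_sum J ((1/2) ^ k) b n)"

text \<open>
  Between these times the difference of two successive levels is constant.
\<close>

definition change_times :: "nat set \<Rightarrow> (nat \<Rightarrow> nat \<Rightarrow> complex) \<Rightarrow> nat \<Rightarrow> nat \<Rightarrow> nat set" where
  "change_times J b n m = (level_resets J b (Suc m) \<union> level_resets J b m) \<inter> {1..n}"

lemma level_anchor_constant:
  "Suc t \<notin> level_resets J b m \<Longrightarrow> level_anchor J b m (Suc t) = level_anchor J b m t"
  by (cases m) (auto simp: level_anchor_def level_resets_def Suc_in_resets)

lemma level_diff_constant:
  assumes "Suc t \<notin> change_times J b n m" "Suc t \<le> n"
  shows "level_diff J b m (Suc t) = level_diff J b m t"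
  using assms level_anchor_constant[of t J b m] level_anchor_constant[of t J b "Suc m"]
  by (auto simp: change_times_def level_diff_def)

lemma level_diff_le: "vnorm J (level_diff J b m t) \<le> 3 * (1/2) ^ m * run_max J b t"
proof (cases m)
  case 0
  have "vnorm J (level_diff J b m t) = vnorm J (\<lambda>j. anchor J 1 b t j - 0)"
    by (simp add: level_diff_def level_anchor_def 0)
  also have "\<dots> \<le> vnorm J (\<lambda>j. anchor J 1 b t j - b t j) + vnorm J (\<lambda>j. b t j - 0)"
    by (rule vnorm_triangle_diff)
  also have "\<dots> \<le> 1 * run_max J b t + run_max J b t"
    using anchor_close[of 1 J b t] vnorm_le_run_max[of J b t] by (subst vnorm_minus_commute) simp
  finally show ?thesis using run_max_nonneg[of J b t] 0 by (simp del: run_max_nonneg)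
next
  case (Suc k)
  have "vnorm J (level_diff J b m t) = vnorm J (\<lambda>j. anchor J ((1/2) ^ m) b t j - anchor J ((1/2) ^ k) b t j)"
    by (simp add: level_diff_def level_anchor_def Suc)
  also have "\<dots> \<le> vnorm J (\<lambda>j. anchor J ((1/2) ^ m) b t j - b t j) + vnorm J (\<lambda>j. b t j - anchor J ((1/2) ^ k) b t j)"
    by (rule vnorm_triangle_diff)
  also have "\<dots> \<le> (1/2) ^ m * run_max J b t + (1/2) ^ k * run_max J b t"
    using anchor_close[of "(1/2) ^ m" J b t] anchor_close[of "(1/2) ^ k" J b t]
    by (subst vnorm_minus_commute) auto
  finally show ?thesis using Suc by (simp add: algebra_simps)
qed

lemma level_diff_0: "level_diff J b m 0 = (if m = 0 then b 0 else (\<lambda>j. 0))"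
  by (cases m) (auto simp: level_diff_def level_anchor_def)

text \<open>
  At a reset of a level the jump is at least the threshold of that level times the running maximum, and the
  difference of the adjacent levels is at most 3 times this quantity.
\<close>

lemma sum_level_resets_le:
  assumes "m' = m \<or> m' = Suc m"
  shows "(\<Sum>t\<in>level_resets J b m' \<inter> {1..n}. vsq J (level_diff J b m t)) \<le> 9 * level_jumps J b n m'"
proof (cases m')
  case 0 then show ?thesis by (simp add: level_resets_def level_jumps_def)
next
  case (Suc k)
  have km: "(1/2::real) ^ m \<le> (1/2) ^ k" using assms Suc by (intro power_decreasing) auto
  have "(\<Sum>t\<in>level_resets J b m' \<inter> {1..n}. vsq J (level_diff J b m t))
    \<le> (\<Sum>t\<in>resets J ((1/2) ^ k) b \<inter> {1..n}. (3 * (1/2) ^ k * run_max J b t)\<^sup>2)"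
    unfolding level_resets_def Suc nat.case
  proof (rule sum_mono)
    fix t
    have "vnorm J (level_diff J b m t) \<le> 3 * (1/2) ^ m * run_max J b t" by (rule level_diff_le)
    also have "\<dots> \<le> 3 * (1/2) ^ k * run_max J b t" using km by (intro mult_right_mono) auto
    finally show "vsq J (level_diff J b m t) \<le> (3 * (1/2) ^ k * run_max J b t)\<^sup>2"
      unfolding vnorm_sq[symmetric] by (intro power_mono) auto
  qed
  also have "\<dots> \<le> 3\<^sup>2 * jump_sum J ((1/2) ^ k) b n" by (rule sum_resets_le) auto
  finally show ?thesis by (simp add: level_jumps_def Suc)
qed

text \<open>
  This estimate is the point of the construction: each piece of the difference of two levels begins with a
  jump of comparable size, so the square sum over the pieces is controlled without counting them.
\<close>

lemma sum_change_times_le: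
  "(\<Sum>t\<in>insert 0 (change_times J b n m). vsq J (level_diff J b m t))
    \<le> 9 * (level_jumps J b n (Suc m) + level_jumps J b n m) + vsq J (b 0)"
proof -
  have fin: "finite (change_times J b n m)" "0 \<notin> change_times J b n m" by (auto simp: change_times_def)
  have "(\<Sum>t\<in>change_times J b n m. vsq J (level_diff J b m t))
     \<le> (\<Sum>t\<in>level_resets J b (Suc m) \<inter> {1..n}. vsq J (level_diff J b m t))
       + (\<Sum>t\<in>level_resets J b m \<inter> {1..n}. vsq J (level_diff J b m t))"
    unfolding change_times_def Int_Un_distrib2
    by (subst sum.union_inter[symmetric]) (auto intro!: sum_nonneg)
  also have "\<dots> \<le> 9 * level_jumps J b n (Suc m) + 9 * level_jumps J b n m"
    by (intro add_mono sum_level_resets_le) auto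
  finally have "(\<Sum>t\<in>change_times J b n m. vsq J (level_diff J b m t))
     \<le> 9 * (level_jumps J b n (Suc m) + level_jumps J b n m)" by simp
  moreover have "vsq J (level_diff J b m 0) \<le> vsq J (b 0)"
    by (auto simp: level_diff_0) (simp add: vsq_def sum_nonneg)
  ultimately show ?thesis using fin by simp
qed

definition last_change :: "nat set \<Rightarrow> nat \<Rightarrow> nat" where
  "last_change S t = Max (insert 0 {s\<in>S. s \<le> t})"

lemma last_change_Suc: "last_change S (Suc t) = (if Suc t \<in> S then Suc t else last_change S t)"
proof -
  have fin: "finite {s\<in>S. s \<le> t}" for t by (rule finite_subset[of _ "{..t}"]) auto
  have "{s\<in>S. s \<le> Suc t} = (if Suc t \<in> S then insert (Suc t) {s\<in>S. s \<le> t} else {s\<in>S. s \<le> t})"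
    by (auto simp: le_Suc_eq)
  moreover have "Max (insert (Suc t) (insert 0 {s\<in>S. s \<le> t})) = Suc t"
    using fin by (intro Max_eqI) auto
  ultimately show ?thesis by (simp add: last_change_def insert_commute)
qed

lemma last_change_0[simp]: "last_change S 0 = 0"
proof -
  have "insert 0 {s\<in>S. s \<le> 0} = {0}" by auto
  then show ?thesis unfolding last_change_def by (simp only: Max_singleton)
qed

lemma last_change_le: "last_change S t \<le> t"
  by (induction t) (auto simp: last_change_Suc)

lemma last_change_in: "last_change S t \<in> insert 0 S"
  by (induction t) (auto simp: last_change_Suc)

lemma last_change_mono: "mono (last_change S)"
  using last_change_le[of S] by (intro incseq_SucI) (auto simp: last_change_Suc intro: le_SucI)

lemma last_change_value:
  assumes "\<And>t. Suc t \<notin> S \<Longrightarrow> D (Suc t) = D t"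
  shows "D (last_change S t) = D t"
  by (induction t) (auto simp: last_change_Suc assms)

lemma var_le_changes:
  fixes D :: "nat \<Rightarrow> complex"
  assumes r: "1 \<le> r" and S: "finite S" and D: "\<And>t. Suc t \<notin> S \<Longrightarrow> D (Suc t) = D t"
  shows "var_le r D (8 * (\<Sum>t\<in>insert 0 S. cmod (D t) powr r) powr (1 / r))"
proof -
  define p where "p = Max (insert 0 S)"
  have p: "last_change S t \<le> p" for t
    unfolding p_def using S last_change_in[of S t] by (intro Max_ge) auto
  have pS: "insert 0 S \<subseteq> {..p}" using S by (auto simp: p_def intro!: Max_ge)
  define D' where "D' = (\<lambda>b. if b \<in> insert 0 S then D b else 0)"
  have "var_le r (\<lambda>t. D' (last_change S t)) (8 * (\<Sum>b\<le>p. cmod (D' b) powr r) powr (1 / r))"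
    by (rule var_le_step[OF r last_change_mono p])
  also have "(\<lambda>t. D' (last_change S t)) = D"
    using last_change_in[of S] last_change_value[of S D, OF D] by (auto simp: D'_def fun_eq_iff)
  also have "(\<Sum>b\<le>p. cmod (D' b) powr r) = (\<Sum>t\<in>insert 0 S. cmod (D t) powr r)"
    using pS r by (intro sum.mono_neutral_cong_right) (auto simp: D'_def)
  finally show ?thesis .
qed

text \<open>
  Time runs from the coarsest scale \<open>n\<close> down to the cell \<open>c\<close> of the finest scale 0, as for a martingale.
\<close>

definition dyadic_path :: "(nat \<Rightarrow> int \<Rightarrow> nat \<Rightarrow> complex) \<Rightarrow> nat \<Rightarrow> int \<Rightarrow> nat \<Rightarrow> nat \<Rightarrow> complex" where
  "dyadic_path A n c t = A (n - t) (c div 2 ^ (n - t))"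

definition leaves :: "nat \<Rightarrow> int \<Rightarrow> int set" where
  "leaves i m = {m * 2 ^ i..<(m + 1) * 2 ^ i}"

lemma leaves_Suc: "leaves (Suc i) m = leaves i (2 * m) \<union> leaves i (2 * m + 1)"
  "leaves i (2 * m) \<inter> leaves i (2 * m + 1) = {}"
proof -
  define q where "q = (2 :: int) ^ i"
  have q: "0 < q" by (simp add: q_def)
  have e: "m * 2 ^ Suc i = 2 * m * q" "(m + 1) * 2 ^ Suc i = (2 * m + 1 + 1) * q" "2 ^ i = q"
    by (simp_all add: q_def algebra_simps)
  have le: "2 * m * q \<le> (2 * m + 1) * q" "(2 * m + 1) * q \<le> (2 * m + 1 + 1) * q"
    using q by (simp_all add: mult_right_mono)
  show "leaves (Suc i) m = leaves i (2 * m) \<union> leaves i (2 * m + 1)"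
    unfolding leaves_def e by (rule ivl_disj_un_two(3)[OF le, symmetric])
  show "leaves i (2 * m) \<inter> leaves i (2 * m + 1) = {}"
    unfolding leaves_def e by auto
qed

text \<open>
  A quantity that does not increase on average when a cell is split into its two halves does not increase on
  average from the root of the tree to its leaves.
\<close>

lemma tree_supermartingale:
  fixes \<Phi> :: "nat \<Rightarrow> (nat \<Rightarrow> nat \<Rightarrow> complex) \<Rightarrow> real"
  assumes A: "\<And>i m. A (Suc i) m = (\<lambda>j. (A i (2 * m) j + A i (2 * m + 1) j) / 2)"
    and step: "\<And>t b b1 b2. (\<And>s. s \<le> t \<Longrightarrow> b1 s = b s) \<Longrightarrow> (\<And>s. s \<le> t \<Longrightarrow> b2 s = b s) \<Longrightarrow>
        (\<And>j. b t j = (b1 (Suc t) j + b2 (Suc t) j) / 2) \<Longrightarrow> \<Phi> (Suc t) b1 + \<Phi> (Suc t) b2 \<le> 2 * \<Phi> t b"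
  shows "(\<Sum>c\<in>leaves n m. \<Phi> n (dyadic_path A n c)) \<le> 2 ^ n * \<Phi> 0 (dyadic_path A n (m * 2 ^ n))"
proof -
  have "(\<Sum>c\<in>leaves i m. \<Phi> n (dyadic_path A n c)) \<le> 2 ^ i * \<Phi> (n - i) (dyadic_path A n (m * 2 ^ i))"
    if "i \<le> n" for i m
    using that
  proof (induction i arbitrary: m)
    case 0
    have "leaves 0 m = {m}" by (auto simp: leaves_def)
    then show ?case by simp
  next
    case (Suc i)
    define t where "t = n - Suc i"
    have ni: "n - i = Suc t" using Suc.prems by (simp add: t_def)
    let ?b = "dyadic_path A n (m * 2 ^ Suc i)"
    let ?b1 = "dyadic_path A n (2 * m * 2 ^ i)"
    let ?b2 = "dyadic_path A n ((2 * m + 1) * 2 ^ i)"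
    have b1: "?b1 = ?b" by (simp add: mult_ac)
    have b2: "?b2 s = ?b s" if "s \<le> t" for s
    proof -
      define e where "e = n - s - Suc i"
      have e: "n - s = Suc i + e"
        using that Suc.prems unfolding t_def e_def by linarith
      have "(2 * m + 1) * 2 ^ i div (2 * 2 ^ i) = (2 * m + 1) div 2"
        by (rule div_mult_mult2) simp
      then have d: "(2 * m + 1) * 2 ^ i div 2 ^ Suc i = m" "(m * 2 ^ Suc i) div 2 ^ Suc i = m"
        by simp_all
      have z: "x div 2 ^ (Suc i + e) = x div 2 ^ Suc i div 2 ^ e" for x :: int
        unfolding power_add by (rule zdiv_zmult2_eq) simp
      show ?thesis unfolding dyadic_path_def e z d ..
    qed
    have bt: "?b t = A (Suc i) m" "?b1 (Suc t) = A i (2 * m)" "?b2 (Suc t) = A i (2 * m + 1)"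
      using Suc.prems ni by (simp_all add: dyadic_path_def t_def Suc_diff_le)
    have "(\<Sum>c\<in>leaves (Suc i) m. \<Phi> n (dyadic_path A n c))
       = (\<Sum>c\<in>leaves i (2 * m). \<Phi> n (dyadic_path A n c)) + (\<Sum>c\<in>leaves i (2 * m + 1). \<Phi> n (dyadic_path A n c))"
      unfolding leaves_Suc(1) using leaves_Suc(2) by (intro sum.union_disjoint) (auto simp: leaves_def)
    also have "\<dots> \<le> 2 ^ i * \<Phi> (Suc t) ?b1 + 2 ^ i * \<Phi> (Suc t) ?b2"
      using Suc.IH[of "2 * m"] Suc.IH[of "2 * m + 1"] Suc.prems ni by (intro add_mono) auto
    also have "\<dots> = 2 ^ i * (\<Phi> (Suc t) ?b1 + \<Phi> (Suc t) ?b2)" by (simp add: distrib_left)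
    also have "\<dots> \<le> 2 ^ i * (2 * \<Phi> t ?b)"
      using step[of t ?b1 ?b ?b2] b1 b2 bt A[of i m] by (intro mult_left_mono) auto
    finally show ?case by (simp add: t_def mult_ac)
  qed
  from this[of n m] show ?thesis by simp
qed

text \<open>
  Doob's maximal inequality. With \<open>R\<close> for the running maximum and \<open>v\<close> for the norm of the current value, the
  potential \<open>2R\<^sup>2 - 4Rv\<close> is a supermartingale, because \<open>v\<close> is a submartingale and \<open>(R - v)\<^sup>2 \<ge> 0\<close> pays for a
  new maximum. It is nonpositive at the root and at least \<open>R\<^sup>2 - 4v\<^sup>2\<close> at the leaves.
\<close>

lemma tree_maximal:
  assumes A: "\<And>i m. A (Suc i) m = (\<lambda>j. (A i (2 * m) j + A i (2 * m + 1) j) / 2)"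
  shows "(\<Sum>c\<in>leaves n m. (run_max J (dyadic_path A n c) n)\<^sup>2) \<le> 4 * (\<Sum>c\<in>leaves n m. vsq J (A 0 c))"
proof -
  define \<Phi> where "\<Phi> = (\<lambda>t b. 2 * (run_max J b t)\<^sup>2 - 4 * run_max J b t * vnorm J (b t))"
  have "(\<Sum>c\<in>leaves n m. \<Phi> n (dyadic_path A n c)) \<le> 2 ^ n * \<Phi> 0 (dyadic_path A n (m * 2 ^ n))"
  proof (rule tree_supermartingale[where A=A and \<Phi>=\<Phi>, OF A])
    fix t b b1 b2
    assume b1: "\<And>s. s \<le> t \<Longrightarrow> b1 s = (b :: nat \<Rightarrow> nat \<Rightarrow> complex) s" and b2: "\<And>s. s \<le> t \<Longrightarrow> b2 s = b s"
      and avg: "\<And>j. b t j = (b1 (Suc t) j + b2 (Suc t) j) / 2"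
    let ?R = "run_max J b t"
    have one: "\<Phi> (Suc t) b' \<le> 2 * ?R\<^sup>2 - 4 * ?R * vnorm J (b' (Suc t))"
      if "\<And>s. s \<le> t \<Longrightarrow> b' s = b s" for b'
    proof -
      define v where "v = vnorm J (b' (Suc t))"
      have R: "run_max J b' t = ?R" using that by (rule path_cong)
      define q where "q = run_max J b t"
      have "0 \<le> (q - v) * (q - v)" by simp
      then have "4 * (q * v) \<le> 2 * (q * q) + 2 * (v * v)" by (simp add: algebra_simps)
      then show ?thesis
        by (simp add: \<Phi>_def R flip: v_def q_def) (auto simp: max_def power2_eq_square mult_ac)
    qed
    have "2 * vnorm J (b t) \<le> vnorm J (b1 (Suc t)) + vnorm J (b2 (Suc t))"
    proof -
      have "vnorm J (\<lambda>j. 2 * b t j) = vnorm J (\<lambda>j. b1 (Suc t) j + b2 (Suc t) j)" by (simp add: avg add_divide_distrib)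
      also have "\<dots> \<le> vnorm J (b1 (Suc t)) + vnorm J (b2 (Suc t))" by (rule vnorm_triangle)
      finally show ?thesis by (simp add: vnorm_scale)
    qed
    then have "?R * (2 * vnorm J (b t)) \<le> ?R * (vnorm J (b1 (Suc t)) + vnorm J (b2 (Suc t)))"
      by (intro mult_left_mono) auto
    then show "\<Phi> (Suc t) b1 + \<Phi> (Suc t) b2 \<le> 2 * \<Phi> t b"
      using one[of b1, OF b1] one[of b2, OF b2] by (simp add: \<Phi>_def algebra_simps)
  qed
  also have "\<dots> \<le> 0"
    by (intro mult_nonneg_nonpos) (auto simp: \<Phi>_def power2_eq_square)
  finally have neg: "(\<Sum>c\<in>leaves n m. \<Phi> n (dyadic_path A n c)) \<le> 0" .
  have "(\<Sum>c\<in>leaves n m. (run_max J (dyadic_path A n c) n)\<^sup>2)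
     \<le> (\<Sum>c\<in>leaves n m. 4 * vsq J (A 0 c) + \<Phi> n (dyadic_path A n c))"
  proof (rule sum_mono)
    fix c
    define R where "R = run_max J (dyadic_path A n c) n"
    define v where "v = vnorm J (A 0 c)"
    have "0 \<le> (2 * v - R)\<^sup>2" by simp
    moreover have "dyadic_path A n c n = A 0 c" by (simp add: dyadic_path_def)
    ultimately show "(run_max J (dyadic_path A n c) n)\<^sup>2 \<le> 4 * vsq J (A 0 c) + \<Phi> n (dyadic_path A n c)"
      unfolding vnorm_sq[symmetric] \<Phi>_def R_def[symmetric] v_def[symmetric]
      by (simp add: power2_eq_square algebra_simps flip: v_def)
  qed
  then show ?thesis using neg by (simp add: sum.distrib sum_distrib_left)
qed

lemma vsq_average:
  assumes "\<And>j. a j = (a1 j + a2 j) / (2::complex)"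
  shows "vsq J (\<lambda>j. a1 j - c j) - vsq J a1 + (vsq J (\<lambda>j. a2 j - c j) - vsq J a2)
    = 2 * (vsq J (\<lambda>j. a j - c j) - vsq J a)"
proof -
  have "(cmod (a1 j - c j))\<^sup>2 - (cmod (a1 j))\<^sup>2 + ((cmod (a2 j - c j))\<^sup>2 - (cmod (a2 j))\<^sup>2)
    = 2 * ((cmod (a j - c j))\<^sup>2 - (cmod (a j))\<^sup>2)" for j
    unfolding assms[of j] cmod_power2 by (simp add: power2_eq_square field_simps)
  then show ?thesis
    unfolding vsq_def by (simp flip: sum_subtractf sum.distrib add: sum_distrib_left)
qed

text \<open>
  The potential is the sum of the squared jumps so far, plus the squared distance to the anchor, minus the
  squared norm of the current value. A jump merely moves the distance into the sum, and between jumps the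
  change is linear in the current value; so the average is preserved.
\<close>

lemma tree_jumps:
  assumes A: "\<And>i m. A (Suc i) m = (\<lambda>j. (A i (2 * m) j + A i (2 * m + 1) j) / 2)"
  shows "(\<Sum>c\<in>leaves n m. jump_sum J \<delta> (dyadic_path A n c) n) \<le> (\<Sum>c\<in>leaves n m. vsq J (A 0 c))"
proof -
  define \<Phi> where "\<Phi> = (\<lambda>t b. jump_sum J \<delta> b t + vsq J (\<lambda>j. b t j - anchor J \<delta> b t j) - vsq J (b t))"
  have "(\<Sum>c\<in>leaves n m. \<Phi> n (dyadic_path A n c)) \<le> 2 ^ n * \<Phi> 0 (dyadic_path A n (m * 2 ^ n))"
  proof (rule tree_supermartingale[where A=A and \<Phi>=\<Phi>, OF A])
    fix t b b1 b2
    assume b1: "\<And>s. s \<le> t \<Longrightarrow> b1 s = (b :: nat \<Rightarrow> nat \<Rightarrow> complex) s" and b2: "\<And>s. s \<le> t \<Longrightarrow> b2 s = b s"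
      and avg: "\<And>j. b t j = (b1 (Suc t) j + b2 (Suc t) j) / 2"
    have one: "\<Phi> (Suc t) b' = jump_sum J \<delta> b t + vsq J (\<lambda>j. b' (Suc t) j - anchor J \<delta> b t j) - vsq J (b' (Suc t))"
      if "\<And>s. s \<le> t \<Longrightarrow> b' s = b s" for b'
    proof -
      have eq: "anchor J \<delta> b' t = anchor J \<delta> b t" "jump_sum J \<delta> b' t = jump_sum J \<delta> b t"
        using path_cong(2,3)[of t b' b] that by auto
      have js: "jump_sum J \<delta> b' (Suc t) = jump_sum J \<delta> b t
          + (if Suc t \<in> resets J \<delta> b' then vsq J (\<lambda>j. b' (Suc t) j - anchor J \<delta> b t j) else 0)"
        using eq by (simp add: jump_sum_def)
      have z: "vsq J (\<lambda>j. 0) = 0" by (simp add: vsq_def)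
      show ?thesis
      proof (cases "Suc t \<in> resets J \<delta> b'")
        case True
        then have "anchor J \<delta> b' (Suc t) = b' (Suc t)"
          by (simp only: Suc_in_resets anchor.simps if_True)
        then show ?thesis using True by (simp add: \<Phi>_def js z del: anchor.simps)
      next
        case False
        then have "anchor J \<delta> b' (Suc t) = anchor J \<delta> b t"
          by (simp only: Suc_in_resets anchor.simps if_False eq)
        then show ?thesis using False by (simp add: \<Phi>_def js del: anchor.simps)
      qed
    qed
    have \<Phi>_t: "\<Phi> t b = jump_sum J \<delta> b t + vsq J (\<lambda>j. b t j - anchor J \<delta> b t j) - vsq J (b t)"
      by (simp only: \<Phi>_def)
    show "\<Phi> (Suc t) b1 + \<Phi> (Suc t) b2 \<le> 2 * \<Phi> t b"
      using one[of b1] one[of b2] b1 b2 \<Phi>_t vsq_average[of "b t" "b1 (Suc t)" "b2 (Suc t)" J "anchor J \<delta> b t", OF avg] by simp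
  qed
  also have "\<dots> \<le> 0"
    by (intro mult_nonneg_nonpos) (auto simp: \<Phi>_def jump_sum_def vsq_def sum_nonneg)
  finally have neg: "(\<Sum>c\<in>leaves n m. \<Phi> n (dyadic_path A n c)) \<le> 0" .
  have "(\<Sum>c\<in>leaves n m. jump_sum J \<delta> (dyadic_path A n c) n)
     \<le> (\<Sum>c\<in>leaves n m. vsq J (A 0 c) + \<Phi> n (dyadic_path A n c))"
    by (rule sum_mono) (simp add: \<Phi>_def dyadic_path_def)
  then show ?thesis using neg by (simp add: sum.distrib)
qed


section \<open>The variation of exponential sums along a martingale\<close>

lemma weighted_cauchy_schwarz:
  fixes w z :: "'a \<Rightarrow> real"
  assumes "\<And>i. i \<in> I \<Longrightarrow> 0 \<le> w i"
  shows "(\<Sum>i\<in>I. w i * z i)\<^sup>2 \<le> (\<Sum>i\<in>I. w i) * (\<Sum>i\<in>I. w i * (z i)\<^sup>2)"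
proof -
  have "(\<Sum>i\<in>I. sqrt (w i) * (sqrt (w i) * z i))\<^sup>2
      \<le> (\<Sum>i\<in>I. (sqrt (w i))\<^sup>2) * (\<Sum>i\<in>I. (sqrt (w i) * z i)\<^sup>2)"
    by (rule Cauchy_Schwarz_ineq_sum)
  also have "(\<Sum>i\<in>I. sqrt (w i) * (sqrt (w i) * z i)) = (\<Sum>i\<in>I. w i * z i)"
    using assms by (intro sum.cong refl) (simp flip: mult.assoc)
  also have "(\<Sum>i\<in>I. (sqrt (w i))\<^sup>2) = (\<Sum>i\<in>I. w i)"
    using assms by (intro sum.cong refl) simp
  also have "(\<Sum>i\<in>I. (sqrt (w i) * z i)\<^sup>2) = (\<Sum>i\<in>I. w i * (z i)\<^sup>2)"
    using assms by (intro sum.cong refl) (simp add: power_mult_distrib)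
  finally show ?thesis .
qed

text \<open>
  The factor gained at level \<open>m\<close> by interpolating between the trivial bound \<open>3 \<surd>M 2\<^sup>-\<^sup>m\<close> for \<open>M\<close> frequencies and
  the uniform square function bound. The numbers form a geometric sequence in \<open>m\<close> because \<open>r > 2\<close>.
\<close>

definition level_weight :: "real \<Rightarrow> nat \<Rightarrow> nat \<Rightarrow> real" where
  "level_weight r M m = (3 * sqrt M * (1/2) ^ m) powr (1 - 2 / r)"

definition weight_total :: "real \<Rightarrow> nat \<Rightarrow> real" where
  "weight_total r M = (3 * sqrt M) powr (1 - 2 / r) / (1 - (1/2) powr (1 - 2 / r))"

lemma level_weight_nonneg[simp]: "0 \<le> level_weight r M m" by (simp add: level_weight_def)

lemma half_powr_less:
  assumes "2 < r" shows "(1/2 :: real) powr (1 - 2 / r) < 1"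
  using assms powr_less_mono2[of "1 - 2 / r" "1/2" "1::real"] by (simp add: field_simps)

lemma weight_total_nonneg: "2 < r \<Longrightarrow> 0 \<le> weight_total r M"
  using half_powr_less[of r] by (simp add: weight_total_def)

lemma sum_level_weight_le:
  assumes r: "2 < r"
  shows "(\<Sum>m\<le>k. level_weight r M m) \<le> weight_total r M"
proof -
  define \<rho> where "\<rho> = (1/2 :: real) powr (1 - 2 / r)"
  have \<rho>: "0 \<le> \<rho>" "\<rho> < 1" using half_powr_less[OF r] by (auto simp: \<rho>_def)
  have e: "level_weight r M m = (3 * sqrt M) powr (1 - 2 / r) * \<rho> ^ m" for m
  proof -
    have "((1/2 :: real) ^ m) powr (1 - 2 / r) = \<rho> ^ m"
      by (simp add: \<rho>_def powr_powr mult.commute flip: powr_realpow)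
    then show ?thesis by (simp add: level_weight_def powr_mult)
  qed
  have "(\<Sum>m\<le>k. \<rho> ^ m) \<le> (\<Sum>m. \<rho> ^ m)"
    using \<rho> by (intro sum_le_suminf summable_geometric) auto
  also have "\<dots> = 1 / (1 - \<rho>)" using \<rho> by (intro suminf_geometric) auto
  finally have "(3 * sqrt M) powr (1 - 2 / r) * (\<Sum>m\<le>k. \<rho> ^ m) \<le> (3 * sqrt M) powr (1 - 2 / r) * (1 / (1 - \<rho>))"
    by (intro mult_left_mono) auto
  then show ?thesis by (simp add: e weight_total_def \<rho>_def sum_distrib_left)
qed

definition piece_energy :: "(nat \<Rightarrow> real) \<Rightarrow> nat set \<Rightarrow> (nat \<Rightarrow> nat \<Rightarrow> complex) \<Rightarrow> nat \<Rightarrow> nat \<Rightarrow> real \<Rightarrow> real" where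
  "piece_energy \<eta> J b n m x = (\<Sum>t\<in>insert 0 (change_times J b n m). (cmod (trig_sum \<eta> J (level_diff J b m t) x))\<^sup>2)"

definition chain_bound :: "real \<Rightarrow> (nat \<Rightarrow> real) \<Rightarrow> nat set \<Rightarrow> nat \<Rightarrow> nat \<Rightarrow> (nat \<Rightarrow> nat \<Rightarrow> complex) \<Rightarrow> real \<Rightarrow> real" where
  "chain_bound r \<eta> J n k b x = 8 * run_max J b n
     + 8 * (\<Sum>m\<le>k. level_weight r (card J) m * (run_max J b n + sqrt (piece_energy \<eta> J b n m x)))"

lemma piece_energy_nonneg[simp]: "0 \<le> piece_energy \<eta> J b n m x"
  by (simp add: piece_energy_def sum_nonneg)

lemma finite_change_times[simp]: "finite (change_times J b n m)"
  by (simp add: change_times_def)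

lemma sum_level_diff: "(\<Sum>m<k. level_diff J b m t j) = level_anchor J b k t j"
proof -
  have "(\<Sum>m<k. level_diff J b m t j) = level_anchor J b k t j - level_anchor J b 0 t j"
    unfolding level_diff_def by (rule sum_lessThan_telescope)
  then show ?thesis by (simp add: level_anchor_def)
qed

text \<open>
  The path is the sum of the level differences up to level \<open>k\<close> and of its distance to the last anchor. Each
  level difference is a step function with jumps only at the change times. The last distance is so small
  that even the sum of all its values is harmless; this is the role of the condition on \<open>k\<close>.
\<close>

lemma chain_var_le:
  assumes r: "2 < r" and J: "finite J" and k: "sqrt (card J) * (1/2) ^ k * (real n + 1) \<le> 1"
  shows "var_le r (\<lambda>t. trig_sum \<eta> J (b (min t n)) x) (chain_bound r \<eta> J n k b x)"
proof -
  let ?T = "\<lambda>u. trig_sum \<eta> J u x"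
  define B where "B = run_max J b n"
  have B0: "0 \<le> B" by (simp add: B_def)
  have RB: "run_max J b (min t n) \<le> B" for t unfolding B_def by (rule run_max_mono) simp
  have level: "var_le r (\<lambda>t. ?T (level_diff J b m (min t n)))
      (8 * (level_weight r (card J) m * (B + sqrt (piece_energy \<eta> J b n m x))))" for m
  proof -
    let ?S = "change_times J b n m" and ?D = "\<lambda>t. ?T (level_diff J b m (min t n))"
    have "var_le r ?D (8 * (\<Sum>t\<in>insert 0 ?S. cmod (?D t) powr r) powr (1 / r))"
    proof (rule var_le_changes)
      fix t assume t: "Suc t \<notin> ?S"
      show "?D (Suc t) = ?D t"
      proof (cases "Suc t \<le> n")
        case True
        then show ?thesis using level_diff_constant[OF t] by simp
      next
        case False
        then have "min (Suc t) n = min t n" by simp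
        then show ?thesis by (simp only:)
      qed
    qed (use r in auto)
    moreover have "(\<Sum>t\<in>insert 0 ?S. cmod (?D t) powr r) powr (1 / r)
      \<le> level_weight r (card J) m * (B + sqrt (\<Sum>t\<in>insert 0 ?S. (cmod (?D t))\<^sup>2))"
      unfolding level_weight_def
    proof (rule powr_sum_interpolate)
      fix t
      have "cmod (?D t) \<le> sqrt (card J) * vnorm J (level_diff J b m (min t n))" by (rule trig_sum_le[OF J])
      also have "\<dots> \<le> sqrt (card J) * (3 * (1/2) ^ m * B)"
        by (intro mult_left_mono order_trans[OF level_diff_le] RB) auto
      finally show "cmod (?D t) \<le> 3 * sqrt (card J) * (1/2) ^ m * B" by (simp add: mult_ac)
    qed (use r B0 in auto)
    moreover have "(\<Sum>t\<in>insert 0 ?S. (cmod (?D t))\<^sup>2) = piece_energy \<eta> J b n m x"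
      unfolding piece_energy_def
    proof (rule sum.cong[OF refl])
      fix t assume "t \<in> insert 0 ?S"
      then have "t \<le> n" by (auto simp: change_times_def)
      then show "(cmod (?D t))\<^sup>2 = (cmod (?T (level_diff J b m t)))\<^sup>2" by (simp add: min_def)
    qed
    ultimately show ?thesis using r by (elim var_le_weaken) auto
  qed
  define E where "E = (\<lambda>t. ?T (\<lambda>j. b (min t n) j - level_anchor J b (Suc k) (min t n) j))"
  have tail: "var_le r E (8 * B)"
  proof -
    have "var_le r E (8 * (\<Sum>t\<in>insert 0 {1..n}. cmod (E t) powr r) powr (1 / r))"
    proof (rule var_le_changes)
      fix t assume "Suc t \<notin> {1..n}"
      then have "min (Suc t) n = min t n" by simp
      then show "E (Suc t) = E t" by (simp only: E_def)
    qed (use r in auto)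
    moreover have "(\<Sum>t\<in>insert 0 {1..n}. cmod (E t) powr r) powr (1 / r) \<le> B"
    proof -
      define q where "q = sqrt (card J) * (1/2) ^ k * B"
      have q0: "0 \<le> q" using B0 by (simp add: q_def)
      have "cmod (E t) \<le> q" for t
      proof -
        have "cmod (E t) \<le> sqrt (card J) * vnorm J (\<lambda>j. b (min t n) j - level_anchor J b (Suc k) (min t n) j)"
          unfolding E_def by (rule trig_sum_le[OF J])
        also have "\<dots> \<le> sqrt (card J) * ((1/2) ^ k * B)"
          using anchor_close[of "(1/2) ^ k" J b "min t n"] RB[of t]
          by (intro mult_left_mono) (auto simp: level_anchor_def intro: order_trans[OF _ mult_left_mono])
        finally show ?thesis by (simp add: q_def mult_ac)
      qed
      then have "(\<Sum>t\<in>insert 0 {1..n}. cmod (E t) powr r) \<le> (\<Sum>t\<in>insert 0 {1..n}. q powr r)"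
        using r by (intro sum_mono powr_mono2) auto
      also have "\<dots> = (real n + 1) * q powr r" by (simp add: distrib_right)
      finally have "(\<Sum>t\<in>insert 0 {1..n}. cmod (E t) powr r) powr (1 / r) \<le> ((real n + 1) * q powr r) powr (1 / r)"
        using r by (intro powr_mono2 sum_nonneg) auto
      also have "\<dots> = (real n + 1) powr (1 / r) * q"
        using r q0 by (simp add: powr_mult powr_powr)
      also have "\<dots> \<le> (real n + 1) * q"
        using r q0 powr_mono[of "1 / r" 1 "real n + 1"] by (intro mult_right_mono) auto
      also have "\<dots> = (sqrt (card J) * (1/2) ^ k * (real n + 1)) * B" by (simp add: q_def mult_ac)
      also have "\<dots> \<le> 1 * B" using k B0 by (intro mult_right_mono) auto
      finally show ?thesis by simp
    qed
    ultimately show ?thesis using r by (elim var_le_weaken) auto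
  qed
  have split: "?T (b (min t n)) = E t + (\<Sum>m\<le>k. ?T (level_diff J b m (min t n)))" for t
  proof -
    have "(\<Sum>m\<le>k. ?T (level_diff J b m (min t n))) = ?T (\<lambda>j. \<Sum>m\<le>k. level_diff J b m (min t n) j)"
      unfolding trig_sum_def sum_distrib_right by (rule sum.swap)
    also have "\<dots> = ?T (level_anchor J b (Suc k) (min t n))"
      unfolding sum_level_diff[symmetric] lessThan_Suc_atMost by simp
    finally show ?thesis by (simp add: E_def trig_sum_diff)
  qed
  have "var_le r (\<lambda>t. E t + (\<Sum>m\<le>k. ?T (level_diff J b m (min t n))))
    (8 * B + (\<Sum>m\<le>k. 8 * (level_weight r (card J) m * (B + sqrt (piece_energy \<eta> J b n m x)))))"
    using r level by (intro var_le_add var_le_sum tail) auto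
  then show ?thesis unfolding split chain_bound_def B_def by (simp add: sum_distrib_left)
qed

lemma chain_bound_sq_le:
  assumes r: "2 < r"
  shows "(chain_bound r \<eta> J n k b x)\<^sup>2 \<le> 128 * (run_max J b n)\<^sup>2 + 256 * weight_total r (card J) *
    (\<Sum>m\<le>k. level_weight r (card J) m * ((run_max J b n)\<^sup>2 + piece_energy \<eta> J b n m x))"
proof -
  let ?w = "level_weight r (card J)" and ?B = "run_max J b n" and ?Y = "\<lambda>m. piece_energy \<eta> J b n m x"
  define S where "S = (\<Sum>m\<le>k. ?w m * (?B + sqrt (?Y m)))"
  have two: "(a + c)\<^sup>2 \<le> 2 * a\<^sup>2 + 2 * c\<^sup>2" for a c :: real
    using sum_squares_bound[of a c] by (simp add: power2_sum)
  have "S\<^sup>2 \<le> (\<Sum>m\<le>k. ?w m) * (\<Sum>m\<le>k. ?w m * (?B + sqrt (?Y m))\<^sup>2)"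
    unfolding S_def by (rule weighted_cauchy_schwarz) simp
  also have "\<dots> \<le> weight_total r (card J) * (\<Sum>m\<le>k. ?w m * (2 * (?B\<^sup>2 + ?Y m)))"
  proof (intro mult_mono sum_level_weight_le[OF r] sum_mono mult_left_mono)
    fix m show "(?B + sqrt (?Y m))\<^sup>2 \<le> 2 * (?B\<^sup>2 + ?Y m)"
      using two[of ?B "sqrt (?Y m)"] by simp
  qed (auto intro!: sum_nonneg weight_total_nonneg r)
  also have "(\<Sum>m\<le>k. ?w m * (2 * (?B\<^sup>2 + ?Y m))) = 2 * (\<Sum>m\<le>k. ?w m * (?B\<^sup>2 + ?Y m))"
    by (simp only: sum_distrib_left mult.left_commute)
  finally have S: "S\<^sup>2 \<le> weight_total r (card J) * (2 * (\<Sum>m\<le>k. ?w m * (?B\<^sup>2 + ?Y m)))" .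
  have "(chain_bound r \<eta> J n k b x)\<^sup>2 = (8 * ?B + 8 * S)\<^sup>2" by (simp add: chain_bound_def S_def)
  also have "\<dots> \<le> 2 * (8 * ?B)\<^sup>2 + 2 * (8 * S)\<^sup>2" by (rule two)
  also have "\<dots> = 128 * ?B\<^sup>2 + 128 * S\<^sup>2" by (simp add: power_mult_distrib)
  also have "\<dots> \<le> 128 * ?B\<^sup>2 + 128 * (weight_total r (card J) * (2 * (\<Sum>m\<le>k. ?w m * (?B\<^sup>2 + ?Y m))))"
    using S by simp
  finally show ?thesis by (simp add: mult_ac)
qed

lemma measurable_trig_sum[measurable]: "trig_sum \<eta> J u \<in> borel_measurable borel"
  unfolding trig_sum_def[abs_def] by measurable

lemma measurable_piece_energy[measurable]: "piece_energy \<eta> J b n m \<in> borel_measurable borel"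
  unfolding piece_energy_def[abs_def] by measurable

lemma measurable_chain_bound[measurable]: "chain_bound r \<eta> J n k b \<in> borel_measurable borel"
  unfolding chain_bound_def[abs_def] by measurable

definition cell :: "real \<Rightarrow> int \<Rightarrow> real set" where
  "cell \<Lambda> m = {of_int m * \<Lambda>..<of_int m * \<Lambda> + \<Lambda>}"

lemma cell_sets[measurable]: "cell \<Lambda> m \<in> sets borel" by (simp add: cell_def)

lemma mem_cell: "0 < \<Lambda> \<Longrightarrow> x \<in> cell \<Lambda> m \<longleftrightarrow> \<lfloor>x / \<Lambda>\<rfloor> = m"
  by (auto simp: cell_def floor_eq_iff field_simps)

lemma emeasure_cell: "0 \<le> \<Lambda> \<Longrightarrow> emeasure lborel (cell \<Lambda> m) = ennreal \<Lambda>"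
  by (simp add: cell_def)

lemma nn_integral_cells:
  assumes [measurable]: "f \<in> borel_measurable borel" and \<Lambda>: "0 < \<Lambda>"
  shows "(\<integral>\<^sup>+x. f x \<partial>lborel) = (\<integral>\<^sup>+m. (\<integral>\<^sup>+x. f x * indicator (cell \<Lambda> m) x \<partial>lborel) \<partial>count_space UNIV)"
proof -
  have "(\<integral>\<^sup>+m. f x * indicator (cell \<Lambda> m) x \<partial>count_space UNIV) = f x" for x
  proof -
    have "(\<integral>\<^sup>+m. f x * indicator (cell \<Lambda> m) x \<partial>count_space UNIV) = (\<Sum>m\<in>{\<lfloor>x / \<Lambda>\<rfloor>}. f x * indicator (cell \<Lambda> m) x)"
      by (rule nn_integral_count_space') (auto simp: indicator_def mem_cell[OF \<Lambda>])
    also have "\<dots> = f x" using mem_cell[OF \<Lambda>, of x "\<lfloor>x / \<Lambda>\<rfloor>"] by (simp add: indicator_def)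
    finally show ?thesis .
  qed
  then have "(\<integral>\<^sup>+x. f x \<partial>lborel) = (\<integral>\<^sup>+x. (\<integral>\<^sup>+m. f x * indicator (cell \<Lambda> m) x \<partial>count_space UNIV) \<partial>lborel)"
    by simp
  also have "\<dots> = (\<integral>\<^sup>+m. (\<integral>\<^sup>+x. f x * indicator (cell \<Lambda> m) x \<partial>lborel) \<partial>count_space UNIV)"
    by (rule nn_integral_count_space_nn_integral) auto
  finally show ?thesis .
qed

lemma nn_integral_cells_mono:
  assumes [measurable]: "f \<in> borel_measurable borel" "g \<in> borel_measurable borel" and \<Lambda>: "0 < \<Lambda>"
    and le: "\<And>m. (\<integral>\<^sup>+x. f x * indicator (cell \<Lambda> m) x \<partial>lborel) \<le> (\<integral>\<^sup>+x. g x * indicator (cell \<Lambda> m) x \<partial>lborel)"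
  shows "(\<integral>\<^sup>+x. f x \<partial>lborel) \<le> (\<integral>\<^sup>+x. g x \<partial>lborel)"
  unfolding nn_integral_cells[OF assms(1) \<Lambda>] nn_integral_cells[OF assms(2) \<Lambda>]
  by (intro nn_integral_mono le)

lemma mem_leaves: "c \<in> leaves n m \<longleftrightarrow> c div 2 ^ n = m"
proof -
  define q where "q = (2::int) ^ n"
  have q: "0 < q" by (simp add: q_def)
  have "c \<in> leaves n m \<longleftrightarrow> m * q \<le> c \<and> c < m * q + q" by (simp add: leaves_def q_def distrib_right)
  also have "\<dots> \<longleftrightarrow> c div q = m"
  proof
    assume "m * q \<le> c \<and> c < m * q + q"
    then show "c div q = m" by (intro int_div_pos_eq[of c q m "c - m * q"]) (auto simp: mult.commute)
  next
    assume "c div q = m"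
    then have "c = m * q + c mod q" using div_mult_mod_eq[of c q] by simp
    then show "m * q \<le> c \<and> c < m * q + q" using pos_mod_bound[OF q, of c] pos_mod_sign[OF q, of c] by linarith
  qed
  finally show ?thesis by (simp add: q_def)
qed

text \<open>
  Cells of the coarser scales are unions of cells of the finest scale.
\<close>

lemma floor_cell_scale:
  fixes x L :: real
  assumes "0 < L" shows "\<lfloor>x / (L * 2 ^ n)\<rfloor> = \<lfloor>x / L\<rfloor> div 2 ^ n"
  using floor_divide_real_eq_div[of "2 ^ n" "x / L"] by simp

lemma indicator_root_cell:
  assumes L: "0 < L"
  shows "(indicator (cell (L * 2 ^ n) m) x :: ennreal) = (\<Sum>c\<in>leaves n m. indicator (cell L c) x)"
proof -
  have fin: "finite (leaves n m)" by (simp add: leaves_def)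
  have "(\<Sum>c\<in>leaves n m. indicator (cell L c) x :: ennreal) = (\<Sum>c\<in>leaves n m. if c = \<lfloor>x / L\<rfloor> then 1 else 0)"
    by (intro sum.cong refl) (auto simp: indicator_def mem_cell[OF L])
  also have "\<dots> = (if \<lfloor>x / L\<rfloor> \<in> leaves n m then 1 else 0)" using fin by simp
  also have "\<dots> = indicator (cell (L * 2 ^ n) m) x"
    using L by (simp add: indicator_def mem_cell mem_leaves floor_cell_scale)
  finally show ?thesis by simp
qed

definition martingale_const :: "real \<Rightarrow> nat \<Rightarrow> real" where
  "martingale_const r M = 512 + 256 * (weight_total r M)\<^sup>2 * (4 + 22 * sieve_const)"

lemma nn_integral_piece_energy_le:
  assumes J: "finite J" and L: "0 < L"
    and sep: "\<And>i j. i \<in> J \<Longrightarrow> j \<in> J \<Longrightarrow> i \<noteq> j \<Longrightarrow> 1 / L \<le> \<bar>\<eta> i - \<eta> j\<bar>"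
  shows "(\<integral>\<^sup>+x. ennreal (piece_energy \<eta> J b n m x) * indicator (cell L c) x \<partial>lborel)
    \<le> ennreal (L * (sieve_const * (9 * (level_jumps J b n (Suc m) + level_jumps J b n m) + vsq J (b 0))))"
proof -
  let ?S = "insert 0 (change_times J b n m)"
  have "(\<integral>\<^sup>+x. ennreal (piece_energy \<eta> J b n m x) * indicator (cell L c) x \<partial>lborel)
    = (\<Sum>t\<in>?S. \<integral>\<^sup>+x. ennreal ((cmod (trig_sum \<eta> J (level_diff J b m t) x))\<^sup>2) * indicator (cell L c) x \<partial>lborel)"
    unfolding piece_energy_def by (subst nn_integral_sum[symmetric]) (auto simp: sum_distrib_right simp del: sum_ennreal simp flip: sum_ennreal)
  also have "\<dots> \<le> (\<Sum>t\<in>?S. ennreal (sieve_const * L * vsq J (level_diff J b m t)))"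
    unfolding cell_def vsq_def using J L sep by (intro sum_mono large_sieve[where L=L]) auto
  also have "\<dots> = ennreal (sieve_const * L * (\<Sum>t\<in>?S. vsq J (level_diff J b m t)))"
    using L sieve_const_pos by (subst sum_ennreal) (auto simp: sum_distrib_left)
  also have "\<dots> \<le> ennreal (sieve_const * L * (9 * (level_jumps J b n (Suc m) + level_jumps J b n m) + vsq J (b 0)))"
    using L sieve_const_pos by (intro ennreal_leI mult_left_mono sum_change_times_le) auto
  finally show ?thesis by (simp add: mult_ac)
qed

lemma jump_sum_nonneg[simp]: "0 \<le> jump_sum J \<delta> b n"
  by (simp add: jump_sum_def sum_nonneg)

lemma level_jumps_nonneg[simp]: "0 \<le> level_jumps J b n m"
  by (cases m) (auto simp: level_jumps_def)

lemma nn_integral_chain_bound_le: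
  assumes r: "2 < r" and J: "finite J" and L: "0 < L"
    and sep: "\<And>i j. i \<in> J \<Longrightarrow> j \<in> J \<Longrightarrow> i \<noteq> j \<Longrightarrow> 1 / L \<le> \<bar>\<eta> i - \<eta> j\<bar>"
  shows "(\<integral>\<^sup>+x. ennreal ((chain_bound r \<eta> J n k b x)\<^sup>2) * indicator (cell L c) x \<partial>lborel)
    \<le> ennreal (L * (128 * (run_max J b n)\<^sup>2 + 256 * weight_total r (card J) *
        (\<Sum>m\<le>k. level_weight r (card J) m * ((run_max J b n)\<^sup>2
          + sieve_const * (9 * (level_jumps J b n (Suc m) + level_jumps J b n m) + vsq J (b 0))))))"
proof -
  let ?w = "level_weight r (card J)" and ?B = "run_max J b n" and ?Y = "\<lambda>m x. piece_energy \<eta> J b n m x"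
  let ?W = "weight_total r (card J)"
  let ?Z = "\<lambda>m. sieve_const * (9 * (level_jumps J b n (Suc m) + level_jumps J b n m) + vsq J (b 0))"
  have W0: "0 \<le> ?W" by (rule weight_total_nonneg[OF r])
  have Z0: "0 \<le> ?Z m" for m using sieve_const_pos by (intro mult_nonneg_nonneg add_nonneg_nonneg) auto
  have "(\<integral>\<^sup>+x. ennreal ((chain_bound r \<eta> J n k b x)\<^sup>2) * indicator (cell L c) x \<partial>lborel)
    \<le> (\<integral>\<^sup>+x. (ennreal (128 * ?B\<^sup>2) * indicator (cell L c) x + (\<Sum>m\<le>k. ennreal (256 * ?W * ?w m) *
          (ennreal (?B\<^sup>2) * indicator (cell L c) x + ennreal (?Y m x) * indicator (cell L c) x))) \<partial>lborel)"
  proof (rule nn_integral_mono)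
    fix x
    have "ennreal ((chain_bound r \<eta> J n k b x)\<^sup>2)
      \<le> ennreal (128 * ?B\<^sup>2 + (\<Sum>m\<le>k. (256 * ?W * ?w m) * (?B\<^sup>2 + ?Y m x)))"
      using chain_bound_sq_le[OF r, of \<eta> J n k b x] by (intro ennreal_leI) (simp add: sum_distrib_left mult_ac)
    also have "\<dots> = ennreal (128 * ?B\<^sup>2) + (\<Sum>m\<le>k. ennreal (256 * ?W * ?w m) * (ennreal (?B\<^sup>2) + ennreal (?Y m x)))"
      using W0 by (subst ennreal_plus) (auto simp: sum_nonneg ennreal_mult ennreal_plus simp del: sum_ennreal simp flip: sum_ennreal)
    finally show "ennreal ((chain_bound r \<eta> J n k b x)\<^sup>2) * indicator (cell L c) x
      \<le> ennreal (128 * ?B\<^sup>2) * indicator (cell L c) x + (\<Sum>m\<le>k. ennreal (256 * ?W * ?w m) *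
          (ennreal (?B\<^sup>2) * indicator (cell L c) x + ennreal (?Y m x) * indicator (cell L c) x))"
      by (auto simp: indicator_def)
  qed
  also have "\<dots> = ennreal (128 * ?B\<^sup>2) * ennreal L + (\<Sum>m\<le>k. ennreal (256 * ?W * ?w m) *
        (ennreal (?B\<^sup>2) * ennreal L + (\<integral>\<^sup>+x. ennreal (?Y m x) * indicator (cell L c) x \<partial>lborel)))"
    using L by (simp add: nn_integral_add nn_integral_sum nn_integral_cmult nn_integral_cmult_indicator emeasure_cell)
  also have "\<dots> \<le> ennreal (128 * ?B\<^sup>2) * ennreal L + (\<Sum>m\<le>k. ennreal (256 * ?W * ?w m) *
        (ennreal (?B\<^sup>2) * ennreal L + ennreal (L * ?Z m)))"
    using J L sep by (intro add_mono order_refl sum_mono mult_left_mono nn_integral_piece_energy_le) auto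
  also have "\<dots> = ennreal (128 * ?B\<^sup>2 * L + (\<Sum>m\<le>k. (256 * ?W * ?w m) * (?B\<^sup>2 * L + L * ?Z m)))"
  proof -
    have LZ: "0 \<le> L * ?Z m" for m using L by (intro mult_nonneg_nonneg[OF _ Z0]) simp
    moreover have "0 \<le> ?B\<^sup>2 * L + L * ?Z m" for m using L by (intro add_nonneg_nonneg LZ) simp
    ultimately show ?thesis
      using W0 L by (subst ennreal_plus) (auto intro!: sum_nonneg mult_nonneg_nonneg simp: ennreal_mult ennreal_plus simp del: sum_ennreal simp flip: sum_ennreal)
  qed
  also have "128 * ?B\<^sup>2 * L + (\<Sum>m\<le>k. (256 * ?W * ?w m) * (?B\<^sup>2 * L + L * ?Z m))
     = L * (128 * ?B\<^sup>2 + 256 * ?W * (\<Sum>m\<le>k. ?w m * (?B\<^sup>2 + ?Z m)))"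
    by (simp add: distrib_left sum_distrib_left mult_ac)
  finally show ?thesis .
qed

lemma sum_leaves_chain_le:
  assumes r: "2 < r" and A: "\<And>i m. A (Suc i) m = (\<lambda>j. (A i (2 * m) j + A i (2 * m + 1) j) / 2)"
  shows "(\<Sum>c\<in>leaves n M. 128 * (run_max J (dyadic_path A n c) n)\<^sup>2 + 256 * weight_total r N *
        (\<Sum>m\<le>k. level_weight r N m * ((run_max J (dyadic_path A n c) n)\<^sup>2
          + sieve_const * (9 * (level_jumps J (dyadic_path A n c) n (Suc m) + level_jumps J (dyadic_path A n c) n m)
          + vsq J (dyadic_path A n c 0)))))
    \<le> martingale_const r N * (\<Sum>c\<in>leaves n M. vsq J (A 0 c))"
proof -
  define V where "V = (\<Sum>c\<in>leaves n M. vsq J (A 0 c))"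
  define B where "B = (\<lambda>c. (run_max J (dyadic_path A n c) n)\<^sup>2)"
  define j where "j = (\<lambda>c m. level_jumps J (dyadic_path A n c) n m)"
  define v where "v = (\<lambda>c. vsq J (dyadic_path A n c 0))"
  define w where "w = level_weight r N"
  define W where "W = weight_total r N"
  define K where "K = sieve_const"
  have V0: "0 \<le> V" by (simp add: V_def sum_nonneg)
  have K0: "0 \<le> K" using sieve_const_pos by (simp add: K_def)
  have W0: "0 \<le> W" by (simp add: W_def weight_total_nonneg r)
  have B: "(\<Sum>c\<in>leaves n M. B c) \<le> 4 * V" unfolding B_def V_def by (rule tree_maximal[where A=A, OF A])
  have jV: "(\<Sum>c\<in>leaves n M. j c m) \<le> V" for m
  proof (cases m)
    case 0 then show ?thesis using V0 by (simp add: j_def level_jumps_def)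
  next
    case (Suc l) then show ?thesis unfolding j_def level_jumps_def V_def by (simp add: tree_jumps[where A=A, OF A])
  qed
  have "v c \<le> B c" for c
    unfolding v_def B_def vnorm_sq[symmetric]
    using vnorm_le_run_max[of J "dyadic_path A n c" 0] run_max_mono[of 0 n J "dyadic_path A n c"]
    by (intro power_mono) auto
  then have vV: "(\<Sum>c\<in>leaves n M. v c) \<le> 4 * V" using B by (meson sum_mono order_trans)
  have "(\<Sum>c\<in>leaves n M. 128 * B c + 256 * W * (\<Sum>m\<le>k. w m * (B c + K * (9 * (j c (Suc m) + j c m) + v c))))
    = 128 * (\<Sum>c\<in>leaves n M. B c) + 256 * W * (\<Sum>m\<le>k. w m * ((\<Sum>c\<in>leaves n M. B c)
        + K * (9 * ((\<Sum>c\<in>leaves n M. j c (Suc m)) + (\<Sum>c\<in>leaves n M. j c m)) + (\<Sum>c\<in>leaves n M. v c))))"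
  proof -
    have "(\<Sum>c\<in>leaves n M. \<Sum>m\<le>k. w m * (B c + K * (9 * (j c (Suc m) + j c m) + v c)))
      = (\<Sum>m\<le>k. \<Sum>c\<in>leaves n M. w m * (B c + K * (9 * (j c (Suc m) + j c m) + v c)))"
      by (rule sum.swap)
    also have "\<dots> = (\<Sum>m\<le>k. w m * ((\<Sum>c\<in>leaves n M. B c)
        + K * (9 * ((\<Sum>c\<in>leaves n M. j c (Suc m)) + (\<Sum>c\<in>leaves n M. j c m)) + (\<Sum>c\<in>leaves n M. v c))))"
      by (simp only: sum_distrib_left[symmetric] sum.distrib)
    finally show ?thesis by (simp only: sum.distrib sum_distrib_left[symmetric])
  qed
  also have "\<dots> \<le> 128 * (4 * V) + 256 * W * (\<Sum>m\<le>k. w m * (4 * V + K * (9 * (V + V) + 4 * V)))"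
    using B jV vV K0 W0
    by (intro add_mono mult_left_mono sum_mono mult_nonneg_nonneg) (auto simp: w_def)
  also have "\<dots> = 512 * V + 256 * W * ((\<Sum>m\<le>k. w m) * ((4 + 22 * K) * V))"
  proof -
    have "4 * V + K * (9 * (V + V) + 4 * V) = (4 + 22 * K) * V" by (simp add: algebra_simps)
    then show ?thesis by (simp only: sum_distrib_right[symmetric])
  qed
  also have "\<dots> \<le> 512 * V + 256 * W * (W * ((4 + 22 * K) * V))"
    using sum_level_weight_le[OF r, of N k] K0 V0 W0
    by (intro add_mono mult_left_mono mult_right_mono order_refl mult_nonneg_nonneg) (auto simp: w_def W_def)
  also have "\<dots> = martingale_const r N * V"
    by (simp add: martingale_const_def W_def K_def power2_eq_square algebra_simps)
  finally show ?thesis by (simp add: B_def j_def v_def w_def W_def K_def V_def)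
qed

text \<open>
  The bound \<open>X\<close> is a finite expression in the path of the cell that contains \<open>x\<close>, hence measurable. On one
  cell of the finest scale the path is constant and only the exponentials vary, so that the large sieve
  applies; the remaining sums over the cells of a root cell are those of the tree lemmas.
\<close>

lemma martingale_variation:
  assumes r: "2 < r" and J: "finite J" and L: "0 < L"
    and sep: "\<And>i j. i \<in> J \<Longrightarrow> j \<in> J \<Longrightarrow> i \<noteq> j \<Longrightarrow> 1 / L \<le> \<bar>\<eta> i - \<eta> j\<bar>"
    and A: "\<And>i m. A (Suc i) m = (\<lambda>j. (A i (2 * m) j + A i (2 * m + 1) j) / 2)"
  obtains X :: "real \<Rightarrow> real" where "X \<in> borel_measurable borel"
    "\<And>x. var_le r (\<lambda>i. trig_sum \<eta> J (A (min i n) \<lfloor>x / (L * 2 ^ min i n)\<rfloor>) x) (X x)"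
    "(\<integral>\<^sup>+x. ennreal ((X x)\<^sup>2) \<partial>lborel)
      \<le> ennreal (martingale_const r (card J)) * (\<integral>\<^sup>+x. ennreal (vsq J (A 0 \<lfloor>x / L\<rfloor>)) \<partial>lborel)"
proof -
  have "(\<lambda>k. sqrt (card J) * (1/2) ^ k * (real n + 1)) \<longlonglongrightarrow> sqrt (card J) * 0 * (real n + 1)"
    by (intro tendsto_intros LIMSEQ_realpow_zero) auto
  then have "\<forall>\<^sub>F k in sequentially. sqrt (card J) * (1/2) ^ k * (real n + 1) < 1"
    by (rule order_tendstoD(2)) simp
  then obtain k where k: "sqrt (card J) * (1/2) ^ k * (real n + 1) \<le> 1"
    by (auto simp: eventually_sequentially intro: less_imp_le)
  define X where "X = (\<lambda>x. chain_bound r \<eta> J n k (dyadic_path A n \<lfloor>x / L\<rfloor>) x)"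
  have Xm[measurable]: "X \<in> borel_measurable borel"
    unfolding X_def
    by (rule measurable_compose_countable[where g="\<lambda>x. \<lfloor>x / L\<rfloor>" and f="\<lambda>c x. chain_bound r \<eta> J n k (dyadic_path A n c) x"]) measurable
  have Vm: "(\<lambda>x. ennreal (vsq J (A 0 \<lfloor>x / L\<rfloor>))) \<in> borel_measurable borel"
    by (rule measurable_compose_countable[where g="\<lambda>x. \<lfloor>x / L\<rfloor>" and f="\<lambda>c x. ennreal (vsq J (A 0 c))"]) measurable
  have C0: "0 \<le> martingale_const r (card J)"
    using sieve_const_pos by (simp add: martingale_const_def)
  show ?thesis
  proof (rule that[of X])
    fix x
    let ?b = "dyadic_path A n \<lfloor>x / L\<rfloor>"
    (* The variation does not see that the path runs through the scales backwards. *)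
    have anti: "antimono (\<lambda>i::nat. n - i)" by (intro antimonoI) simp
    have "var_le r (\<lambda>i. trig_sum \<eta> J (?b (min (n - i) n)) x) (X x)"
      unfolding X_def by (rule var_le_comp_antimono[OF chain_var_le[OF r J k] anti])
    moreover have "?b (min (n - i) n) = A (min i n) \<lfloor>x / (L * 2 ^ min i n)\<rfloor>" for i
    proof -
      have "n - min (n - i) n = min i n" by auto
      then show ?thesis by (simp only: dyadic_path_def floor_cell_scale[OF L])
    qed
    ultimately show "var_le r (\<lambda>i. trig_sum \<eta> J (A (min i n) \<lfloor>x / (L * 2 ^ min i n)\<rfloor>) x) (X x)"
      by simp
  next
    have "(\<integral>\<^sup>+x. ennreal ((X x)\<^sup>2) \<partial>lborel)
       \<le> (\<integral>\<^sup>+x. ennreal (martingale_const r (card J)) * ennreal (vsq J (A 0 \<lfloor>x / L\<rfloor>)) \<partial>lborel)"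
    proof (rule nn_integral_cells_mono[where \<Lambda>="L * 2 ^ n"])
      fix m
      have leafsum: "(\<integral>\<^sup>+x. f x * indicator (cell (L * 2 ^ n) m) x \<partial>lborel)
         = (\<Sum>c\<in>leaves n m. \<integral>\<^sup>+x. f x * indicator (cell L c) x \<partial>lborel)"
        if [measurable]: "f \<in> borel_measurable borel" for f
        unfolding indicator_root_cell[OF L] sum_distrib_left by (rule nn_integral_sum) measurable
      have on_cell: "f \<lfloor>x / L\<rfloor> x * indicator (cell L c) x = f c x * indicator (cell L c) x"
        for f :: "int \<Rightarrow> real \<Rightarrow> ennreal" and x c
        by (auto simp: indicator_def mem_cell[OF L])
      let ?q = "\<lambda>c. 128 * (run_max J (dyadic_path A n c) n)\<^sup>2 + 256 * weight_total r (card J) *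
        (\<Sum>m\<le>k. level_weight r (card J) m * ((run_max J (dyadic_path A n c) n)\<^sup>2
          + sieve_const * (9 * (level_jumps J (dyadic_path A n c) n (Suc m) + level_jumps J (dyadic_path A n c) n m)
          + vsq J (dyadic_path A n c 0))))"
      have q0: "0 \<le> ?q c" for c
        using sieve_const_pos weight_total_nonneg[OF r, of "card J"]
        by (intro add_nonneg_nonneg mult_nonneg_nonneg sum_nonneg) auto
      have "(\<integral>\<^sup>+x. ennreal ((X x)\<^sup>2) * indicator (cell (L * 2 ^ n) m) x \<partial>lborel)
         = (\<Sum>c\<in>leaves n m. \<integral>\<^sup>+x. ennreal ((chain_bound r \<eta> J n k (dyadic_path A n c) x)\<^sup>2) * indicator (cell L c) x \<partial>lborel)"
        by (subst leafsum)
           (simp_all add: X_def on_cell[of "\<lambda>c x. ennreal ((chain_bound r \<eta> J n k (dyadic_path A n c) x)\<^sup>2)"])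
      also have "\<dots> \<le> (\<Sum>c\<in>leaves n m. ennreal (L * ?q c))"
        by (intro sum_mono nn_integral_chain_bound_le[OF r J L sep])
      also have "\<dots> = ennreal (L * (\<Sum>c\<in>leaves n m. ?q c))"
        using L q0 by (subst sum_ennreal) (auto simp only: sum_distrib_left mult_nonneg_nonneg less_imp_le)
      also have "\<dots> \<le> ennreal (L * (martingale_const r (card J) * (\<Sum>c\<in>leaves n m. vsq J (A 0 c))))"
        using L by (intro ennreal_leI mult_left_mono sum_leaves_chain_le[where A=A, OF r A]) auto
      also have "\<dots> = (\<Sum>c\<in>leaves n m. ennreal (martingale_const r (card J) * vsq J (A 0 c)) * ennreal L)"
        using L C0 by (simp add: ennreal_mult[symmetric] sum_ennreal sum_distrib_left mult_ac)
      also have "\<dots> = (\<Sum>c\<in>leaves n m. \<integral>\<^sup>+x. ennreal (martingale_const r (card J)) * ennreal (vsq J (A 0 c)) * indicator (cell L c) x \<partial>lborel)"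
        using L C0 by (simp add: nn_integral_cmult_indicator emeasure_cell ennreal_mult)
      also have "\<dots> = (\<integral>\<^sup>+x. ennreal (martingale_const r (card J)) * ennreal (vsq J (A 0 \<lfloor>x / L\<rfloor>)) * indicator (cell (L * 2 ^ n) m) x \<partial>lborel)"
        using Vm by (subst leafsum)
           (simp_all add: on_cell[of "\<lambda>c x. ennreal (martingale_const r (card J)) * ennreal (vsq J (A 0 c))"])
      finally show "(\<integral>\<^sup>+x. ennreal ((X x)\<^sup>2) * indicator (cell (L * 2 ^ n) m) x \<partial>lborel)
         \<le> (\<integral>\<^sup>+x. ennreal (martingale_const r (card J)) * ennreal (vsq J (A 0 \<lfloor>x / L\<rfloor>)) * indicator (cell (L * 2 ^ n) m) x \<partial>lborel)" .
    qed (use L Vm in auto)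
    also have "\<dots> = ennreal (martingale_const r (card J)) * (\<integral>\<^sup>+x. ennreal (vsq J (A 0 \<lfloor>x / L\<rfloor>)) \<partial>lborel)"
      using Vm by (intro nn_integral_cmult) simp
    finally show "(\<integral>\<^sup>+x. ennreal ((X x)\<^sup>2) \<partial>lborel)
      \<le> ennreal (martingale_const r (card J)) * (\<integral>\<^sup>+x. ennreal (vsq J (A 0 \<lfloor>x / L\<rfloor>)) \<partial>lborel)" .
  qed (rule Xm)
qed


section \<open>Low-frequency cutoffs and dyadic averages\<close>

definition cell_avg :: "real \<Rightarrow> (real \<Rightarrow> complex) \<Rightarrow> int \<Rightarrow> complex" where
  "cell_avg \<Lambda> u m = (LINT x|lborel. indicator (cell \<Lambda> m) x *\<^sub>R u x) / \<Lambda>"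

lemma cauchy_schwarz_cell:
  assumes [measurable]: "f \<in> borel_measurable borel" and \<Lambda>: "0 < \<Lambda>"
  shows "(\<integral>\<^sup>+t. ennreal (cmod (f t)) * indicator {c..<c + \<Lambda>} t \<partial>lborel)\<^sup>2
    \<le> ennreal \<Lambda> * (\<integral>\<^sup>+t. ennreal ((cmod (f t))\<^sup>2) * indicator {c..<c + \<Lambda>} t \<partial>lborel)"
proof -
  let ?I = "indicator {c..<c + \<Lambda>} :: real \<Rightarrow> ennreal"
  have "(\<integral>\<^sup>+t. ennreal (cmod (f t)) * ?I t \<partial>lborel)\<^sup>2 = (\<integral>\<^sup>+t. ?I t * (ennreal (cmod (f t)) * ?I t) \<partial>lborel)\<^sup>2"
    by (intro arg_cong[where f="\<lambda>x. x\<^sup>2"] nn_integral_cong) (auto simp: indicator_def)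
  also have "\<dots> \<le> (\<integral>\<^sup>+t. (?I t)\<^sup>2 \<partial>lborel) * (\<integral>\<^sup>+t. (ennreal (cmod (f t)) * ?I t)\<^sup>2 \<partial>lborel)"
    by (rule Cauchy_Schwarz_nn_integral) auto
  also have "(\<integral>\<^sup>+t. (?I t)\<^sup>2 \<partial>lborel) = (\<integral>\<^sup>+t. ?I t \<partial>lborel)"
    by (intro nn_integral_cong) (auto simp: indicator_def)
  also have "\<dots> = ennreal \<Lambda>" using \<Lambda> by simp
  also have "(\<integral>\<^sup>+t. (ennreal (cmod (f t)) * ?I t)\<^sup>2 \<partial>lborel) = (\<integral>\<^sup>+t. ennreal ((cmod (f t))\<^sup>2) * ?I t \<partial>lborel)"
    by (intro nn_integral_cong) (auto simp: indicator_def ennreal_power)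
  finally show ?thesis .
qed

lemma synth_integrable_cell:
  assumes "integrable lborel G"
  shows "integrable lborel (\<lambda>x. indicator (cell \<Lambda> m) x *\<^sub>R synth G x)"
  unfolding cell_def by (rule synth_set_integrable[OF assms])

lemma cell_avg_sum:
  assumes "finite J" "\<And>j. j \<in> J \<Longrightarrow> integrable lborel (G j)"
  shows "cell_avg \<Lambda> (\<lambda>x. \<Sum>j\<in>J. c j * synth (G j) x) m = (\<Sum>j\<in>J. c j * cell_avg \<Lambda> (synth (G j)) m)"
proof -
  have "(LINT x|lborel. indicator (cell \<Lambda> m) x *\<^sub>R (\<Sum>j\<in>J. c j * synth (G j) x))
      = (LINT x|lborel. (\<Sum>j\<in>J. c j * (indicator (cell \<Lambda> m) x *\<^sub>R synth (G j) x)))"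
    by (simp add: scaleR_sum_right)
  also have "\<dots> = (\<Sum>j\<in>J. (LINT x|lborel. c j * (indicator (cell \<Lambda> m) x *\<^sub>R synth (G j) x)))"
    using assms by (intro Bochner_Integration.integral_sum integrable_mult_right synth_integrable_cell) auto
  also have "\<dots> = (\<Sum>j\<in>J. c j * (LINT x|lborel. indicator (cell \<Lambda> m) x *\<^sub>R synth (G j) x))"
    by (intro sum.cong refl integral_mult_right_zero)
  finally show ?thesis by (simp add: cell_avg_def sum_divide_distrib)
qed

text \<open>
  A Poincare inequality: the deviation from the mean is at most the integral of the derivative, which is
  estimated by Cauchy-Schwarz.
\<close>

lemma synth_minus_avg_le:
  assumes G: "bandlim R G" and \<Lambda>: "0 < \<Lambda>" and x: "x \<in> cell \<Lambda> m"
  shows "ennreal ((cmod (synth G x - cell_avg \<Lambda> (synth G) m))\<^sup>2)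
    \<le> ennreal \<Lambda> * (\<integral>\<^sup>+t. ennreal ((cmod (synth (freq_deriv G) t))\<^sup>2) * indicator (cell \<Lambda> m) t \<partial>lborel)"
proof -
  note [measurable] = bandlim_measurable[OF G] bandlim_measurable[OF bandlim_freq_deriv(1)[OF G]]
  define D where "D = (\<integral>\<^sup>+t. ennreal (cmod (synth (freq_deriv G) t)) * indicator (cell \<Lambda> m) t \<partial>lborel)"
  let ?I = "indicator (cell \<Lambda> m)"
  have i1: "integrable lborel (\<lambda>y. ?I y *\<^sub>R synth G x)" unfolding cell_def by (rule integrable_indicator_Ico)
  have i2: "integrable lborel (\<lambda>y. ?I y *\<^sub>R synth G y)" by (rule synth_integrable_cell[OF bandlim_integrable[OF G]])
  have "(LINT y|lborel. ?I y *\<^sub>R synth G x) = \<Lambda> * synth G x"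
  proof -
    have "(LINT y|lborel. ?I y *\<^sub>R synth G x) = measure lborel (cell \<Lambda> m) *\<^sub>R synth G x"
      using \<Lambda> by (subst integral_scaleR_left) (auto simp: cell_def)
    then show ?thesis using \<Lambda> by (simp add: cell_def scaleR_conv_of_real)
  qed
  then have "\<Lambda> * (synth G x - cell_avg \<Lambda> (synth G) m) = (LINT y|lborel. ?I y *\<^sub>R synth G x) - (LINT y|lborel. ?I y *\<^sub>R synth G y)"
    using \<Lambda> by (simp add: cell_avg_def right_diff_distrib)
  also have "\<dots> = (LINT y|lborel. ?I y *\<^sub>R (synth G x - synth G y))"
    unfolding scaleR_diff_right by (rule Bochner_Integration.integral_diff[OF i1 i2, symmetric])
  finally have eq: "\<Lambda> * (synth G x - cell_avg \<Lambda> (synth G) m) = (LINT y|lborel. ?I y *\<^sub>R (synth G x - synth G y))" .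
  have "ennreal (cmod (\<Lambda> * (synth G x - cell_avg \<Lambda> (synth G) m)))
      \<le> (\<integral>\<^sup>+y. ennreal (cmod (?I y *\<^sub>R (synth G x - synth G y))) \<partial>lborel)"
    unfolding eq scaleR_diff_right
    by (intro integral_norm_bound_ennreal Bochner_Integration.integrable_diff i1 i2)
  also have "\<dots> \<le> (\<integral>\<^sup>+y. D * ?I y \<partial>lborel)"
  proof (rule nn_integral_mono)
    fix y
    show "ennreal (cmod (?I y *\<^sub>R (synth G x - synth G y))) \<le> D * ?I y"
      using synth_diff_le[OF G, of x "of_int m * \<Lambda>" \<Lambda> y] x
      by (cases "y \<in> cell \<Lambda> m") (auto simp: D_def cell_def)
  qed
  also have "\<dots> = ennreal \<Lambda> * D" using \<Lambda> by (simp add: nn_integral_cmult_indicator emeasure_cell mult.commute)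
  finally have "ennreal \<Lambda> * ennreal (cmod (synth G x - cell_avg \<Lambda> (synth G) m)) \<le> ennreal \<Lambda> * D"
    using \<Lambda> by (simp add: norm_mult ennreal_mult)
  then have "ennreal (cmod (synth G x - cell_avg \<Lambda> (synth G) m)) \<le> D"
    using \<Lambda> by (subst (asm) ennreal_mult_le_mult_iff) auto
  then have "ennreal ((cmod (synth G x - cell_avg \<Lambda> (synth G) m))\<^sup>2) \<le> D\<^sup>2"
    by (simp add: ennreal_power[symmetric] power_mono)
  also have "\<dots> \<le> ennreal \<Lambda> * (\<integral>\<^sup>+t. ennreal ((cmod (synth (freq_deriv G) t))\<^sup>2) * ?I t \<partial>lborel)"
    unfolding D_def cell_def by (rule cauchy_schwarz_cell[OF _ \<Lambda>]) measurable
  finally show ?thesis .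
qed

lemma freq_deriv_sum:
  "freq_deriv (\<lambda>\<omega>. \<Sum>j\<in>J. c j * G j \<omega>) = (\<lambda>\<omega>. \<Sum>j\<in>J. c j * freq_deriv (G j) \<omega>)"
  by (simp add: freq_deriv_def fun_eq_iff sum_distrib_left mult_ac)

text \<open>
  For fixed \<open>x\<close> the exponentials are coefficients, so the pointwise inequality can be applied to the linear
  combination \<open>\<Sum>\<^sub>j e(\<eta>\<^sub>j x) h\<^sub>j\<close>. After exchanging the integrals, the large sieve in \<open>x\<close> is available for each
  value of the derivatives.
\<close>

lemma trig_minus_avg_energy_le:
  assumes J: "finite J" and L: "0 < L" "L \<le> \<Lambda>"
    and sep: "\<And>i j. i \<in> J \<Longrightarrow> j \<in> J \<Longrightarrow> i \<noteq> j \<Longrightarrow> 1 / L \<le> \<bar>\<eta> i - \<eta> j\<bar>"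
    and H: "\<And>j. j \<in> J \<Longrightarrow> bandlim R (H j)"
  shows "energy (\<lambda>x. trig_sum \<eta> J (\<lambda>j. synth (H j) x - cell_avg \<Lambda> (synth (H j)) \<lfloor>x / \<Lambda>\<rfloor>) x)
    \<le> ennreal (sieve_const * (2 * pi * R * \<Lambda>)\<^sup>2) * (\<Sum>j\<in>J. energy (H j))"
proof -
  have \<Lambda>: "0 < \<Lambda>" using L by linarith
  have Hm[measurable]: "H j \<in> borel_measurable borel" "freq_deriv (H j) \<in> borel_measurable borel" if "j \<in> J" for j
    using bandlim_measurable[OF H[OF that]] bandlim_measurable[OF bandlim_freq_deriv(1)[OF H[OF that]]] by auto
  define U where "U = (\<lambda>m x. trig_sum \<eta> J (\<lambda>j. synth (H j) x - cell_avg \<Lambda> (synth (H j)) m) x)"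
  define Q where "Q = (\<lambda>t. \<Sum>j\<in>J. ennreal ((cmod (synth (freq_deriv (H j)) t))\<^sup>2))"
  have Um[measurable]: "U m \<in> borel_measurable borel" for m
    unfolding U_def trig_sum_def by (intro borel_measurable_sum) measurable
  have Qm[measurable]: "Q \<in> borel_measurable borel"
    unfolding Q_def by (intro borel_measurable_sum) measurable
  have Sm: "(\<lambda>(x, t). trig_sum \<eta> J (\<lambda>j. synth (freq_deriv (H j)) t) x) \<in> borel_measurable (lborel \<Otimes>\<^sub>M lborel)"
    unfolding trig_sum_def case_prod_beta
  proof (intro borel_measurable_sum)
    fix j assume j: "j \<in> J"
    note [measurable] = Hm[OF j]
    have [measurable]: "synth (freq_deriv (H j)) \<in> borel_measurable borel" by measurable
    show "(\<lambda>p. synth (freq_deriv (H j)) (snd p) * cis (2 * pi * \<eta> j * fst p)) \<in> borel_measurable (lborel \<Otimes>\<^sub>M lborel)"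
      by measurable
  qed
  have pt: "ennreal ((cmod (U m x))\<^sup>2)
      \<le> ennreal \<Lambda> * (\<integral>\<^sup>+t. ennreal ((cmod (trig_sum \<eta> J (\<lambda>j. synth (freq_deriv (H j)) t) x))\<^sup>2) * indicator (cell \<Lambda> m) t \<partial>lborel)"
    if x: "x \<in> cell \<Lambda> m" for m x
  proof -
    define c where "c = (\<lambda>j. cis (2 * pi * \<eta> j * x))"
    define G where "G = (\<lambda>\<omega>. \<Sum>j\<in>J. c j * H j \<omega>)"
    have G: "bandlim R G" unfolding G_def
      by (intro bandlim_sum J bandlim_mult[where K=1, OF H]) (auto simp: c_def)
    have Hi: "integrable lborel (H j)" if "j \<in> J" for j using bandlim_integrable[OF H[OF that]] .
    have Di: "integrable lborel (freq_deriv (H j))" if "j \<in> J" for j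
      using bandlim_integrable[OF bandlim_freq_deriv(1)[OF H[OF that]]] .
    have sG: "synth G = (\<lambda>y. \<Sum>j\<in>J. c j * synth (H j) y)"
      unfolding G_def by (intro ext synth_sum[OF J] Hi)
    have ca: "cell_avg \<Lambda> (\<lambda>y. \<Sum>j\<in>J. c j * synth (H j) y) m = (\<Sum>j\<in>J. c j * cell_avg \<Lambda> (synth (H j)) m)"
      by (rule cell_avg_sum[OF J]) (rule Hi)
    have "U m x = synth G x - cell_avg \<Lambda> (synth G) m"
      unfolding sG ca
      by (simp add: U_def trig_sum_def c_def left_diff_distrib right_diff_distrib sum_subtractf mult.commute)
    moreover have "synth (freq_deriv G) t = trig_sum \<eta> J (\<lambda>j. synth (freq_deriv (H j)) t) x" for t
    proof -
      have "synth (freq_deriv G) t = (\<Sum>j\<in>J. c j * synth (freq_deriv (H j)) t)"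
        unfolding G_def freq_deriv_sum by (rule synth_sum[OF J]) (rule Di)
      then show ?thesis by (simp add: trig_sum_def c_def mult.commute)
    qed
    ultimately show ?thesis using synth_minus_avg_le[OF G \<Lambda> x] by simp
  qed
  have "energy (\<lambda>x. U \<lfloor>x / \<Lambda>\<rfloor> x) \<le> (\<integral>\<^sup>+x. ennreal (sieve_const * \<Lambda>\<^sup>2) * Q x \<partial>lborel)"
    unfolding energy_def
  proof (rule nn_integral_cells_mono[OF _ _ \<Lambda>])
    have "(\<lambda>x. U \<lfloor>x / \<Lambda>\<rfloor> x) \<in> borel_measurable borel"
      by (rule measurable_compose_countable[where g="\<lambda>x. \<lfloor>x / \<Lambda>\<rfloor>" and f=U]) measurable
    then show "(\<lambda>x. ennreal ((cmod (U \<lfloor>x / \<Lambda>\<rfloor> x))\<^sup>2)) \<in> borel_measurable borel" by measurable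
    fix m
    let ?I = "indicator (cell \<Lambda> m) :: real \<Rightarrow> ennreal"
    let ?S = "\<lambda>x t. ennreal ((cmod (trig_sum \<eta> J (\<lambda>j. synth (freq_deriv (H j)) t) x))\<^sup>2)"
    have "(\<integral>\<^sup>+x. ennreal ((cmod (U \<lfloor>x / \<Lambda>\<rfloor> x))\<^sup>2) * ?I x \<partial>lborel)
       \<le> (\<integral>\<^sup>+x. (\<integral>\<^sup>+t. ennreal \<Lambda> * (?S x t * ?I x * ?I t) \<partial>lborel) \<partial>lborel)"
    proof (rule nn_integral_mono)
      fix x
      show "ennreal ((cmod (U \<lfloor>x / \<Lambda>\<rfloor> x))\<^sup>2) * ?I x \<le> (\<integral>\<^sup>+t. ennreal \<Lambda> * (?S x t * ?I x * ?I t) \<partial>lborel)"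
      proof (cases "x \<in> cell \<Lambda> m")
        case True
        have "(\<lambda>t. ?S x t * ?I t) \<in> borel_measurable lborel"
          using Sm by measurable
        then have "(\<integral>\<^sup>+t. ennreal \<Lambda> * (?S x t * ?I t) \<partial>lborel) = ennreal \<Lambda> * (\<integral>\<^sup>+t. ?S x t * ?I t \<partial>lborel)"
          by (rule nn_integral_cmult)
        then show ?thesis using pt[OF True] True mem_cell[OF \<Lambda>, of x m] by simp
      qed simp
    qed
    also have "\<dots> = (\<integral>\<^sup>+t. (\<integral>\<^sup>+x. ennreal \<Lambda> * (?S x t * ?I x * ?I t) \<partial>lborel) \<partial>lborel)"
      by (rule lborel_pair.Fubini'[symmetric]) (use Sm in measurable)
    also have "\<dots> \<le> (\<integral>\<^sup>+t. ennreal (sieve_const * \<Lambda>\<^sup>2) * Q t * ?I t \<partial>lborel)"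
    proof (rule nn_integral_mono)
      fix t
      have m1: "(\<lambda>x. ?S x t * ?I x) \<in> borel_measurable lborel" by measurable
      have "(\<integral>\<^sup>+x. ennreal \<Lambda> * (?S x t * ?I x * ?I t) \<partial>lborel) = ennreal \<Lambda> * ((\<integral>\<^sup>+x. ?S x t * ?I x \<partial>lborel) * ?I t)"
        using m1 by (simp add: nn_integral_cmult nn_integral_multc)
      also have "\<dots> \<le> ennreal \<Lambda> * (ennreal (sieve_const * \<Lambda> * (\<Sum>j\<in>J. (cmod (synth (freq_deriv (H j)) t))\<^sup>2)) * ?I t)"
        unfolding cell_def using J L sep by (intro mult_left_mono mult_right_mono large_sieve[where L=L]) auto
      also have "ennreal (sieve_const * \<Lambda> * (\<Sum>j\<in>J. (cmod (synth (freq_deriv (H j)) t))\<^sup>2)) = ennreal (sieve_const * \<Lambda>) * Q t"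
        unfolding Q_def using \<Lambda> sieve_const_pos by (simp add: ennreal_mult sum_nonneg)
      also have "ennreal \<Lambda> * (ennreal (sieve_const * \<Lambda>) * Q t * ?I t) = ennreal (sieve_const * \<Lambda>\<^sup>2) * Q t * ?I t"
        using \<Lambda> sieve_const_pos by (simp add: ennreal_mult power2_eq_square mult_ac)
      finally show "(\<integral>\<^sup>+x. ennreal \<Lambda> * (?S x t * ?I x * ?I t) \<partial>lborel) \<le> ennreal (sieve_const * \<Lambda>\<^sup>2) * Q t * ?I t" .
    qed
    finally show "(\<integral>\<^sup>+x. ennreal ((cmod (U \<lfloor>x / \<Lambda>\<rfloor> x))\<^sup>2) * ?I x \<partial>lborel)
       \<le> (\<integral>\<^sup>+t. ennreal (sieve_const * \<Lambda>\<^sup>2) * Q t * ?I t \<partial>lborel)" .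
  qed measurable
  also have "\<dots> = ennreal (sieve_const * \<Lambda>\<^sup>2) * (\<Sum>j\<in>J. energy (synth (freq_deriv (H j))))"
  proof -
    have "(\<integral>\<^sup>+x. Q x \<partial>lborel) = (\<Sum>j\<in>J. energy (synth (freq_deriv (H j))))"
      unfolding Q_def energy_def
    proof (rule nn_integral_sum)
      fix j assume "j \<in> J"
      note [measurable] = Hm[OF this]
      have [measurable]: "synth (freq_deriv (H j)) \<in> borel_measurable borel" by measurable
      show "(\<lambda>x. ennreal ((cmod (synth (freq_deriv (H j)) x))\<^sup>2)) \<in> borel_measurable lborel" by measurable
    qed
    then show ?thesis by (subst nn_integral_cmult) auto
  qed
  also have "\<dots> \<le> ennreal (sieve_const * \<Lambda>\<^sup>2) * (\<Sum>j\<in>J. ennreal ((2 * pi * R)\<^sup>2) * energy (H j))"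
  proof (intro mult_left_mono sum_mono)
    fix j assume "j \<in> J"
    then show "energy (synth (freq_deriv (H j))) \<le> ennreal ((2 * pi * R)\<^sup>2) * energy (H j)"
      using H bandlim_freq_deriv bandlim_integrable energy_synth_le order_trans by meson
  qed auto
  also have "\<dots> = ennreal (sieve_const * (2 * pi * R * \<Lambda>)\<^sup>2) * (\<Sum>j\<in>J. energy (H j))"
  proof -
    have "ennreal (sieve_const * \<Lambda>\<^sup>2) * ennreal ((2 * pi * R)\<^sup>2) = ennreal (sieve_const * (2 * pi * R * \<Lambda>)\<^sup>2)"
      using sieve_const_pos by (subst ennreal_mult[symmetric]) (auto simp: power_mult_distrib mult_ac)
    then show ?thesis by (simp only: sum_distrib_left[symmetric] mult.assoc[symmetric])
  qed
  finally show ?thesis unfolding U_def .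
qed

text \<open>
  A point value is the value at another point of the interval plus an integral of the derivative; one
  averages over the other point.
\<close>

lemma sobolev_point:
  assumes F: "bandlim R F" and \<delta>: "0 < \<delta>" and b: "b \<in> {c..c + \<delta>}"
  shows "ennreal ((cmod (synth F b))\<^sup>2)
    \<le> ennreal (2 / \<delta>) * (\<integral>\<^sup>+t. ennreal ((cmod (synth F t))\<^sup>2) * indicator {c..<c + \<delta>} t \<partial>lborel)
    + ennreal (2 * \<delta>) * (\<integral>\<^sup>+t. ennreal ((cmod (synth (freq_deriv F) t))\<^sup>2) * indicator {c..<c + \<delta>} t \<partial>lborel)"
proof -
  note [measurable] = bandlim_measurable[OF F] bandlim_measurable[OF bandlim_freq_deriv(1)[OF F]]
  let ?I = "indicator {c..<c + \<delta>} :: real \<Rightarrow> ennreal"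
  define E where "E = (\<integral>\<^sup>+t. ennreal ((cmod (synth (freq_deriv F) t))\<^sup>2) * ?I t \<partial>lborel)"
  define N where "N = (\<integral>\<^sup>+t. ennreal ((cmod (synth F t))\<^sup>2) * ?I t \<partial>lborel)"
  have D2: "(\<integral>\<^sup>+t. ennreal (cmod (synth (freq_deriv F) t)) * ?I t \<partial>lborel)\<^sup>2 \<le> ennreal \<delta> * E"
    unfolding E_def by (rule cauchy_schwarz_cell[OF _ \<delta>]) measurable
  have pt: "ennreal ((cmod (synth F b))\<^sup>2) * ?I t \<le> 2 * (ennreal ((cmod (synth F t))\<^sup>2) * ?I t) + 2 * (ennreal \<delta> * E) * ?I t" for t
  proof (cases "t \<in> {c..<c + \<delta>}")
    case True
    have "ennreal (cmod (synth F b - synth F t)) \<le> (\<integral>\<^sup>+t. ennreal (cmod (synth (freq_deriv F) t)) * ?I t \<partial>lborel)"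
      using True b by (intro synth_diff_le[OF F]) auto
    then have "(ennreal (cmod (synth F b - synth F t)))\<^sup>2 \<le> ennreal \<delta> * E"
      using D2 by (meson order_trans power_mono zero_le)
    then have d: "ennreal ((cmod (synth F b - synth F t))\<^sup>2) \<le> ennreal \<delta> * E"
      by (simp add: ennreal_power)
    have "(cmod (synth F b))\<^sup>2 \<le> (cmod (synth F t) + cmod (synth F b - synth F t))\<^sup>2"
      by (intro power_mono norm_triangle_sub) auto
    also have "\<dots> \<le> 2 * (cmod (synth F t))\<^sup>2 + 2 * (cmod (synth F b - synth F t))\<^sup>2"
      using sum_squares_bound[of "cmod (synth F t)" "cmod (synth F b - synth F t)"] by (simp add: power2_sum)
    finally have "ennreal ((cmod (synth F b))\<^sup>2)
       \<le> ennreal (2 * (cmod (synth F t))\<^sup>2 + 2 * (cmod (synth F b - synth F t))\<^sup>2)" by (rule ennreal_leI)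
    also have "\<dots> = 2 * ennreal ((cmod (synth F t))\<^sup>2) + 2 * ennreal ((cmod (synth F b - synth F t))\<^sup>2)"
      by (simp add: ennreal_plus ennreal_mult)
    also have "\<dots> \<le> 2 * ennreal ((cmod (synth F t))\<^sup>2) + 2 * (ennreal \<delta> * E)"
      using d by (intro add_mono mult_left_mono) auto
    finally show ?thesis using True by simp
  qed simp
  have "ennreal \<delta> * ennreal ((cmod (synth F b))\<^sup>2) = (\<integral>\<^sup>+t. ennreal ((cmod (synth F b))\<^sup>2) * ?I t \<partial>lborel)"
    using \<delta> by (subst nn_integral_cmult_indicator) (auto simp: mult.commute)
  also have "\<dots> \<le> (\<integral>\<^sup>+t. 2 * (ennreal ((cmod (synth F t))\<^sup>2) * ?I t) + 2 * (ennreal \<delta> * E) * ?I t \<partial>lborel)"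
    by (intro nn_integral_mono pt)
  also have "\<dots> = 2 * N + 2 * (ennreal \<delta> * E) * ennreal \<delta>"
    unfolding N_def using \<delta> by (subst nn_integral_add) (auto simp: nn_integral_cmult nn_integral_cmult_indicator)
  finally have le: "ennreal \<delta> * ennreal ((cmod (synth F b))\<^sup>2) \<le> 2 * N + 2 * (ennreal \<delta> * E) * ennreal \<delta>" .
  have inv: "ennreal (1 / \<delta>) * ennreal \<delta> = 1" using \<delta> by (simp add: ennreal_mult[symmetric])
  have "ennreal ((cmod (synth F b))\<^sup>2) = ennreal (1 / \<delta>) * (ennreal \<delta> * ennreal ((cmod (synth F b))\<^sup>2))"
    by (simp add: mult.assoc[symmetric] inv)
  also have "\<dots> \<le> ennreal (1 / \<delta>) * (2 * N + 2 * (ennreal \<delta> * E) * ennreal \<delta>)"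
    by (intro mult_left_mono le) auto
  also have "\<dots> = ennreal (1 / \<delta>) * 2 * N + (ennreal (1 / \<delta>) * ennreal \<delta>) * (2 * ennreal \<delta>) * E"
    by (simp add: distrib_left mult_ac)
  also have "\<dots> = ennreal (2 / \<delta>) * N + ennreal (2 * \<delta>) * E"
  proof -
    have e2: "(2 :: ennreal) = ennreal 2" by simp
    have "ennreal (1 / \<delta>) * 2 = ennreal (2 / \<delta>)"
      unfolding e2 using \<delta> by (subst ennreal_mult[symmetric]) auto
    moreover have "2 * ennreal \<delta> = ennreal (2 * \<delta>)"
      unfolding e2 using \<delta> by (subst ennreal_mult[symmetric]) auto
    ultimately
    show ?thesis by (simp add: inv)
  qed
  finally show ?thesis by (simp add: N_def E_def)
qed


lemma cell_avg_freq_deriv: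
  assumes F: "bandlim R F" and \<Lambda>: "0 < \<Lambda>"
  shows "cell_avg \<Lambda> (synth (freq_deriv F)) m
    = (synth F (of_int m * \<Lambda> + \<Lambda>) - synth F (of_int m * \<Lambda>)) / \<Lambda>"
  unfolding cell_avg_def cell_def using synth_FTC[OF F, of "of_int m * \<Lambda>" "of_int m * \<Lambda> + \<Lambda>"] \<Lambda> by simp

text \<open>
  The mean of a derivative over a cell is a difference quotient of end point values. These are estimated on
  subintervals of length \<open>\<delta>\<close> inside the cell, where \<open>\<delta>\<close> may be much smaller than the cell: for oscillating
  functions this is where the cancellation in the mean comes from.
\<close>

lemma trig_avg_energy_le:
  assumes J: "finite J" and L: "0 < L" "L \<le> \<Lambda>" and \<delta>: "0 < \<delta>" "\<delta> \<le> \<Lambda>"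
    and sep: "\<And>i j. i \<in> J \<Longrightarrow> j \<in> J \<Longrightarrow> i \<noteq> j \<Longrightarrow> 1 / L \<le> \<bar>\<eta> i - \<eta> j\<bar>"
    and F: "\<And>j. j \<in> J \<Longrightarrow> bandlim R (F j)"
  shows "energy (\<lambda>x. trig_sum \<eta> J (\<lambda>j. cell_avg \<Lambda> (synth (freq_deriv (F j))) \<lfloor>x / \<Lambda>\<rfloor>) x)
    \<le> ennreal (4 * sieve_const / \<Lambda>) *
      (\<Sum>j\<in>J. ennreal (2 / \<delta>) * energy (F j) + ennreal (2 * \<delta>) * energy (freq_deriv (F j)))"
proof -
  have \<Lambda>: "0 < \<Lambda>" using L by linarith
  define S where "S = (\<lambda>j x. ennreal (2 / \<delta>) * ennreal ((cmod (synth (F j) x))\<^sup>2)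
      + ennreal (2 * \<delta>) * ennreal ((cmod (synth (freq_deriv (F j)) x))\<^sup>2))"
  define a where "a = (\<lambda>j m. cell_avg \<Lambda> (synth (freq_deriv (F j))) m)"
  have synth_m: "synth (F j) \<in> borel_measurable borel" "synth (freq_deriv (F j)) \<in> borel_measurable borel"
    if "j \<in> J" for j
    using bandlim_measurable[OF F[OF that]] bandlim_measurable[OF bandlim_freq_deriv(1)[OF F[OF that]]]
    by (auto intro: measurable_synth)
  have Sm: "S j \<in> borel_measurable borel" if "j \<in> J" for j
  proof -
    note [measurable] = synth_m[OF that]
    show ?thesis unfolding S_def by measurable
  qed
  have end_le: "ennreal ((cmod (synth (F j) b))\<^sup>2) \<le> (\<integral>\<^sup>+x. S j x * indicator (cell \<Lambda> m) x \<partial>lborel)"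
    if j: "j \<in> J" and b: "b \<in> {c..c + \<delta>}" and sub: "{c..<c + \<delta>} \<subseteq> cell \<Lambda> m" for j b c m
  proof -
    note [measurable] = synth_m[OF j]
    have "ennreal ((cmod (synth (F j) b))\<^sup>2)
      \<le> ennreal (2 / \<delta>) * (\<integral>\<^sup>+t. ennreal ((cmod (synth (F j) t))\<^sup>2) * indicator {c..<c + \<delta>} t \<partial>lborel)
      + ennreal (2 * \<delta>) * (\<integral>\<^sup>+t. ennreal ((cmod (synth (freq_deriv (F j)) t))\<^sup>2) * indicator {c..<c + \<delta>} t \<partial>lborel)"
      by (rule sobolev_point[OF F[OF j] \<delta>(1) b])
    also have "\<dots> = (\<integral>\<^sup>+t. S j t * indicator {c..<c + \<delta>} t \<partial>lborel)"
      unfolding S_def by (simp add: distrib_right nn_integral_add nn_integral_cmult mult.assoc)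
    also have "\<dots> \<le> (\<integral>\<^sup>+t. S j t * indicator (cell \<Lambda> m) t \<partial>lborel)"
      using sub by (intro nn_integral_mono) (auto simp: indicator_def)
    finally show ?thesis .
  qed
  have "energy (\<lambda>x. trig_sum \<eta> J (\<lambda>j. a j \<lfloor>x / \<Lambda>\<rfloor>) x) \<le> (\<integral>\<^sup>+x. ennreal (4 * sieve_const / \<Lambda>) * (\<Sum>j\<in>J. S j x) \<partial>lborel)"
    unfolding energy_def
  proof (rule nn_integral_cells_mono[OF _ _ \<Lambda>])
    have "(\<lambda>x. trig_sum \<eta> J (\<lambda>j. a j \<lfloor>x / \<Lambda>\<rfloor>) x) \<in> borel_measurable borel"
      by (rule measurable_compose_countable[where g="\<lambda>x. \<lfloor>x / \<Lambda>\<rfloor>" and f="\<lambda>m. trig_sum \<eta> J (\<lambda>j. a j m)"]) measurable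
    then show "(\<lambda>x. ennreal ((cmod (trig_sum \<eta> J (\<lambda>j. a j \<lfloor>x / \<Lambda>\<rfloor>) x))\<^sup>2)) \<in> borel_measurable borel" by measurable
    show "(\<lambda>x. ennreal (4 * sieve_const / \<Lambda>) * (\<Sum>j\<in>J. S j x)) \<in> borel_measurable borel"
      using Sm by (intro borel_measurable_times_ennreal borel_measurable_sum) auto
    fix m
    let ?I = "indicator (cell \<Lambda> m) :: real \<Rightarrow> ennreal"
    have a_sq: "(cmod (a j m))\<^sup>2 \<le> 2 / \<Lambda>\<^sup>2 * ((cmod (synth (F j) (of_int m * \<Lambda> + \<Lambda>)))\<^sup>2 + (cmod (synth (F j) (of_int m * \<Lambda>)))\<^sup>2)"
      if "j \<in> J" for j
    proof -
      let ?p = "synth (F j) (of_int m * \<Lambda> + \<Lambda>)" and ?q = "synth (F j) (of_int m * \<Lambda>)"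
      have "(cmod (?p - ?q))\<^sup>2 \<le> (cmod ?p + cmod ?q)\<^sup>2" by (intro power_mono norm_triangle_ineq4) auto
      also have "\<dots> \<le> 2 * ((cmod ?p)\<^sup>2 + (cmod ?q)\<^sup>2)"
        using sum_squares_bound[of "cmod ?p" "cmod ?q"] by (simp add: power2_sum)
      finally have "(cmod (?p - ?q))\<^sup>2 / \<Lambda>\<^sup>2 \<le> 2 * ((cmod ?p)\<^sup>2 + (cmod ?q)\<^sup>2) / \<Lambda>\<^sup>2"
        by (intro divide_right_mono) auto
      then show ?thesis
        unfolding a_def cell_avg_freq_deriv[OF F[OF that] \<Lambda>] using \<Lambda> by (simp add: norm_divide power_divide)
    qed
    have "(\<integral>\<^sup>+x. ennreal ((cmod (trig_sum \<eta> J (\<lambda>j. a j \<lfloor>x / \<Lambda>\<rfloor>) x))\<^sup>2) * ?I x \<partial>lborel)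
      = (\<integral>\<^sup>+x. ennreal ((cmod (trig_sum \<eta> J (\<lambda>j. a j m) x))\<^sup>2) * ?I x \<partial>lborel)"
      by (intro nn_integral_cong) (auto simp: indicator_def mem_cell[OF \<Lambda>])
    also have "\<dots> \<le> ennreal (sieve_const * \<Lambda> * (\<Sum>j\<in>J. (cmod (a j m))\<^sup>2))"
      unfolding cell_def using J L sep by (intro large_sieve[where L=L]) auto
    also have "\<dots> \<le> ennreal (sieve_const * \<Lambda> * (\<Sum>j\<in>J. 2 / \<Lambda>\<^sup>2 *
        ((cmod (synth (F j) (of_int m * \<Lambda> + \<Lambda>)))\<^sup>2 + (cmod (synth (F j) (of_int m * \<Lambda>)))\<^sup>2)))"
      using \<Lambda> sieve_const_pos by (intro ennreal_leI mult_left_mono sum_mono a_sq) auto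
    also have "sieve_const * \<Lambda> * (\<Sum>j\<in>J. 2 / \<Lambda>\<^sup>2 *
        ((cmod (synth (F j) (of_int m * \<Lambda> + \<Lambda>)))\<^sup>2 + (cmod (synth (F j) (of_int m * \<Lambda>)))\<^sup>2))
      = (2 * sieve_const / \<Lambda>) * (\<Sum>j\<in>J. ((cmod (synth (F j) (of_int m * \<Lambda> + \<Lambda>)))\<^sup>2 + (cmod (synth (F j) (of_int m * \<Lambda>)))\<^sup>2))"
      unfolding sum_distrib_left using \<Lambda> by (intro sum.cong refl) (simp add: power2_eq_square field_simps)
    also have "ennreal \<dots> = ennreal (2 * sieve_const / \<Lambda>) *
      (\<Sum>j\<in>J. ennreal ((cmod (synth (F j) (of_int m * \<Lambda> + \<Lambda>)))\<^sup>2) + ennreal ((cmod (synth (F j) (of_int m * \<Lambda>)))\<^sup>2))"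
      using \<Lambda> sieve_const_pos by (subst ennreal_mult) (auto simp: sum_nonneg simp flip: ennreal_plus)
    also have "\<dots> \<le> ennreal (2 * sieve_const / \<Lambda>) *
      (\<Sum>j\<in>J. (\<integral>\<^sup>+x. S j x * ?I x \<partial>lborel) + (\<integral>\<^sup>+x. S j x * ?I x \<partial>lborel))"
    proof (intro mult_left_mono sum_mono add_mono)
      fix j assume j: "j \<in> J"
      show "ennreal ((cmod (synth (F j) (of_int m * \<Lambda> + \<Lambda>)))\<^sup>2) \<le> (\<integral>\<^sup>+x. S j x * ?I x \<partial>lborel)"
        using \<delta> by (intro end_le[OF j, where c="of_int m * \<Lambda> + \<Lambda> - \<delta>"]) (auto simp: cell_def)
      show "ennreal ((cmod (synth (F j) (of_int m * \<Lambda>)))\<^sup>2) \<le> (\<integral>\<^sup>+x. S j x * ?I x \<partial>lborel)"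
        using \<delta> by (intro end_le[OF j, where c="of_int m * \<Lambda>"]) (auto simp: cell_def)
    qed auto
    also have "\<dots> = ennreal (4 * sieve_const / \<Lambda>) * (\<Sum>j\<in>J. \<integral>\<^sup>+x. S j x * ?I x \<partial>lborel)"
    proof -
      have e2: "(2 :: ennreal) = ennreal 2" by simp
      have "ennreal (2 * sieve_const / \<Lambda>) * 2 = ennreal (4 * sieve_const / \<Lambda>)"
        unfolding e2 using \<Lambda> sieve_const_pos by (subst ennreal_mult[symmetric]) auto
      moreover have "(\<Sum>j\<in>J. (\<integral>\<^sup>+x. S j x * ?I x \<partial>lborel) + (\<integral>\<^sup>+x. S j x * ?I x \<partial>lborel))
        = 2 * (\<Sum>j\<in>J. \<integral>\<^sup>+x. S j x * ?I x \<partial>lborel)"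
        by (simp only: mult_2[symmetric] sum_distrib_left)
      ultimately show ?thesis by (simp only: mult.assoc[symmetric])
    qed
    also have "\<dots> = ennreal (4 * sieve_const / \<Lambda>) * (\<integral>\<^sup>+x. (\<Sum>j\<in>J. S j x * ?I x) \<partial>lborel)"
      using Sm by (subst nn_integral_sum) auto
    also have "\<dots> = (\<integral>\<^sup>+x. ennreal (4 * sieve_const / \<Lambda>) * (\<Sum>j\<in>J. S j x) * ?I x \<partial>lborel)"
      using Sm by (subst nn_integral_cmult[symmetric]) (auto simp: sum_distrib_right mult.assoc intro!: borel_measurable_sum)
    finally show "(\<integral>\<^sup>+x. ennreal ((cmod (trig_sum \<eta> J (\<lambda>j. a j \<lfloor>x / \<Lambda>\<rfloor>) x))\<^sup>2) * ?I x \<partial>lborel)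
      \<le> (\<integral>\<^sup>+x. ennreal (4 * sieve_const / \<Lambda>) * (\<Sum>j\<in>J. S j x) * ?I x \<partial>lborel)" .
  qed
  also have "\<dots> = ennreal (4 * sieve_const / \<Lambda>) * (\<Sum>j\<in>J. \<integral>\<^sup>+x. S j x \<partial>lborel)"
    using Sm by (subst nn_integral_cmult) (auto simp: nn_integral_sum intro!: borel_measurable_sum)
  also have "\<dots> \<le> ennreal (4 * sieve_const / \<Lambda>) *
      (\<Sum>j\<in>J. ennreal (2 / \<delta>) * energy (F j) + ennreal (2 * \<delta>) * energy (freq_deriv (F j)))"
  proof (intro mult_left_mono sum_mono)
    fix j assume j: "j \<in> J"
    note [measurable] = synth_m[OF j]
    have "(\<integral>\<^sup>+x. S j x \<partial>lborel) = ennreal (2 / \<delta>) * energy (synth (F j)) + ennreal (2 * \<delta>) * energy (synth (freq_deriv (F j)))"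
      unfolding S_def energy_def by (simp add: nn_integral_add nn_integral_cmult)
    also have "\<dots> \<le> ennreal (2 / \<delta>) * energy (F j) + ennreal (2 * \<delta>) * energy (freq_deriv (F j))"
      using F[OF j] by (intro add_mono mult_left_mono energy_synth_le bandlim_integrable bandlim_freq_deriv) auto
    finally show "(\<integral>\<^sup>+x. S j x \<partial>lborel) \<le> ennreal (2 / \<delta>) * energy (F j) + ennreal (2 * \<delta>) * energy (freq_deriv (F j))" .
  qed auto
  finally show ?thesis by (simp add: a_def)
qed

definition restr :: "'a set \<Rightarrow> ('a \<Rightarrow> 'b) \<Rightarrow> 'a \<Rightarrow> 'b::zero" where
  "restr S G = (\<lambda>\<omega>. if \<omega> \<in> S then G \<omega> else 0)"

definition low_freq :: "real \<Rightarrow> nat \<Rightarrow> real set" where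
  "low_freq L i = {\<omega>. \<bar>\<omega>\<bar> < 1 / (L * 2 ^ i)}"

text \<open>
  The last shell \<open>l = n\<close> is a full neighbourhood of 0, so that the shells from \<open>i\<close> to \<open>n\<close> partition the low
  frequencies of scale \<open>i\<close>.
\<close>

definition shell :: "real \<Rightarrow> nat \<Rightarrow> nat \<Rightarrow> real set" where
  "shell L n l = {\<omega>. \<bar>\<omega>\<bar> < 1 / (L * 2 ^ l) \<and> (l < n \<longrightarrow> 1 / (L * 2 ^ Suc l) \<le> \<bar>\<omega>\<bar>)}"

lemma low_freq_sets[measurable]: "low_freq L i \<in> sets borel"
  unfolding low_freq_def by measurable

lemma shell_sets[measurable]: "shell L n l \<in> sets borel"
  unfolding shell_def by measurable

lemma restr_measurable[measurable (raw)]: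
  fixes G :: "real \<Rightarrow> complex"
  assumes [measurable]: "G \<in> borel_measurable borel" "S \<in> sets borel"
  shows "restr S G \<in> borel_measurable borel"
  unfolding restr_def by measurable

lemma energy_mono: "(\<And>x. cmod (f x) \<le> cmod (g x)) \<Longrightarrow> energy f \<le> energy g"
  unfolding energy_def by (intro nn_integral_mono ennreal_leI power_mono) auto

lemma energy_restr_le: "energy (restr S G) \<le> energy G"
  by (intro energy_mono) (simp add: restr_def)

lemma restr_low_freq_sum:
  fixes G :: "real \<Rightarrow> 'b::comm_monoid_add"
  assumes L: "0 < L" and i: "i \<le> n"
  shows "restr (low_freq L i) G \<omega> = (\<Sum>l\<in>{i..n}. restr (shell L n l) G \<omega>)"
  using i
proof (induction i rule: inc_induct)
  case base then show ?case by (simp add: restr_def low_freq_def shell_def)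
next
  case (step i)
  have le: "1 / (L * 2 ^ Suc i) \<le> 1 / (L * 2 ^ i)" using L by (simp add: field_simps)
  have "restr (low_freq L i) G \<omega> = restr (shell L n i) G \<omega> + restr (low_freq L (Suc i)) G \<omega>"
    using step.hyps le by (auto simp: restr_def low_freq_def shell_def)
  also have "{i..n} = insert i {Suc i..n}" using step.hyps by auto
  ultimately show ?case using step.IH by simp
qed

lemma sum_energy_shell_le:
  assumes [measurable]: "G \<in> borel_measurable borel" and L: "0 < L"
  shows "(\<Sum>l\<le>n. energy (restr (shell L n l) G)) \<le> energy G"
proof -
  have sq: "ennreal ((cmod (restr S G x))\<^sup>2) = restr S (\<lambda>x. ennreal ((cmod (G x))\<^sup>2)) x" for S x
    by (simp add: restr_def)
  have "(\<Sum>l\<le>n. energy (restr (shell L n l) G)) = (\<integral>\<^sup>+x. (\<Sum>l\<le>n. ennreal ((cmod (restr (shell L n l) G x))\<^sup>2)) \<partial>lborel)"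
    unfolding energy_def by (rule nn_integral_sum[symmetric]) measurable
  also have "\<dots> = (\<integral>\<^sup>+x. restr (low_freq L 0) (\<lambda>x. ennreal ((cmod (G x))\<^sup>2)) x \<partial>lborel)"
    by (intro nn_integral_cong) (simp only: sq restr_low_freq_sum[OF L le0[of n]] atLeast0AtMost)
  also have "\<dots> \<le> energy G" unfolding energy_def by (intro nn_integral_mono) (simp add: restr_def)
  finally show ?thesis .
qed

lemma bandlim_restr:
  assumes [measurable]: "G \<in> borel_measurable borel" "S \<in> sets borel" and G: "energy G < \<infinity>"
    and S: "\<And>\<omega>. \<omega> \<in> S \<Longrightarrow> \<bar>\<omega>\<bar> \<le> R"
  shows "bandlim R (restr S G)"
  unfolding bandlim_def
proof (intro conjI allI impI)
  show "energy (restr S G) < \<infinity>" using energy_restr_le[of S G] G by (rule le_less_trans)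
  fix \<omega> assume "R < \<bar>\<omega>\<bar>"
  then show "restr S G \<omega> = 0" using S[of \<omega>] by (auto simp: restr_def)
qed measurable

definition scale_dist :: "nat \<Rightarrow> nat \<Rightarrow> nat" where "scale_dist i l = (i - l) + (l - i)"

lemma sum_scale_dist_le:
  fixes \<rho> :: real
  assumes \<rho>: "0 \<le> \<rho>" "\<rho> < 1"
  shows "(\<Sum>l\<le>n. \<rho> ^ scale_dist i l) \<le> 2 / (1 - \<rho>)"
proof -
  have geo: "(\<Sum>k\<in>A. \<rho> ^ k) \<le> 1 / (1 - \<rho>)" if "finite A" for A
  proof -
    have "(\<Sum>k\<in>A. \<rho> ^ k) \<le> (\<Sum>k. \<rho> ^ k)"
      using \<rho> that by (intro sum_le_suminf summable_geometric) auto
    then show ?thesis using \<rho> by (simp add: suminf_geometric)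
  qed
  have "(\<Sum>l\<le>n. \<rho> ^ scale_dist i l) = (\<Sum>l\<in>{l. l \<le> n \<and> l \<le> i}. \<rho> ^ scale_dist i l) + (\<Sum>l\<in>{l. l \<le> n \<and> i < l}. \<rho> ^ scale_dist i l)"
    by (subst sum.union_disjoint[symmetric]) (auto intro!: sum.cong)
  also have "(\<Sum>l\<in>{l. l \<le> n \<and> l \<le> i}. \<rho> ^ scale_dist i l) = (\<Sum>k\<in>(\<lambda>l. i - l) ` {l. l \<le> n \<and> l \<le> i}. \<rho> ^ k)"
    by (subst sum.reindex) (auto simp: inj_on_def scale_dist_def)
  also have "(\<Sum>l\<in>{l. l \<le> n \<and> i < l}. \<rho> ^ scale_dist i l) = (\<Sum>k\<in>(\<lambda>l. l - i) ` {l. l \<le> n \<and> i < l}. \<rho> ^ k)"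
    by (subst sum.reindex) (auto simp: inj_on_def scale_dist_def)
  also have "(\<Sum>k\<in>(\<lambda>l. i - l) ` {l. l \<le> n \<and> l \<le> i}. \<rho> ^ k) + (\<Sum>k\<in>(\<lambda>l. l - i) ` {l. l \<le> n \<and> i < l}. \<rho> ^ k)
      \<le> 1 / (1 - \<rho>) + 1 / (1 - \<rho>)"
    by (intro add_mono geo) auto
  finally show ?thesis by simp
qed

lemma trig_sum_cong: "(\<And>j. j \<in> J \<Longrightarrow> u j = v j) \<Longrightarrow> trig_sum \<eta> J u x = trig_sum \<eta> J v x"
  by (simp add: trig_sum_def)

lemma energy_uminus: "energy (\<lambda>x. - f x) = energy f"
  by (simp add: energy_def)

context
  fixes J :: "nat set" and \<eta> :: "nat \<Rightarrow> real" and L :: real and G :: "nat \<Rightarrow> real \<Rightarrow> complex" and n :: nat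
  assumes J: "finite J" and L: "0 < L"
    and sep: "\<And>i j. i \<in> J \<Longrightarrow> j \<in> J \<Longrightarrow> i \<noteq> j \<Longrightarrow> 1 / L \<le> \<bar>\<eta> i - \<eta> j\<bar>"
    and Gm: "\<And>j. j \<in> J \<Longrightarrow> G j \<in> borel_measurable borel"
    and Gfin: "\<And>j. j \<in> J \<Longrightarrow> energy (G j) < \<infinity>"
begin

text \<open>
  The contribution of the shell \<open>l\<close> to the deviation of the cutoff from the average at scale \<open>i\<close>. The cutoff
  keeps exactly the shells \<open>l \<ge> i\<close>.
\<close>

definition piece_dev :: "nat \<Rightarrow> nat \<Rightarrow> real \<Rightarrow> complex" where
  "piece_dev i l x = (if i \<le> l
     then trig_sum \<eta> J (\<lambda>j. synth (restr (shell L n l) (G j)) x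
        - cell_avg (L * 2 ^ i) (synth (restr (shell L n l) (G j))) \<lfloor>x / (L * 2 ^ i)\<rfloor>) x
     else - trig_sum \<eta> J (\<lambda>j. cell_avg (L * 2 ^ i) (synth (restr (shell L n l) (G j))) \<lfloor>x / (L * 2 ^ i)\<rfloor>) x)"

lemma bandlim_shell: "j \<in> J \<Longrightarrow> bandlim (1 / (L * 2 ^ l)) (restr (shell L n l) (G j))"
  using Gm Gfin by (intro bandlim_restr) (auto simp: shell_def)

lemma piece_dev_measurable[measurable]: "piece_dev i l \<in> borel_measurable borel"
proof -
  let ?p = "\<lambda>j. synth (restr (shell L n l) (G j))"
  have pm: "?p j \<in> borel_measurable borel" if "j \<in> J" for j
    using bandlim_measurable[OF bandlim_shell[OF that]] by (rule measurable_synth)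
  have m1: "(\<lambda>x. trig_sum \<eta> J (\<lambda>j. ?p j x - cell_avg (L * 2 ^ i) (?p j) m) x) \<in> borel_measurable borel" for m
    unfolding trig_sum_def
  proof (intro borel_measurable_sum)
    fix j assume "j \<in> J"
    note [measurable] = pm[OF this]
    show "(\<lambda>x. (?p j x - cell_avg (L * 2 ^ i) (?p j) m) * cis (2 * pi * \<eta> j * x)) \<in> borel_measurable borel" by measurable
  qed
  have "(\<lambda>x. trig_sum \<eta> J (\<lambda>j. ?p j x - cell_avg (L * 2 ^ i) (?p j) \<lfloor>x / (L * 2 ^ i)\<rfloor>) x) \<in> borel_measurable borel"
    by (rule measurable_compose_countable[where g="\<lambda>x. \<lfloor>x / (L * 2 ^ i)\<rfloor>"
          and f="\<lambda>m x. trig_sum \<eta> J (\<lambda>j. ?p j x - cell_avg (L * 2 ^ i) (?p j) m) x"]) (rule m1, measurable)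
  moreover have "(\<lambda>x. trig_sum \<eta> J (\<lambda>j. cell_avg (L * 2 ^ i) (?p j) \<lfloor>x / (L * 2 ^ i)\<rfloor>) x) \<in> borel_measurable borel"
    by (rule measurable_compose_countable[where g="\<lambda>x. \<lfloor>x / (L * 2 ^ i)\<rfloor>"
          and f="\<lambda>m. trig_sum \<eta> J (\<lambda>j. cell_avg (L * 2 ^ i) (?p j) m)"]) measurable
  ultimately show ?thesis unfolding piece_dev_def[abs_def] by simp
qed

text \<open>
  A function with frequencies in a shell \<open>l \<ge> i\<close> hardly varies on cells of scale \<open>i\<close>, and a function with
  frequencies in a shell \<open>l < i\<close> oscillates so fast that its means over these cells are small. In both
  cases the gain is geometric in the distance of the scales.
\<close>

lemma energy_piece_dev_le:
  assumes i: "i \<le> n"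
  shows "energy (piece_dev i l)
    \<le> ennreal (64 * sieve_const * (1/2) ^ scale_dist i l) * (\<Sum>j\<in>J. energy (restr (shell L n l) (G j)))"
proof -
  let ?H = "\<lambda>j. restr (shell L n l) (G j)"
  let ?\<Lambda> = "L * 2 ^ i"
  define R where "R = 1 / (L * 2 ^ l)"
  have R: "0 < R" using L by (simp add: R_def)
  have \<Lambda>: "0 < ?\<Lambda>" using L by simp
  have "L * 1 \<le> L * 2 ^ i" using L by (intro mult_left_mono) auto
  then have L\<Lambda>: "L \<le> ?\<Lambda>" by simp
  have K: "0 < sieve_const" by (rule sieve_const_pos)
  have H: "bandlim R (?H j)" if "j \<in> J" for j unfolding R_def by (rule bandlim_shell[OF that])
  have pow: "(2::real) ^ a / 2 ^ b = (1/2) ^ (b - a)" if "a \<le> b" for a b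
    using that by (simp add: power_divide power_diff)
  show ?thesis
  proof (cases "i \<le> l")
    case True
    have d: "scale_dist i l = l - i" using True by (simp add: scale_dist_def)
    have RL: "R * ?\<Lambda> = (1/2) ^ (l - i)" using L pow[OF True] by (simp add: R_def)
    have "energy (piece_dev i l) \<le> ennreal (sieve_const * (2 * pi * R * ?\<Lambda>)\<^sup>2) * (\<Sum>j\<in>J. energy (?H j))"
      using trig_minus_avg_energy_le[OF J L L\<Lambda> sep H] True by (simp add: piece_dev_def[abs_def])
    also have "\<dots> \<le> ennreal (64 * sieve_const * (1/2) ^ scale_dist i l) * (\<Sum>j\<in>J. energy (?H j))"
    proof (intro mult_right_mono ennreal_leI)
      have "(2 * pi)\<^sup>2 \<le> 8\<^sup>2" using pi_less_4 by (intro power_mono) auto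
      moreover have "((1/2 :: real) ^ (l - i))\<^sup>2 \<le> (1/2) ^ (l - i)"
        using power_le_one[of "1/2 :: real" "l - i"] by (simp add: power2_eq_square mult_left_le)
      ultimately have "(2 * pi)\<^sup>2 * ((1/2) ^ (l - i))\<^sup>2 \<le> 64 * (1/2) ^ (l - i)"
        by (intro mult_mono) auto
      moreover have "(2 * pi * R * ?\<Lambda>)\<^sup>2 = (2 * pi)\<^sup>2 * ((1/2) ^ (l - i))\<^sup>2"
        unfolding RL[symmetric] by (simp add: power_mult_distrib)
      ultimately have "sieve_const * (2 * pi * R * ?\<Lambda>)\<^sup>2 \<le> sieve_const * (64 * (1/2) ^ (l - i))"
        using K by (intro mult_left_mono) auto
      then show "sieve_const * (2 * pi * R * ?\<Lambda>)\<^sup>2 \<le> 64 * sieve_const * (1/2) ^ scale_dist i l"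
        by (simp add: d mult_ac)
    qed simp
    finally show ?thesis .
  next
    case False
    have d: "scale_dist i l = i - l" using False by (simp add: scale_dist_def)
    (* The inverse of the frequency: the two terms of trig_avg_energy_le are then of equal size. *)
    define \<delta> where "\<delta> = L * 2 ^ l"
    have \<delta>: "0 < \<delta>" "\<delta> \<le> ?\<Lambda>" using L False by (auto simp: \<delta>_def)
    have ratio: "\<delta> / ?\<Lambda> = (1/2) ^ (i - l)" using L pow[of l i] False by (simp add: \<delta>_def)
    (* The antiderivatives, in frequency; the division is harmless away from 0. *)
    define F where "F = (\<lambda>j \<omega>. inverse (2 * pi * \<i> * \<omega>) * ?H j \<omega>)"
    have ln: "l < n" using False i by simp
      have bnd: "cmod (inverse (2 * pi * \<i> * \<omega>)) \<le> \<delta>" and nz: "\<omega> \<noteq> 0" if "?H j \<omega> \<noteq> 0" for j and \<omega> :: real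
      proof -
        have sh: "1 / (L * 2 ^ Suc l) \<le> \<bar>\<omega>\<bar>" using that ln by (auto simp: restr_def shell_def split: if_splits)
        then have pos: "0 < \<bar>\<omega>\<bar>" using L by (smt (verit) divide_pos_pos mult_pos_pos zero_less_power)
        then show "\<omega> \<noteq> 0" by simp
        have "1 \<le> \<bar>\<omega>\<bar> * (2 * \<delta>)" using sh L by (simp add: \<delta>_def field_simps)
        also have "\<dots> \<le> \<bar>\<omega>\<bar> * (2 * pi * \<delta>)" using pi_gt3 \<delta> by (intro mult_left_mono mult_right_mono) auto
        finally have le: "1 \<le> \<bar>\<omega>\<bar> * (2 * pi * \<delta>)" .
        show "cmod (inverse (2 * pi * \<i> * \<omega>)) \<le> \<delta>"
        proof -
          have "cmod (2 * pi * \<i> * \<omega>) = 2 * pi * \<bar>\<omega>\<bar>" by (simp add: norm_mult)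
          then show ?thesis unfolding norm_inverse using pos le by (simp add: field_simps)
        qed
      qed
      have FH: "freq_deriv (F j) = ?H j" for j
      proof
        fix \<omega>
        show "freq_deriv (F j) \<omega> = ?H j \<omega>"
        proof (cases "?H j \<omega> = 0")
          case True
          then show ?thesis by (simp add: freq_deriv_def F_def)
        next
          case False
          then have w: "2 * pi * \<i> * \<omega> \<noteq> (0 :: complex)" using nz[of j \<omega>] by simp
          have "freq_deriv (F j) \<omega> = (2 * pi * \<i> * \<omega> * inverse (2 * pi * \<i> * \<omega>)) * ?H j \<omega>"
            unfolding freq_deriv_def F_def by (simp only: mult.assoc)
          then show ?thesis unfolding right_inverse[OF w] by simp
        qed
      qed
      have F: "bandlim R (F j)" if "j \<in> J" for j
        unfolding F_def by (rule bandlim_mult[OF H[OF that] _ bnd]) auto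
      have EF: "energy (F j) \<le> ennreal (\<delta>\<^sup>2) * energy (?H j)" if "j \<in> J" for j
        unfolding F_def by (rule energy_mult_le[OF bandlim_measurable[OF H[OF that]] bnd])
      have "energy (piece_dev i l) = energy (\<lambda>x. trig_sum \<eta> J (\<lambda>j. cell_avg ?\<Lambda> (synth (freq_deriv (F j))) \<lfloor>x / ?\<Lambda>\<rfloor>) x)"
        using False unfolding piece_dev_def[abs_def] FH by (simp add: energy_uminus)
      also have "\<dots> \<le> ennreal (4 * sieve_const / ?\<Lambda>) *
        (\<Sum>j\<in>J. ennreal (2 / \<delta>) * energy (F j) + ennreal (2 * \<delta>) * energy (freq_deriv (F j)))"
        by (rule trig_avg_energy_le[OF J L L\<Lambda> \<delta> sep F])
      also have "\<dots> \<le> ennreal (4 * sieve_const / ?\<Lambda>) * (\<Sum>j\<in>J. ennreal (4 * \<delta>) * energy (?H j))"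
      proof (intro mult_left_mono sum_mono)
        fix j assume "j \<in> J"
        have "ennreal (2 / \<delta>) * energy (F j) + ennreal (2 * \<delta>) * energy (freq_deriv (F j))
          \<le> ennreal (2 / \<delta>) * (ennreal (\<delta>\<^sup>2) * energy (?H j)) + ennreal (2 * \<delta>) * energy (?H j)"
          unfolding FH by (intro add_mono mult_left_mono EF[OF \<open>j \<in> J\<close>]) auto
        also have "\<dots> = (ennreal (2 / \<delta> * \<delta>\<^sup>2) + ennreal (2 * \<delta>)) * energy (?H j)"
        proof -
          have "ennreal (2 / \<delta> * \<delta>\<^sup>2) = ennreal (2 / \<delta>) * ennreal (\<delta>\<^sup>2)"
            using \<delta> by (intro ennreal_mult) auto
          then show ?thesis by (simp only: distrib_right mult.assoc)
        qed
        also have "ennreal (2 / \<delta> * \<delta>\<^sup>2) + ennreal (2 * \<delta>) = ennreal (4 * \<delta>)"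
          using \<delta> by (simp add: power2_eq_square flip: ennreal_plus)
        finally show "ennreal (2 / \<delta>) * energy (F j) + ennreal (2 * \<delta>) * energy (freq_deriv (F j)) \<le> ennreal (4 * \<delta>) * energy (?H j)" .
      qed auto
      also have "\<dots> = (ennreal (4 * sieve_const / ?\<Lambda>) * ennreal (4 * \<delta>)) * (\<Sum>j\<in>J. energy (?H j))"
        by (simp only: sum_distrib_left[symmetric] mult.assoc)
      also have "ennreal (4 * sieve_const / ?\<Lambda>) * ennreal (4 * \<delta>) = ennreal (16 * sieve_const * (\<delta> / ?\<Lambda>))"
        using \<delta> K \<Lambda> by (subst ennreal_mult[symmetric]) (auto simp: mult_ac)
      also have "ennreal (16 * sieve_const * (\<delta> / ?\<Lambda>)) * (\<Sum>j\<in>J. energy (?H j))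
        \<le> ennreal (64 * sieve_const * (1/2) ^ scale_dist i l) * (\<Sum>j\<in>J. energy (?H j))"
        unfolding ratio d using K by (intro mult_right_mono ennreal_leI) auto
      finally show ?thesis .
  qed
qed

lemma deviation_eq_sum_pieces:
  assumes i: "i \<le> n"
  shows "trig_sum \<eta> J (\<lambda>j. synth (restr (low_freq L i) (G j)) x
      - cell_avg (L * 2 ^ i) (synth (restr (low_freq L 0) (G j))) \<lfloor>x / (L * 2 ^ i)\<rfloor>) x
    = (\<Sum>l\<le>n. piece_dev i l x)"
proof -
  let ?m = "\<lfloor>x / (L * 2 ^ i)\<rfloor>" and ?\<Lambda> = "L * 2 ^ i"
  define p where "p = (\<lambda>l j. synth (restr (shell L n l) (G j)))"
  define q where "q = (\<lambda>l j. cell_avg ?\<Lambda> (p l j) ?m)"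
  have Gi: "integrable lborel (restr (shell L n l) (G j))" if "j \<in> J" for l j
    by (rule bandlim_integrable[OF bandlim_shell[OF that]])
  have low: "synth (restr (low_freq L i') (G j)) y = (\<Sum>l\<in>{i'..n}. p l j y)"
    if "j \<in> J" "i' \<le> n" for i' j y
  proof -
    have "restr (low_freq L i') (G j) = (\<lambda>\<omega>. \<Sum>l\<in>{i'..n}. 1 * restr (shell L n l) (G j) \<omega>)"
      using restr_low_freq_sum[OF L that(2), of "G j"] by (intro ext) simp
    then have "synth (restr (low_freq L i') (G j)) y = (\<Sum>l\<in>{i'..n}. 1 * synth (restr (shell L n l) (G j)) y)"
      using synth_sum[of "{i'..n}" "\<lambda>l. restr (shell L n l) (G j)" "\<lambda>l. 1" y] Gi[OF that(1)] by simp
    then show ?thesis by (simp add: p_def)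
  qed
  have avg: "cell_avg ?\<Lambda> (synth (restr (low_freq L 0) (G j))) ?m = (\<Sum>l\<le>n. q l j)" if j: "j \<in> J" for j
  proof -
    have "synth (restr (low_freq L 0) (G j)) = (\<lambda>y. \<Sum>l\<le>n. 1 * synth (restr (shell L n l) (G j)) y)"
      using low[OF j, of 0] by (intro ext) (simp add: p_def atLeast0AtMost)
    then show ?thesis
      using cell_avg_sum[of "{..n}" "\<lambda>l. restr (shell L n l) (G j)" ?\<Lambda> "\<lambda>l. 1" ?m] Gi[OF j]
      by (simp add: q_def p_def)
  qed
  have "trig_sum \<eta> J (\<lambda>j. synth (restr (low_freq L i) (G j)) x
      - cell_avg ?\<Lambda> (synth (restr (low_freq L 0) (G j))) ?m) x
    = trig_sum \<eta> J (\<lambda>j. \<Sum>l\<le>n. (if i \<le> l then p l j x - q l j else - q l j)) x"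
  proof (rule trig_sum_cong)
    fix j assume j: "j \<in> J"
    have "(\<Sum>l\<in>{i..n}. p l j x) = (\<Sum>l\<le>n. if i \<le> l then p l j x else 0)"
      by (intro sum.mono_neutral_cong_left) auto
    then show "synth (restr (low_freq L i) (G j)) x - cell_avg ?\<Lambda> (synth (restr (low_freq L 0) (G j))) ?m
      = (\<Sum>l\<le>n. (if i \<le> l then p l j x - q l j else - q l j))"
      unfolding low[OF j i] avg[OF j]
      by (simp flip: sum_subtractf) (intro sum.cong refl, simp)
  qed
  also have "\<dots> = (\<Sum>l\<le>n. trig_sum \<eta> J (\<lambda>j. if i \<le> l then p l j x - q l j else - q l j) x)"
    unfolding trig_sum_def sum_distrib_right by (rule sum.swap)
  also have "\<dots> = (\<Sum>l\<le>n. piece_dev i l x)"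
  proof (rule sum.cong[OF refl])
    fix l
    show "trig_sum \<eta> J (\<lambda>j. if i \<le> l then p l j x - q l j else - q l j) x = piece_dev i l x"
      by (cases "i \<le> l") (simp_all add: piece_dev_def p_def q_def trig_sum_def sum_negf)
  qed
  finally show ?thesis .
qed

text \<open>
  Schur's test for the geometrically decaying interaction of scales and shells.
\<close>

lemma sum_deviation_energy_le:
  "(\<Sum>i\<le>n. energy (\<lambda>x. \<Sum>l\<le>n. piece_dev i l x))
    \<le> ennreal (3072 * sieve_const) * (\<Sum>j\<in>J. energy (G j))"
proof -
  (* Any ratio strictly between 1/2 and 1 would do: both \<rho> and (1/2) / \<rho> have to be less than 1. *)
  define \<rho> where "\<rho> = (2/3 :: real)"
  define \<Gamma> where "\<Gamma> = (\<lambda>l. \<Sum>j\<in>J. energy (restr (shell L n l) (G j)))"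
  have K: "0 < sieve_const" by (rule sieve_const_pos)
  have one: "energy (\<lambda>x. \<Sum>l\<le>n. piece_dev i l x)
     \<le> (\<Sum>l\<le>n. ennreal (384 * sieve_const * (3/4) ^ scale_dist i l) * \<Gamma> l)" if i: "i \<le> n" for i
  proof -
    have "energy (\<lambda>x. \<Sum>l\<le>n. piece_dev i l x)
       \<le> (\<integral>\<^sup>+x. (\<Sum>l\<le>n. ennreal (6 / \<rho> ^ scale_dist i l) * ennreal ((cmod (piece_dev i l x))\<^sup>2)) \<partial>lborel)"
      unfolding energy_def
    proof (rule nn_integral_mono)
      fix x
      let ?w = "\<lambda>l. \<rho> ^ scale_dist i l" and ?v = "\<lambda>l. cmod (piece_dev i l x)"
      have w0: "0 < ?w l" for l by (simp add: \<rho>_def)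
      have "(cmod (\<Sum>l\<le>n. piece_dev i l x))\<^sup>2 \<le> (\<Sum>l\<le>n. ?w l * (?v l / ?w l))\<^sup>2"
        using w0 norm_sum[of "\<lambda>l. piece_dev i l x" "{..n}"]
        by (intro power_mono) (auto simp: \<rho>_def)
      also have "\<dots> \<le> (\<Sum>l\<le>n. ?w l) * (\<Sum>l\<le>n. ?w l * (?v l / ?w l)\<^sup>2)"
        using w0 by (intro weighted_cauchy_schwarz) (auto intro: less_imp_le)
      also have "\<dots> \<le> 6 * (\<Sum>l\<le>n. ?w l * (?v l / ?w l)\<^sup>2)"
        using sum_scale_dist_le[of \<rho> i n] w0
        by (intro mult_right_mono sum_nonneg mult_nonneg_nonneg) (auto simp: \<rho>_def)
      also have "\<dots> = (\<Sum>l\<le>n. (6 / ?w l) * (?v l)\<^sup>2)"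
        unfolding sum_distrib_left using w0
        by (intro sum.cong refl) (simp add: power2_eq_square \<rho>_def)
      finally have "ennreal ((cmod (\<Sum>l\<le>n. piece_dev i l x))\<^sup>2) \<le> ennreal (\<Sum>l\<le>n. (6 / ?w l) * (?v l)\<^sup>2)"
        by (rule ennreal_leI)
      also have "\<dots> = (\<Sum>l\<le>n. ennreal (6 / ?w l) * ennreal ((?v l)\<^sup>2))"
      proof -
        have "(\<Sum>l\<le>n. ennreal (6 / ?w l) * ennreal ((?v l)\<^sup>2)) = (\<Sum>l\<le>n. ennreal ((6 / ?w l) * (?v l)\<^sup>2))"
          by (intro sum.cong refl ennreal_mult[symmetric]) (auto simp: \<rho>_def)
        also have "\<dots> = ennreal (\<Sum>l\<le>n. (6 / ?w l) * (?v l)\<^sup>2)"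
          by (rule sum_ennreal) (auto simp: \<rho>_def)
        finally show ?thesis by (rule sym)
      qed
      finally show "ennreal ((cmod (\<Sum>l\<le>n. piece_dev i l x))\<^sup>2) \<le> (\<Sum>l\<le>n. ennreal (6 / ?w l) * ennreal ((?v l)\<^sup>2))" .
    qed
    also have "\<dots> = (\<Sum>l\<le>n. ennreal (6 / \<rho> ^ scale_dist i l) * energy (piece_dev i l))"
      unfolding energy_def by (simp add: nn_integral_sum nn_integral_cmult)
    also have "\<dots> \<le> (\<Sum>l\<le>n. ennreal (6 / \<rho> ^ scale_dist i l) * (ennreal (64 * sieve_const * (1/2) ^ scale_dist i l) * \<Gamma> l))"
      unfolding \<Gamma>_def by (intro sum_mono mult_left_mono energy_piece_dev_le[OF i]) auto
    also have "\<dots> = (\<Sum>l\<le>n. ennreal (384 * sieve_const * (3/4) ^ scale_dist i l) * \<Gamma> l)"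
    proof (rule sum.cong[OF refl])
      fix l
      have "6 / \<rho> ^ scale_dist i l * (64 * sieve_const * (1/2) ^ scale_dist i l)
        = 384 * sieve_const * (((1/2) / \<rho>) ^ scale_dist i l)"
        unfolding power_divide[of "1/2" \<rho>] by simp
      also have "(1/2) / \<rho> = 3/4" by (simp add: \<rho>_def)
      finally have "ennreal (6 / \<rho> ^ scale_dist i l) * ennreal (64 * sieve_const * (1/2) ^ scale_dist i l)
        = ennreal (384 * sieve_const * (3/4) ^ scale_dist i l)"
        using K by (subst ennreal_mult[symmetric]) (auto simp: \<rho>_def)
      then show "ennreal (6 / \<rho> ^ scale_dist i l) * (ennreal (64 * sieve_const * (1/2) ^ scale_dist i l) * \<Gamma> l)
        = ennreal (384 * sieve_const * (3/4) ^ scale_dist i l) * \<Gamma> l"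
        by (simp only: mult.assoc[symmetric])
    qed
    finally show ?thesis .
  qed
  have "(\<Sum>i\<le>n. energy (\<lambda>x. \<Sum>l\<le>n. piece_dev i l x))
     \<le> (\<Sum>i\<le>n. \<Sum>l\<le>n. ennreal (384 * sieve_const * (3/4) ^ scale_dist i l) * \<Gamma> l)"
    by (intro sum_mono one) auto
  also have "\<dots> = (\<Sum>l\<le>n. (\<Sum>i\<le>n. ennreal (384 * sieve_const * (3/4) ^ scale_dist i l)) * \<Gamma> l)"
    by (subst sum.swap) (simp only: sum_distrib_right)
  also have "\<dots> \<le> (\<Sum>l\<le>n. ennreal (3072 * sieve_const) * \<Gamma> l)"
  proof (intro sum_mono mult_right_mono)
    fix l
    have sym: "scale_dist i l = scale_dist l i" for i by (simp add: scale_dist_def)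
    have "(\<Sum>i\<le>n. ennreal (384 * sieve_const * (3/4) ^ scale_dist i l))
      = ennreal (384 * sieve_const * (\<Sum>i\<le>n. (3/4) ^ scale_dist l i))"
      using K unfolding sym by (subst sum_ennreal) (auto simp: sum_distrib_left)
    also have "\<dots> \<le> ennreal (384 * sieve_const * 8)"
      using sum_scale_dist_le[of "3/4" l n] K by (intro ennreal_leI mult_left_mono) auto
    finally show "(\<Sum>i\<le>n. ennreal (384 * sieve_const * (3/4) ^ scale_dist i l)) \<le> ennreal (3072 * sieve_const)" by (simp add: mult_ac)
  qed simp
  also have "\<dots> = ennreal (3072 * sieve_const) * (\<Sum>j\<in>J. \<Sum>l\<le>n. energy (restr (shell L n l) (G j)))"
    unfolding \<Gamma>_def by (subst sum.swap) (simp only: sum_distrib_left)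
  also have "\<dots> \<le> ennreal (3072 * sieve_const) * (\<Sum>j\<in>J. energy (G j))"
    by (intro mult_left_mono sum_mono sum_energy_shell_le Gm L) auto
  finally show ?thesis .
qed

end


section \<open>Variation for separated frequencies\<close>

lemma cell_avg_sq_le:
  assumes G: "integrable lborel G" and \<Lambda>: "0 < \<Lambda>"
  shows "ennreal \<Lambda> * ennreal ((cmod (cell_avg \<Lambda> (synth G) m))\<^sup>2)
    \<le> (\<integral>\<^sup>+x. ennreal ((cmod (synth G x))\<^sup>2) * indicator (cell \<Lambda> m) x \<partial>lborel)"
proof -
  have [measurable]: "G \<in> borel_measurable borel" using G by auto
  let ?I = "LINT x|lborel. indicator (cell \<Lambda> m) x *\<^sub>R synth G x"
  let ?E = "\<integral>\<^sup>+x. ennreal ((cmod (synth G x))\<^sup>2) * indicator (cell \<Lambda> m) x \<partial>lborel"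
  have "ennreal (cmod ?I) \<le> (\<integral>\<^sup>+x. ennreal (cmod (indicator (cell \<Lambda> m) x *\<^sub>R synth G x)) \<partial>lborel)"
    by (intro integral_norm_bound_ennreal synth_integrable_cell G)
  also have "\<dots> = (\<integral>\<^sup>+x. ennreal (cmod (synth G x)) * indicator (cell \<Lambda> m) x \<partial>lborel)"
    by (intro nn_integral_cong) (auto simp: indicator_def)
  finally have "ennreal ((cmod ?I)\<^sup>2) \<le> (\<integral>\<^sup>+x. ennreal (cmod (synth G x)) * indicator (cell \<Lambda> m) x \<partial>lborel)\<^sup>2"
    by (simp add: ennreal_power[symmetric] power_mono)
  also have "\<dots> \<le> ennreal \<Lambda> * ?E"
    unfolding cell_def by (rule cauchy_schwarz_cell[OF _ \<Lambda>]) measurable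
  finally have le: "ennreal ((cmod ?I)\<^sup>2) \<le> ennreal \<Lambda> * ?E" .
  have "ennreal \<Lambda> * ennreal ((cmod (cell_avg \<Lambda> (synth G) m))\<^sup>2) = ennreal (1 / \<Lambda>) * ennreal ((cmod ?I)\<^sup>2)"
    using \<Lambda> by (simp add: cell_avg_def norm_divide ennreal_mult[symmetric] power_divide power2_eq_square)
  also have "\<dots> \<le> ennreal (1 / \<Lambda>) * (ennreal \<Lambda> * ?E)" by (intro mult_left_mono le) simp
  also have "\<dots> = ?E" using \<Lambda> by (simp add: mult.assoc[symmetric] ennreal_mult[symmetric])
  finally show ?thesis .
qed

lemma cell_avg_double:
  assumes G: "integrable lborel G" and \<Lambda>: "0 < \<Lambda>"
  shows "cell_avg (2 * \<Lambda>) (synth G) m = (cell_avg \<Lambda> (synth G) (2 * m) + cell_avg \<Lambda> (synth G) (2 * m + 1)) / 2"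
proof -
  have "(indicator (cell (2 * \<Lambda>) m) x :: real) = indicator (cell \<Lambda> (2 * m)) x + indicator (cell \<Lambda> (2 * m + 1)) x" for x
    using \<Lambda> by (auto simp: cell_def indicator_def algebra_simps)
  then have "(LINT x|lborel. indicator (cell (2 * \<Lambda>) m) x *\<^sub>R synth G x)
    = (LINT x|lborel. indicator (cell \<Lambda> (2 * m)) x *\<^sub>R synth G x + indicator (cell \<Lambda> (2 * m + 1)) x *\<^sub>R synth G x)"
    by (simp add: scaleR_add_left)
  also have "\<dots> = (LINT x|lborel. indicator (cell \<Lambda> (2 * m)) x *\<^sub>R synth G x) + (LINT x|lborel. indicator (cell \<Lambda> (2 * m + 1)) x *\<^sub>R synth G x)"
    by (intro Bochner_Integration.integral_add synth_integrable_cell G)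
  finally show ?thesis using \<Lambda> by (simp add: cell_avg_def field_simps)
qed

definition block_const :: "real \<Rightarrow> nat \<Rightarrow> real" where
  "block_const r M = 2 * martingale_const r M + 393216 * sieve_const"

lemma martingale_const_nonneg: "0 \<le> martingale_const r M"
  using sieve_const_pos by (simp add: martingale_const_def)

text \<open>
  The cutoffs are the averages plus a deviation that is square summable over the scales.
\<close>

lemma separated_variation:
  assumes r: "2 < r" and J: "finite J" and L: "0 < L"
    and sep: "\<And>i j. i \<in> J \<Longrightarrow> j \<in> J \<Longrightarrow> i \<noteq> j \<Longrightarrow> 1 / L \<le> \<bar>\<eta> i - \<eta> j\<bar>"
    and Gm: "\<And>j. j \<in> J \<Longrightarrow> G j \<in> borel_measurable borel"
    and Gfin: "\<And>j. j \<in> J \<Longrightarrow> energy (G j) < \<infinity>"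
  obtains X :: "real \<Rightarrow> real" where "X \<in> borel_measurable borel"
    "\<And>x. var_le r (\<lambda>i. trig_sum \<eta> J (\<lambda>j. synth (restr (low_freq L (min i n)) (G j)) x) x) (X x)"
    "(\<integral>\<^sup>+x. ennreal ((X x)\<^sup>2) \<partial>lborel) \<le> ennreal (block_const r (card J)) * (\<Sum>j\<in>J. energy (G j))"
proof -
  define g where "g = (\<lambda>j. synth (restr (low_freq L 0) (G j)))"
  define A where "A = (\<lambda>i m j. if j \<in> J then cell_avg (L * 2 ^ i) (g j) m else 0)"
  define u where "u = (\<lambda>i x. \<Sum>l\<le>n. piece_dev J \<eta> L G n i l x)"
  note ctx = J L sep Gm Gfin
  have um[measurable]: "u i \<in> borel_measurable borel" for i
    unfolding u_def using piece_dev_measurable[OF ctx] by (intro borel_measurable_sum) auto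
  have glim: "bandlim (1 / L) (restr (low_freq L 0) (G j))" if "j \<in> J" for j
    using Gm[OF that] Gfin[OF that] by (intro bandlim_restr) (auto simp: low_freq_def)
  have gi: "integrable lborel (restr (low_freq L 0) (G j))" if "j \<in> J" for j
    by (rule bandlim_integrable[OF glim[OF that]])
  have A: "A (Suc i) m = (\<lambda>j. (A i (2 * m) j + A i (2 * m + 1) j) / 2)" for i m
  proof
    fix j
    show "A (Suc i) m j = (A i (2 * m) j + A i (2 * m + 1) j) / 2"
    proof (cases "j \<in> J")
      case True
      have "L * 2 ^ Suc i = 2 * (L * 2 ^ i)" by simp
      then have "cell_avg (L * 2 ^ Suc i) (g j) m
        = (cell_avg (L * 2 ^ i) (g j) (2 * m) + cell_avg (L * 2 ^ i) (g j) (2 * m + 1)) / 2"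
        using cell_avg_double[OF gi[OF True], of "L * 2 ^ i" m] L by (simp only: g_def) simp
      then show ?thesis using True by (simp only: A_def if_True)
    qed (simp add: A_def)
  qed
  obtain Y where Ym[measurable]: "Y \<in> borel_measurable borel"
    and Yvar: "\<And>x. var_le r (\<lambda>i. trig_sum \<eta> J (A (min i n) \<lfloor>x / (L * 2 ^ min i n)\<rfloor>) x) (Y x)"
    and Yint: "(\<integral>\<^sup>+x. ennreal ((Y x)\<^sup>2) \<partial>lborel)
      \<le> ennreal (martingale_const r (card J)) * (\<integral>\<^sup>+x. ennreal (vsq J (A 0 \<lfloor>x / L\<rfloor>)) \<partial>lborel)"
    by (rule martingale_variation[where A=A and n=n, OF r J L sep A]) auto
  define Z where "Z = (\<lambda>x. \<Sum>i\<le>n. (cmod (u i x))\<^sup>2)"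
  have Zm[measurable]: "Z \<in> borel_measurable borel" unfolding Z_def by measurable
  have Z0: "0 \<le> Z x" for x by (simp add: Z_def sum_nonneg)
  have uvar: "var_le r (\<lambda>i. u (min i n) x) (8 * sqrt (Z x))" for x
  proof -
    have "mono (\<lambda>i::nat. min i n)" by (intro monoI) auto
    then have "var_le r (\<lambda>i. u (min i n) x) (8 * (\<Sum>b\<le>n. cmod (u b x) powr r) powr (1 / r))"
      using r by (intro var_le_step[where D="\<lambda>i. u i x"]) auto
    moreover have "(\<Sum>b\<le>n. cmod (u b x) powr r) powr (1 / r) \<le> sqrt (Z x)"
      unfolding Z_def using r by (intro powr_sum_le_l2) auto
    ultimately show ?thesis using r by (elim var_le_weaken) auto
  qed
  have split: "trig_sum \<eta> J (\<lambda>j. synth (restr (low_freq L (min i n)) (G j)) x) x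
     = u (min i n) x + trig_sum \<eta> J (A (min i n) \<lfloor>x / (L * 2 ^ min i n)\<rfloor>) x" for i x
  proof -
    have "u (min i n) x = trig_sum \<eta> J (\<lambda>j. synth (restr (low_freq L (min i n)) (G j)) x
      - cell_avg (L * 2 ^ min i n) (synth (restr (low_freq L 0) (G j))) \<lfloor>x / (L * 2 ^ min i n)\<rfloor>) x"
      unfolding u_def by (rule deviation_eq_sum_pieces[OF ctx, symmetric]) auto
    also have "\<dots> = trig_sum \<eta> J (\<lambda>j. synth (restr (low_freq L (min i n)) (G j)) x
      - A (min i n) \<lfloor>x / (L * 2 ^ min i n)\<rfloor> j) x"
      by (rule trig_sum_cong) (simp add: A_def g_def)
    finally show ?thesis by (simp add: trig_sum_diff)
  qed
  have Zint: "(\<integral>\<^sup>+x. ennreal (Z x) \<partial>lborel) \<le> ennreal (3072 * sieve_const) * (\<Sum>j\<in>J. energy (G j))"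
  proof -
    have "(\<integral>\<^sup>+x. ennreal (Z x) \<partial>lborel) = (\<Sum>i\<le>n. energy (u i))"
      unfolding energy_def Z_def by (subst nn_integral_sum[symmetric]) auto
    also have "\<dots> \<le> ennreal (3072 * sieve_const) * (\<Sum>j\<in>J. energy (G j))"
      unfolding u_def by (rule sum_deviation_energy_le[OF ctx]) auto
    finally show ?thesis .
  qed
  have Aint: "(\<integral>\<^sup>+x. ennreal (vsq J (A 0 \<lfloor>x / L\<rfloor>)) \<partial>lborel) \<le> (\<Sum>j\<in>J. energy (G j))"
  proof -
    have gm: "g j \<in> borel_measurable borel" if "j \<in> J" for j
      unfolding g_def using bandlim_measurable[OF glim[OF that]] by (rule measurable_synth)
    have "(\<integral>\<^sup>+x. ennreal (vsq J (A 0 \<lfloor>x / L\<rfloor>)) \<partial>lborel) \<le> (\<integral>\<^sup>+x. (\<Sum>j\<in>J. ennreal ((cmod (g j x))\<^sup>2)) \<partial>lborel)"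
    proof (rule nn_integral_cells_mono[OF _ _ L])
      show "(\<lambda>x. ennreal (vsq J (A 0 \<lfloor>x / L\<rfloor>))) \<in> borel_measurable borel"
        by (rule measurable_compose_countable[where g="\<lambda>x. \<lfloor>x / L\<rfloor>" and f="\<lambda>c x. ennreal (vsq J (A 0 c))"]) measurable
      show "(\<lambda>x. \<Sum>j\<in>J. ennreal ((cmod (g j x))\<^sup>2)) \<in> borel_measurable borel"
        using gm by (intro borel_measurable_sum) auto
      fix m
      have "(\<integral>\<^sup>+x. ennreal (vsq J (A 0 \<lfloor>x / L\<rfloor>)) * indicator (cell L m) x \<partial>lborel)
        = (\<integral>\<^sup>+x. ennreal (vsq J (A 0 m)) * indicator (cell L m) x \<partial>lborel)"
        by (intro nn_integral_cong) (auto simp: indicator_def mem_cell[OF L])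
      also have "\<dots> = (\<Sum>j\<in>J. ennreal L * ennreal ((cmod (A 0 m j))\<^sup>2))"
      proof -
        have "(\<integral>\<^sup>+x. ennreal (vsq J (A 0 m)) * indicator (cell L m) x \<partial>lborel) = ennreal (vsq J (A 0 m)) * ennreal L"
          using L by (subst nn_integral_cmult_indicator) (auto simp: emeasure_cell)
        moreover have "ennreal (vsq J (A 0 m)) = (\<Sum>j\<in>J. ennreal ((cmod (A 0 m j))\<^sup>2))"
          unfolding vsq_def by (rule sum_ennreal[symmetric]) simp
        ultimately show ?thesis by (metis sum_distrib_left mult.commute)
      qed
      also have "\<dots> \<le> (\<Sum>j\<in>J. \<integral>\<^sup>+x. ennreal ((cmod (g j x))\<^sup>2) * indicator (cell L m) x \<partial>lborel)"
      proof (rule sum_mono)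
        fix j assume j: "j \<in> J"
        then show "ennreal L * ennreal ((cmod (A 0 m j))\<^sup>2) \<le> (\<integral>\<^sup>+x. ennreal ((cmod (g j x))\<^sup>2) * indicator (cell L m) x \<partial>lborel)"
          using cell_avg_sq_le[OF gi[OF j] L, of m] by (simp add: A_def g_def)
      qed
      also have "\<dots> = (\<integral>\<^sup>+x. (\<Sum>j\<in>J. ennreal ((cmod (g j x))\<^sup>2)) * indicator (cell L m) x \<partial>lborel)"
        unfolding sum_distrib_right using gm by (intro nn_integral_sum[symmetric]) auto
      finally show "(\<integral>\<^sup>+x. ennreal (vsq J (A 0 \<lfloor>x / L\<rfloor>)) * indicator (cell L m) x \<partial>lborel)
        \<le> (\<integral>\<^sup>+x. (\<Sum>j\<in>J. ennreal ((cmod (g j x))\<^sup>2)) * indicator (cell L m) x \<partial>lborel)" .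
    qed
    also have "\<dots> = (\<Sum>j\<in>J. energy (g j))"
      unfolding energy_def using gm by (intro nn_integral_sum) auto
    also have "\<dots> \<le> (\<Sum>j\<in>J. energy (G j))"
      unfolding g_def by (intro sum_mono order_trans[OF energy_synth_le energy_restr_le] gi)
    finally show ?thesis .
  qed
  define X where "X = (\<lambda>x. 8 * sqrt (Z x) + Y x)"
  show ?thesis
  proof (rule that[of X])
    show "X \<in> borel_measurable borel" unfolding X_def by measurable
    show "var_le r (\<lambda>i. trig_sum \<eta> J (\<lambda>j. synth (restr (low_freq L (min i n)) (G j)) x) x) (X x)" for x
      unfolding split X_def using r by (intro var_le_add uvar Yvar) auto
    have "(\<integral>\<^sup>+x. ennreal ((X x)\<^sup>2) \<partial>lborel) \<le> (\<integral>\<^sup>+x. ennreal 128 * ennreal (Z x) + ennreal 2 * ennreal ((Y x)\<^sup>2) \<partial>lborel)"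
    proof (rule nn_integral_mono)
      fix x
      have "(X x)\<^sup>2 \<le> 2 * (8 * sqrt (Z x))\<^sup>2 + 2 * (Y x)\<^sup>2"
        unfolding X_def using sum_squares_bound[of "8 * sqrt (Z x)" "Y x"] by (simp add: power2_sum)
      also have "\<dots> = 128 * Z x + 2 * (Y x)\<^sup>2" using Z0[of x] by (simp add: power_mult_distrib)
      finally have "ennreal ((X x)\<^sup>2) \<le> ennreal (128 * Z x + 2 * (Y x)\<^sup>2)" by (rule ennreal_leI)
      also have "\<dots> = ennreal (128 * Z x) + ennreal (2 * (Y x)\<^sup>2)" using Z0[of x] by (intro ennreal_plus) auto
      also have "ennreal (128 * Z x) = ennreal 128 * ennreal (Z x)" using Z0[of x] by (intro ennreal_mult) auto
      also have "ennreal (2 * (Y x)\<^sup>2) = ennreal 2 * ennreal ((Y x)\<^sup>2)" by (intro ennreal_mult) auto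
      finally show "ennreal ((X x)\<^sup>2) \<le> ennreal 128 * ennreal (Z x) + ennreal 2 * ennreal ((Y x)\<^sup>2)" .
    qed
    also have "\<dots> = ennreal 128 * (\<integral>\<^sup>+x. ennreal (Z x) \<partial>lborel) + ennreal 2 * (\<integral>\<^sup>+x. ennreal ((Y x)\<^sup>2) \<partial>lborel)"
      by (subst nn_integral_add) (auto simp: nn_integral_cmult simp del: ennreal_numeral)
    also have "\<dots> \<le> ennreal 128 * (ennreal (3072 * sieve_const) * (\<Sum>j\<in>J. energy (G j)))
        + ennreal 2 * (ennreal (martingale_const r (card J)) * (\<Sum>j\<in>J. energy (G j)))"
      by (intro add_mono mult_left_mono Zint order_trans[OF Yint] Aint) auto
    also have "\<dots> = (ennreal 128 * ennreal (3072 * sieve_const) + ennreal 2 * ennreal (martingale_const r (card J))) * (\<Sum>j\<in>J. energy (G j))"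
      by (simp only: distrib_right mult.assoc)
    also have "ennreal 128 * ennreal (3072 * sieve_const) = ennreal (393216 * sieve_const)"
      using sieve_const_pos by (subst ennreal_mult[symmetric]) auto
    also have "ennreal 2 * ennreal (martingale_const r (card J)) = ennreal (2 * martingale_const r (card J))"
      using martingale_const_nonneg by (subst ennreal_mult[symmetric]) auto
    also have "ennreal (393216 * sieve_const) + ennreal (2 * martingale_const r (card J)) = ennreal (block_const r (card J))"
      using sieve_const_pos martingale_const_nonneg[of r "card J"]
      by (subst ennreal_plus[symmetric]) (auto simp: block_const_def add.commute)
    finally show "(\<integral>\<^sup>+x. ennreal ((X x)\<^sup>2) \<partial>lborel) \<le> ennreal (block_const r (card J)) * (\<Sum>j\<in>J. energy (G j))" .
  qed
qed

lemma synth_shift: "synth (\<lambda>\<omega>. H (\<eta> + \<omega>)) x * cis (2 * pi * \<eta> * x) = synth H x"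
proof -
  have "synth H x = (LINT \<omega>|lborel. H (\<eta> + 1 * \<omega>) * cis (2 * pi * (\<eta> + 1 * \<omega>) * x))"
    unfolding synth_def by (subst lborel_integral_real_affine[where c=1 and t=\<eta>]) auto
  also have "\<dots> = (LINT \<omega>|lborel. H (\<eta> + \<omega>) * cis (2 * pi * \<omega> * x) * cis (2 * pi * \<eta> * x))"
    by (intro Bochner_Integration.integral_cong refl) (simp add: mult.assoc cis_mult algebra_simps)
  also have "\<dots> = synth (\<lambda>\<omega>. H (\<eta> + \<omega>)) x * cis (2 * pi * \<eta> * x)"
    unfolding synth_def by (rule integral_mult_left_zero)
  finally show ?thesis by simp
qed

lemma energy_shift:
  assumes [measurable]: "H \<in> borel_measurable borel"
  shows "energy (\<lambda>\<omega>. H (\<eta> + \<omega>)) = energy H"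
  unfolding energy_def by (subst (2) nn_integral_real_affine[where c=1 and t=\<eta>]) auto

text \<open>
  Translation by \<open>\<eta>\<^sub>j\<close> in frequency is multiplication by \<open>e(\<eta>\<^sub>j x)\<close>, which turns the statement about cutoffs at
  0 into one about cutoffs at the points \<open>\<eta>\<^sub>j\<close>.
\<close>

lemma shell_variation:
  fixes \<eta> :: "nat \<Rightarrow> real"
  assumes r: "2 < r" and J: "finite J" and L: "0 < L"
    and sep: "\<And>i j. i \<in> J \<Longrightarrow> j \<in> J \<Longrightarrow> i \<noteq> j \<Longrightarrow> 1 / L \<le> \<bar>\<eta> i - \<eta> j\<bar>"
    and Gm[measurable]: "G \<in> borel_measurable borel" and Gfin: "energy G < \<infinity>"
    and S[measurable]: "\<And>j. S j \<in> sets borel"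
  obtains X :: "real \<Rightarrow> real" where "X \<in> borel_measurable borel"
    "\<And>x. var_le r (\<lambda>i. \<Sum>j\<in>J. synth (restr {\<omega>\<in>S j. \<bar>\<omega> - \<eta> j\<bar> < 1 / (L * 2 ^ min i n)} G) x) (X x)"
    "(\<integral>\<^sup>+x. ennreal ((X x)\<^sup>2) \<partial>lborel) \<le> ennreal (block_const r (card J)) * (\<Sum>j\<in>J. energy (restr (S j) G))"
proof -
  define F where "F = (\<lambda>j \<omega>. restr (S j) G (\<eta> j + \<omega>))"
  have Sm[measurable]: "restr (S j) G \<in> borel_measurable borel" for j by (intro restr_measurable) measurable
  have Fm: "F j \<in> borel_measurable borel" for j unfolding F_def by measurable
  have FE: "energy (F j) = energy (restr (S j) G)" for j unfolding F_def by (rule energy_shift) measurable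
  have Ffin: "energy (F j) < \<infinity>" for j unfolding FE by (rule le_less_trans[OF energy_restr_le Gfin])
  obtain X where X: "X \<in> borel_measurable borel"
    "\<And>x. var_le r (\<lambda>i. trig_sum \<eta> J (\<lambda>j. synth (restr (low_freq L (min i n)) (F j)) x) x) (X x)"
    "(\<integral>\<^sup>+x. ennreal ((X x)\<^sup>2) \<partial>lborel) \<le> ennreal (block_const r (card J)) * (\<Sum>j\<in>J. energy (F j))"
    by (rule separated_variation[where G=F and n=n, OF r J L sep Fm Ffin]) auto
  have "trig_sum \<eta> J (\<lambda>j. synth (restr (low_freq L i) (F j)) x) x
     = (\<Sum>j\<in>J. synth (restr {\<omega>\<in>S j. \<bar>\<omega> - \<eta> j\<bar> < 1 / (L * 2 ^ i)} G) x)" for i x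
    unfolding trig_sum_def
  proof (rule sum.cong[OF refl])
    fix j
    have "restr (low_freq L i) (F j) = (\<lambda>\<omega>. restr {\<omega>\<in>S j. \<bar>\<omega> - \<eta> j\<bar> < 1 / (L * 2 ^ i)} G (\<eta> j + \<omega>))"
      by (auto simp: restr_def low_freq_def F_def fun_eq_iff)
    then show "synth (restr (low_freq L i) (F j)) x * cis (2 * pi * \<eta> j * x)
      = synth (restr {\<omega>\<in>S j. \<bar>\<omega> - \<eta> j\<bar> < 1 / (L * 2 ^ i)} G) x"
      by (simp only: synth_shift)
  qed
  then show ?thesis using X by (intro that[of X]) (simp_all add: FE)
qed


section \<open>The Fourier transform of square-integrable functions\<close>

lemma energy_lebesgue: "energy f = (\<integral>\<^sup>+x. (ennreal (cmod (f x)))\<^sup>2 \<partial>lebesgue)"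
  by (simp add: energy_def nn_integral_completion ennreal_power)

text \<open>
  All estimates are made for squares of norms, which are integrals; also if they are infinite.
\<close>

lemma L2norm_square: "(L2norm g)\<^sup>2 = (\<integral>\<^sup>+x. (g x)\<^sup>2 \<partial>lebesgue)"
proof -
  define I where "I = (\<integral>\<^sup>+x. (g x)\<^sup>2 \<partial>lebesgue)"
  show ?thesis
  proof (cases "I = \<infinity>")
    case True
    then show ?thesis by (simp add: L2norm_def I_def)
  next
    case False
    then have "(L2norm g)\<^sup>2 = ennreal ((sqrt (enn2real I))\<^sup>2)"
      by (simp add: L2norm_def I_def Let_def ennreal_power del: real_sqrt_pow2 real_sqrt_pow2_iff)
    also have "\<dots> = I" using False by (simp add: less_top)
    finally show ?thesis by (simp add: I_def)
  qed
qed

lemma cL2norm_square: "(cL2norm f)\<^sup>2 = energy f"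
  by (simp add: L2norm_square energy_lebesgue)

lemma cL2norm_less_top_iff: "cL2norm f < \<infinity> \<longleftrightarrow> energy f < \<infinity>"
  by (simp add: L2norm_def energy_lebesgue Let_def less_top[symmetric])

lemma ennreal_le_of_square_le:
  fixes a b :: ennreal
  assumes "a\<^sup>2 \<le> b\<^sup>2"
  shows "a \<le> b"
proof (cases b)
  case (real b')
  show ?thesis
  proof (cases a)
    case (real a')
    then have "a'\<^sup>2 \<le> b'\<^sup>2" using assms \<open>b = ennreal b'\<close> \<open>0 \<le> b'\<close> by (simp add: ennreal_power)
    then show ?thesis using real \<open>b = ennreal b'\<close> \<open>0 \<le> b'\<close> by (simp add: abs_le_square_iff[symmetric] ennreal_leI)
  next
    case top
    then show ?thesis using assms real by (simp add: ennreal_power top_unique)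
  qed
qed simp

lemma borel_representative:
  fixes f :: "real \<Rightarrow> complex"
  assumes f: "f \<in> borel_measurable lebesgue"
  obtains f' where "f' \<in> borel_measurable borel" "AE x in lborel. f x = f' x"
proof -
  have "(\<lambda>x. Re (f x)) \<in> borel_measurable lebesgue" "(\<lambda>x. Im (f x)) \<in> borel_measurable lebesgue"
    using f by measurable
  then obtain u v where u: "u \<in> borel_measurable lborel" "AE x in lborel. Re (f x) = u x"
    and v: "v \<in> borel_measurable lborel" "AE x in lborel. Im (f x) = v x"
    using completion_ex_borel_measurable_real by blast
  show ?thesis
  proof (rule that[of "\<lambda>x. Complex (u x) (v x)"])
    have [measurable]: "u \<in> borel_measurable borel" "v \<in> borel_measurable borel" using u v by auto
    have "(\<lambda>x. complex_of_real (u x) + \<i> * complex_of_real (v x)) \<in> borel_measurable borel" by measurable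
    then show "(\<lambda>x. Complex (u x) (v x)) \<in> borel_measurable borel" by (simp add: Complex_eq)
    show "AE x in lborel. f x = Complex (u x) (v x)"
      using u(2) v(2) by eventually_elim (simp add: complex_eq_iff)
  qed
qed

lemma energy_cong_AE: "AE x in lborel. f x = g x \<Longrightarrow> energy f = energy g"
  unfolding energy_def by (rule nn_integral_cong_AE) auto

definition trunc_fourier :: "(real \<Rightarrow> complex) \<Rightarrow> nat \<Rightarrow> real \<Rightarrow> complex" where
  "trunc_fourier f n \<xi> = (LINT y|lborel. restr {- real n..real n} f y * cis (-1 * 2 * pi * y * \<xi>))"

lemma fourier_L1_truncation:
  assumes f: "AE x in lborel. f x = f' x" and [measurable]: "f' \<in> borel_measurable borel"
    and fm: "f \<in> borel_measurable lebesgue"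
  shows "fourier_L1 (\<lambda>x. indicator {- real n..real n} x * f x) = trunc_fourier f' n"
proof
  fix \<xi>
  have e: "exp (- 2 * of_real pi * \<i> * of_real \<xi> * of_real x) = cis (-1 * 2 * pi * x * \<xi>)" for x :: real
    by (simp add: cis_conv_exp mult_ac)
  have [measurable]: "f \<in> borel_measurable lebesgue" by (rule fm)
  have cism: "(\<lambda>x. cis (-1 * 2 * pi * x * \<xi>)) \<in> borel_measurable lebesgue"
    by (rule measurable_completion) measurable
  have f'm: "(\<lambda>x. restr {- real n..real n} f' x * cis (-1 * 2 * pi * x * \<xi>)) \<in> borel_measurable lborel"
    by measurable
  have "fourier_L1 (\<lambda>x. indicator {- real n..real n} x * f x) \<xi>
     = (LINT x|lebesgue. restr {- real n..real n} f' x * cis (-1 * 2 * pi * x * \<xi>))"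
    unfolding fourier_L1_def e
  proof (rule integral_cong_AE)
    show "(\<lambda>x. cis (-1 * 2 * pi * x * \<xi>) * (indicator {- real n..real n} x * f x)) \<in> borel_measurable lebesgue"
      using cism by (intro borel_measurable_times borel_measurable_indicator) auto
    show "(\<lambda>x. restr {- real n..real n} f' x * cis (-1 * 2 * pi * x * \<xi>)) \<in> borel_measurable lebesgue"
      by (rule measurable_completion[OF f'm])
    show "AE x in lebesgue. cis (-1 * 2 * pi * x * \<xi>) * (indicator {- real n..real n} x * f x)
      = restr {- real n..real n} f' x * cis (-1 * 2 * pi * x * \<xi>)"
      using AE_completion[OF f] by eventually_elim (auto simp: restr_def indicator_def)
  qed
  also have "\<dots> = trunc_fourier f' n \<xi>"
    unfolding trunc_fourier_def by (rule integral_completion[OF f'm])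
  finally show "fourier_L1 (\<lambda>x. indicator {- real n..real n} x * f x) \<xi> = trunc_fourier f' n \<xi>" .
qed

context
  fixes f :: "real \<Rightarrow> complex"
  assumes fm[measurable]: "f \<in> borel_measurable borel" and fE: "energy f < \<infinity>"
begin

lemma trunc_fourier_measurable[measurable]: "trunc_fourier f n \<in> borel_measurable borel"
  unfolding trunc_fourier_def[abs_def] by measurable

lemma bandlim_trunc: "bandlim n (restr {- real n..real n} f)"
  by (intro bandlim_restr fE) auto

lemma energy_trunc_fourier_le: "energy (trunc_fourier f n) \<le> energy f"
proof -
  have "energy (trunc_fourier f n) \<le> energy (restr {- real n..real n} f)"
    unfolding trunc_fourier_def[abs_def] using bessel[OF bandlim_integrable[OF bandlim_trunc], of "-1"] by simp
  also have "\<dots> \<le> energy f" by (rule energy_restr_le)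
  finally show ?thesis .
qed

definition tail_energy :: "nat \<Rightarrow> ennreal" where
  "tail_energy n = energy (restr (- {- real n..real n}) f)"

lemma energy_trunc_diff_le:
  "energy (\<lambda>\<xi>. trunc_fourier f n \<xi> - trunc_fourier f m \<xi>) \<le> tail_energy (min n m)"
proof -
  define h where "h = (\<lambda>y. restr {- real n..real n} f y - restr {- real m..real m} f y)"
  have hi: "integrable lborel h"
    unfolding h_def
    by (intro Bochner_Integration.integrable_diff bandlim_integrable[OF bandlim_trunc[of n]] bandlim_integrable[OF bandlim_trunc[of m]])
  have int: "integrable lborel (\<lambda>y. restr {- real n..real n} f y * cis (-1 * 2 * pi * y * \<xi>))" for n \<xi>
    using integrable_mult_cis[OF bandlim_integrable[OF bandlim_trunc], of n "- \<xi>"] by (simp add: mult_ac)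
  have "(\<lambda>\<xi>. trunc_fourier f n \<xi> - trunc_fourier f m \<xi>) = (\<lambda>\<xi>. LINT y|lborel. h y * cis (-1 * 2 * pi * y * \<xi>))"
    unfolding trunc_fourier_def h_def left_diff_distrib
    by (intro ext Bochner_Integration.integral_diff[symmetric] int)
  then have "energy (\<lambda>\<xi>. trunc_fourier f n \<xi> - trunc_fourier f m \<xi>) \<le> energy h"
    using bessel[OF hi, of "-1"] by simp
  also have "\<dots> \<le> tail_energy (min n m)"
    unfolding tail_energy_def by (intro energy_mono) (auto simp: h_def restr_def min_def)
  finally show ?thesis .
qed

lemma tail_energy_tendsto: "tail_energy \<longlonglongrightarrow> 0"
proof -
  have "(\<lambda>n. \<integral>\<^sup>+x. ennreal ((cmod (restr (- {- real n..real n}) f x))\<^sup>2) \<partial>lborel) \<longlonglongrightarrow> (\<integral>\<^sup>+(x::real). 0 \<partial>lborel)"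
  proof (rule nn_integral_dominated_convergence[where w="\<lambda>x. ennreal ((cmod (f x))\<^sup>2)"
        and u="\<lambda>n x. ennreal ((cmod (restr (- {- real n..real n}) f x))\<^sup>2)" and u'="\<lambda>x. 0"])
    show "(\<integral>\<^sup>+x. ennreal ((cmod (f x))\<^sup>2) \<partial>lborel) < \<infinity>" using fE by (simp add: energy_def)
    show "AE x in lborel. ennreal ((cmod (restr (- {- real j..real j}) f x))\<^sup>2) \<le> ennreal ((cmod (f x))\<^sup>2)" for j
      by (simp add: restr_def)
    show "AE x in lborel. (\<lambda>n. ennreal ((cmod (restr (- {- real n..real n}) f x))\<^sup>2)) \<longlonglongrightarrow> 0"
    proof (rule AE_I2)
      fix x :: real
      obtain N :: nat where N: "\<bar>x\<bar> \<le> real N" using real_arch_simple by blast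
      show "(\<lambda>n. ennreal ((cmod (restr (- {- real n..real n}) f x))\<^sup>2)) \<longlonglongrightarrow> 0"
      proof (rule tendsto_eventually)
        show "\<forall>\<^sub>F n in sequentially. ennreal ((cmod (restr (- {- real n..real n}) f x))\<^sup>2) = 0"
          using eventually_ge_at_top[of N]
        proof eventually_elim
          case (elim n)
          then have "x \<in> {- real n..real n}" using N by auto
          then show ?case by (simp add: restr_def)
        qed
      qed
    qed
  qed measurable
  then show ?thesis by (simp add: tail_energy_def[abs_def] energy_def)
qed

text \<open>
  The completeness of \<open>L\<^sup>2\<close> for this sequence: along a rapidly convergent subsequence the transforms converge
  almost everywhere, and Fatou's lemma transfers the estimates to the limit.
\<close>

lemma plancherel_limit_exists:
  obtains g where "g \<in> borel_measurable borel" "energy g \<le> energy f"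
    "\<And>n. energy (\<lambda>\<xi>. trunc_fourier f n \<xi> - g \<xi>) \<le> tail_energy n"
proof -
  have "\<exists>N\<ge>k. tail_energy N \<le> ennreal ((1/8) ^ k)" for k
  proof -
    have "\<forall>\<^sub>F n in sequentially. tail_energy n < ennreal ((1/8) ^ k)"
      by (rule order_tendstoD(2)[OF tail_energy_tendsto]) simp
    then have "\<forall>\<^sub>F n in sequentially. k \<le> n \<and> tail_energy n \<le> ennreal ((1/8) ^ k)"
      using eventually_ge_at_top[of k] by eventually_elim auto
    then show ?thesis using eventually_happens'[OF sequentially_bot] by blast
  qed
  then obtain N where N: "\<And>k. k \<le> N k" "\<And>k. tail_energy (N k) \<le> ennreal ((1/8) ^ k)" by metis
  (* The condition k \<le> N k makes min n (N k) equal to n for large k in the final estimate. *)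
  define F where "F = (\<lambda>k. trunc_fourier f (N k))"
  have Fm[measurable]: "F k \<in> borel_measurable borel" for k unfolding F_def by measurable
  define u where "u = (\<lambda>k x. F (Suc k) x - F k x)"
  have um[measurable]: "u k \<in> borel_measurable borel" for k unfolding u_def by measurable
  have uE: "energy (u k) \<le> ennreal ((1/8) ^ k)" for k
  proof -
    have "energy (u k) \<le> tail_energy (min (N (Suc k)) (N k))"
      unfolding u_def F_def by (rule energy_trunc_diff_le)
    also have "\<dots> \<le> ennreal ((1/8) ^ k)"
    proof -
      have "ennreal ((1/8) ^ Suc k) \<le> ennreal ((1/8) ^ k)" by (intro ennreal_leI power_decreasing) auto
      then show ?thesis using N(2)[of k] order_trans[OF N(2)[of "Suc k"]] by (cases "N (Suc k) \<le> N k") (auto simp: min_def)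
    qed
    finally show ?thesis .
  qed
  define s where "s = (\<lambda>x. \<Sum>k. ennreal (4 ^ k) * ennreal ((cmod (u k x))\<^sup>2))"
  have sm: "s \<in> borel_measurable lborel" unfolding s_def by measurable
  have "(\<integral>\<^sup>+x. s x \<partial>lborel) = (\<Sum>k. ennreal (4 ^ k) * energy (u k))"
    unfolding s_def energy_def by (subst nn_integral_suminf) (auto simp: nn_integral_cmult)
  also have "\<dots> \<le> (\<Sum>k. ennreal ((1/2) ^ k))"
  proof (intro suminf_le summableI)
    fix k
    have "ennreal (4 ^ k) * energy (u k) \<le> ennreal (4 ^ k) * ennreal ((1/8) ^ k)"
      by (intro mult_left_mono uE) auto
    also have "\<dots> = ennreal ((1/2) ^ k)" by (simp add: ennreal_mult[symmetric] flip: power_mult_distrib)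
    finally show "ennreal (4 ^ k) * energy (u k) \<le> ennreal ((1/2) ^ k)" .
  qed
  also have "\<dots> = ennreal (\<Sum>k. (1/2) ^ k)" by (intro suminf_ennreal2 summable_geometric) auto
  also have "\<dots> < \<infinity>" by simp
  finally have sfin: "AE x in lborel. s x \<noteq> \<infinity>"
    using nn_integral_noteq_infinite[OF sm] by auto
  define g where "g = (\<lambda>x. lim (\<lambda>k. F k x))"
  have gm[measurable]: "g \<in> borel_measurable borel" unfolding g_def by measurable
  have conv: "AE x in lborel. (\<lambda>k. F k x) \<longlonglongrightarrow> g x"
    using sfin
  proof eventually_elim
    case (elim x)
    then obtain M where M: "0 \<le> M" "s x = ennreal M" by (cases "s x") auto
    have uk: "cmod (u k x) \<le> sqrt M * (1/2) ^ k" for k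
    proof -
      have "ennreal (4 ^ k) * ennreal ((cmod (u k x))\<^sup>2) \<le> s x"
        unfolding s_def using sum_le_suminf[of "\<lambda>k. ennreal (4 ^ k) * ennreal ((cmod (u k x))\<^sup>2)" "{k}"] by simp
      then have "4 ^ k * (cmod (u k x))\<^sup>2 \<le> M" using M by (simp add: ennreal_mult[symmetric])
      moreover have "(2 ^ k * cmod (u k x))\<^sup>2 = 4 ^ k * (cmod (u k x))\<^sup>2"
      proof -
        have "((2::real) ^ k)\<^sup>2 = (2\<^sup>2) ^ k" by (simp only: power_mult[symmetric] mult.commute)
        then show ?thesis by (simp add: power_mult_distrib)
      qed
      ultimately have "(2 ^ k * cmod (u k x))\<^sup>2 \<le> M" by simp
      then have "2 ^ k * cmod (u k x) \<le> sqrt M" by (rule real_le_rsqrt)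
      then show ?thesis by (simp add: field_simps power_divide)
    qed
    have "summable (\<lambda>k. sqrt M * (1/2) ^ k)" by (intro summable_mult summable_geometric) auto
    then have "summable (\<lambda>k. u k x)" by (rule summable_comparison_test'[where N=0]) (use uk in auto)
    then have "convergent (\<lambda>n. \<Sum>k<n. u k x)" by (simp add: summable_iff_convergent)
    moreover have "(\<Sum>k<n. u k x) = F n x - F 0 x" for n
      unfolding u_def by (rule sum_lessThan_telescope)
    ultimately have "convergent (\<lambda>n. F n x - F 0 x)" by simp
    then have "convergent (\<lambda>n. F n x)" by (simp add: convergent_diff_const_right_iff)
    then show ?case unfolding g_def by (simp add: convergent_LIMSEQ_iff)
  qed
  show ?thesis
  proof (rule that[of g])
    show "g \<in> borel_measurable borel" by measurable
    show "energy g \<le> energy f"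
      unfolding energy_def[of g]
    proof (rule nn_integral_le_of_tendsto[where f="\<lambda>k x. ennreal ((cmod (F k x))\<^sup>2)"])
      show "AE x in lborel. (\<lambda>k. ennreal ((cmod (F k x))\<^sup>2)) \<longlonglongrightarrow> ennreal ((cmod (g x))\<^sup>2)"
        using conv by eventually_elim (intro tendsto_intros)
      show "\<forall>\<^sub>F k in sequentially. (\<integral>\<^sup>+x. ennreal ((cmod (F k x))\<^sup>2) \<partial>lborel) \<le> energy f"
        using energy_trunc_fourier_le unfolding F_def energy_def[of "trunc_fourier f n" for n, symmetric] by simp
    qed measurable
    fix n
    show "energy (\<lambda>\<xi>. trunc_fourier f n \<xi> - g \<xi>) \<le> tail_energy n"
      unfolding energy_def
    proof (rule nn_integral_le_of_tendsto[where f="\<lambda>k x. ennreal ((cmod (trunc_fourier f n x - F k x))\<^sup>2)"])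
      show "AE x in lborel. (\<lambda>k. ennreal ((cmod (trunc_fourier f n x - F k x))\<^sup>2)) \<longlonglongrightarrow> ennreal ((cmod (trunc_fourier f n x - g x))\<^sup>2)"
        using conv by eventually_elim (intro tendsto_intros)
      show "\<forall>\<^sub>F k in sequentially. (\<integral>\<^sup>+x. ennreal ((cmod (trunc_fourier f n x - F k x))\<^sup>2) \<partial>lborel) \<le> tail_energy n"
        using eventually_ge_at_top[of n]
      proof eventually_elim
        case (elim k)
        have "min n (N k) = n" using elim N(1)[of k] by simp
        then show ?case using energy_trunc_diff_le[of n "N k"] by (simp add: F_def energy_def)
      qed
    qed measurable
  qed
qed

end

text \<open>
  The limit just constructed witnesses the existence of the transform, and every other choice agrees with it
  almost everywhere. A Borel measurable representative makes the product measure arguments available.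
\<close>

lemma fourier_L2_representative:
  assumes f: "f \<in> L2"
  obtains g where "g \<in> borel_measurable borel" "energy g \<le> energy f" "AE x in lborel. fourier_L2 f x = g x"
    "fourier_L2 f \<in> borel_measurable lebesgue"
proof -
  have fm: "f \<in> borel_measurable lebesgue" and fE: "energy f < \<infinity>"
    using f cL2norm_less_top_iff[of f] by (auto simp: L2_def)
  obtain f' where f'm: "f' \<in> borel_measurable borel" and ff': "AE x in lborel. f x = f' x"
    by (rule borel_representative[OF fm])
  have EE: "energy f = energy f'" by (rule energy_cong_AE[OF ff'])
  then have f'E: "energy f' < \<infinity>" using fE by simp
  obtain g where gm[measurable]: "g \<in> borel_measurable borel" and gE: "energy g \<le> energy f'"
    and lim: "\<And>n. energy (\<lambda>\<xi>. trunc_fourier f' n \<xi> - g \<xi>) \<le> tail_energy f' n"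
    by (rule plancherel_limit_exists[OF f'm f'E]) auto
  note tail = tail_energy_tendsto[OF f'm f'E]
  have trunc: "fourier_L1 (\<lambda>x. indicator {- real n..real n} x * f x) = trunc_fourier f' n" for n
    by (rule fourier_L1_truncation[OF ff' f'm fm])
  have to_zero: "(\<lambda>n. energy (\<lambda>\<xi>. trunc_fourier f' n \<xi> - g \<xi>)) \<longlonglongrightarrow> 0"
    by (rule tendsto_sandwich[OF _ _ tendsto_const tail]) (use lim in auto)
  have ex: "is_fourier_L2 f g"
    unfolding is_fourier_L2_def trunc
  proof (intro conjI)
    have "energy g < \<infinity>" using gE f'E by (rule le_less_trans)
    then show "g \<in> L2"
      using cL2norm_less_top_iff[of g] by (simp add: L2_def measurable_completion)
    have e: "cL2norm h = ennreal (sqrt (enn2real (energy h)))" if "energy h < \<infinity>" for h :: "real \<Rightarrow> complex"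
      using that by (auto simp: L2norm_def energy_lebesgue Let_def)
    have "(\<lambda>n. ennreal (sqrt (enn2real (energy (\<lambda>\<xi>. trunc_fourier f' n \<xi> - g \<xi>))))) \<longlonglongrightarrow> ennreal (sqrt 0)"
      using to_zero by (intro tendsto_intros) auto
    moreover have "\<forall>\<^sub>F n in sequentially. ennreal (sqrt (enn2real (energy (\<lambda>\<xi>. trunc_fourier f' n \<xi> - g \<xi>))))
        = cL2norm (\<lambda>\<xi>. trunc_fourier f' n \<xi> - g \<xi>)"
    proof -
      have "\<forall>\<^sub>F n in sequentially. energy (\<lambda>\<xi>. trunc_fourier f' n \<xi> - g \<xi>) < \<infinity>"
        using order_tendstoD(2)[OF to_zero, of \<infinity>] by simp
      then show ?thesis by eventually_elim (simp add: e)
    qed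
    ultimately show "(\<lambda>n. cL2norm (\<lambda>\<xi>. trunc_fourier f' n \<xi> - g \<xi>)) \<longlonglongrightarrow> 0"
      using Lim_transform_eventually by fastforce
  qed
  have isF: "is_fourier_L2 f (fourier_L2 f)"
    unfolding fourier_L2_def by (rule someI[where P="is_fourier_L2 f", OF ex])
  define h where "h = fourier_L2 f"
  have hm: "h \<in> borel_measurable lebesgue" using isF by (simp add: is_fourier_L2_def L2_def h_def)
  obtain h' where h'm[measurable]: "h' \<in> borel_measurable borel" and hh': "AE x in lborel. h x = h' x"
    by (rule borel_representative[OF hm])
  have "(\<lambda>n. cL2norm (\<lambda>\<xi>. trunc_fourier f' n \<xi> - h \<xi>)) \<longlonglongrightarrow> 0"
    using isF unfolding is_fourier_L2_def trunc h_def by simp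
  then have "(\<lambda>n. (cL2norm (\<lambda>\<xi>. trunc_fourier f' n \<xi> - h \<xi>))\<^sup>2) \<longlonglongrightarrow> 0 * 0"
    unfolding power2_eq_square by (intro tendsto_mult_ennreal) auto
  then have "(\<lambda>n. energy (\<lambda>\<xi>. trunc_fourier f' n \<xi> - h \<xi>)) \<longlonglongrightarrow> 0" by (simp add: cL2norm_square)
  moreover have "energy (\<lambda>\<xi>. trunc_fourier f' n \<xi> - h \<xi>) = energy (\<lambda>\<xi>. trunc_fourier f' n \<xi> - h' \<xi>)" for n
    using hh' by (intro energy_cong_AE) auto
  ultimately have h'_zero: "(\<lambda>n. energy (\<lambda>\<xi>. trunc_fourier f' n \<xi> - h' \<xi>)) \<longlonglongrightarrow> 0" by simp
  have [measurable]: "trunc_fourier f' n \<in> borel_measurable borel" for n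
    by (rule trunc_fourier_measurable[OF f'm f'E])
  have le: "energy (\<lambda>\<xi>. h' \<xi> - g \<xi>)
    \<le> 2 * energy (\<lambda>\<xi>. trunc_fourier f' n \<xi> - g \<xi>) + 2 * energy (\<lambda>\<xi>. trunc_fourier f' n \<xi> - h' \<xi>)" for n
  proof -
    have "energy (\<lambda>\<xi>. h' \<xi> - g \<xi>) = energy (\<lambda>\<xi>. (trunc_fourier f' n \<xi> - g \<xi>) + - (trunc_fourier f' n \<xi> - h' \<xi>))"
      by simp
    also have "\<dots> \<le> 2 * energy (\<lambda>\<xi>. trunc_fourier f' n \<xi> - g \<xi>) + 2 * energy (\<lambda>\<xi>. - (trunc_fourier f' n \<xi> - h' \<xi>))"
      by (rule energy_add_le) measurable
    finally show ?thesis by (simp only: energy_uminus)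
  qed
  have "(\<lambda>n. 2 * energy (\<lambda>\<xi>. trunc_fourier f' n \<xi> - g \<xi>) + 2 * energy (\<lambda>\<xi>. trunc_fourier f' n \<xi> - h' \<xi>)) \<longlonglongrightarrow> 2 * 0 + 2 * 0"
    by (intro tendsto_add tendsto_mult_ennreal tendsto_const to_zero h'_zero) auto
  then have "energy (\<lambda>\<xi>. h' \<xi> - g \<xi>) \<le> 2 * 0 + 2 * 0"
    by (rule LIMSEQ_le_const) (use le in auto)
  then have "energy (\<lambda>\<xi>. h' \<xi> - g \<xi>) = 0" by simp
  then have "AE x in lborel. ennreal ((cmod (h' x - g x))\<^sup>2) = 0"
    unfolding energy_def by (subst (asm) nn_integral_0_iff_AE) auto
  then have "AE x in lborel. h x = g x" using hh' by eventually_elim simp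
  then show ?thesis using that[of g] gE EE hm unfolding h_def by auto
qed

lemma freq_proj_eq_synth:
  assumes g[measurable]: "g \<in> borel_measurable borel" and AE: "AE x in lborel. fourier_L2 f x = g x"
    and fm: "fourier_L2 f \<in> borel_measurable lebesgue"
  shows "freq_proj N \<xi> k f x = synth (restr (freq_nbhd N \<xi> k) g) x"
proof -
  have Rm[measurable]: "freq_nbhd N \<xi> k \<in> sets borel" unfolding freq_nbhd_def by (intro sets.finite_UN) auto
  have e: "exp (2 * of_real pi * \<i> * of_real \<omega> * of_real x) = cis (2 * pi * \<omega> * x)" for \<omega> :: real
    by (simp add: cis_conv_exp mult_ac)
  have cism: "(\<lambda>\<omega>. cis (2 * pi * \<omega> * x)) \<in> borel_measurable lebesgue"
    by (rule measurable_completion) measurable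
  have gm: "(\<lambda>\<omega>. restr (freq_nbhd N \<xi> k) g \<omega> * cis (2 * pi * \<omega> * x)) \<in> borel_measurable lborel"
    by measurable
  have "freq_proj N \<xi> k f x = (LINT \<omega>|lebesgue. restr (freq_nbhd N \<xi> k) g \<omega> * cis (2 * pi * \<omega> * x))"
    unfolding freq_proj_def inv_fourier_L1_def e
  proof (rule integral_cong_AE)
    show "(\<lambda>\<omega>. cis (2 * pi * \<omega> * x) * (indicator (freq_nbhd N \<xi> k) \<omega> * fourier_L2 f \<omega>)) \<in> borel_measurable lebesgue"
      using cism fm by (intro borel_measurable_times borel_measurable_indicator) auto
    show "(\<lambda>\<omega>. restr (freq_nbhd N \<xi> k) g \<omega> * cis (2 * pi * \<omega> * x)) \<in> borel_measurable lebesgue"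
      by (rule measurable_completion[OF gm])
    show "AE \<omega> in lebesgue. cis (2 * pi * \<omega> * x) * (indicator (freq_nbhd N \<xi> k) \<omega> * fourier_L2 f \<omega>)
      = restr (freq_nbhd N \<xi> k) g \<omega> * cis (2 * pi * \<omega> * x)"
      using AE_completion[OF AE] by eventually_elim (auto simp: restr_def indicator_def)
  qed
  also have "\<dots> = synth (restr (freq_nbhd N \<xi> k) g) x"
    unfolding synth_def by (rule integral_completion[OF gm])
  finally show ?thesis .
qed


section \<open>Nested families of frequency sets\<close>

lemma sum_if_unique:
  fixes g :: "'b::comm_monoid_add"
  assumes "finite J" and "\<And>i j. i \<in> J \<Longrightarrow> j \<in> J \<Longrightarrow> P i \<Longrightarrow> P j \<Longrightarrow> i = j"
  shows "(\<Sum>j\<in>J. if P j then g else 0) = (if \<exists>j\<in>J. P j then g else 0)"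
proof (cases "\<exists>j\<in>J. P j")
  case True
  then obtain i where i: "i \<in> J" "P i" by auto
  have "(\<Sum>j\<in>J. if P j then g else 0) = (\<Sum>j\<in>J. if j = i then g else 0)"
    using assms(2) i by (intro sum.cong refl) auto
  then show ?thesis using True i assms(1) by simp
next
  case False
  then have "(\<Sum>j\<in>J. if P j then g else 0) = (\<Sum>j\<in>J. 0)" by (intro sum.cong refl) auto
  then show ?thesis using False by simp
qed

lemma sum_energy_disjoint_le:
  assumes [measurable]: "G \<in> borel_measurable borel" and E: "\<And>c. c \<in> I \<Longrightarrow> E c \<in> sets borel"
    and I: "finite I" and disj: "\<And>c d. c \<in> I \<Longrightarrow> d \<in> I \<Longrightarrow> c \<noteq> d \<Longrightarrow> E c \<inter> E d = {}"
  shows "(\<Sum>c\<in>I. energy (restr (E c) G)) \<le> energy G"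
proof -
  have "(\<Sum>c\<in>I. energy (restr (E c) G)) = (\<integral>\<^sup>+x. (\<Sum>c\<in>I. ennreal ((cmod (restr (E c) G x))\<^sup>2)) \<partial>lborel)"
    unfolding energy_def
  proof (rule nn_integral_sum[symmetric])
    fix c assume "c \<in> I"
    note [measurable] = E[OF this]
    show "(\<lambda>x. ennreal ((cmod (restr (E c) G x))\<^sup>2)) \<in> borel_measurable lborel" by measurable
  qed
  also have "\<dots> \<le> energy G"
    unfolding energy_def
  proof (rule nn_integral_mono)
    fix x
    have "(\<Sum>c\<in>I. ennreal ((cmod (restr (E c) G x))\<^sup>2)) = (\<Sum>c\<in>I. if x \<in> E c then ennreal ((cmod (G x))\<^sup>2) else 0)"
      by (intro sum.cong refl) (simp add: restr_def)
    also have "\<dots> = (if \<exists>c\<in>I. x \<in> E c then ennreal ((cmod (G x))\<^sup>2) else 0)"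
      using disj by (intro sum_if_unique I) blast
    finally show "(\<Sum>c\<in>I. ennreal ((cmod (restr (E c) G x))\<^sup>2)) \<le> ennreal ((cmod (G x))\<^sup>2)" by simp
  qed
  finally show ?thesis .
qed

lemma integrable_restr_mono:
  fixes G :: "real \<Rightarrow> complex"
  assumes G: "integrable lborel (restr A G)" and [measurable]: "B \<in> sets borel" and BA: "B \<subseteq> A"
  shows "integrable lborel (restr B G)"
proof -
  have "restr B G = (\<lambda>x. indicator B x *\<^sub>R restr A G x)"
    using BA by (auto simp: restr_def fun_eq_iff indicator_def)
  then show ?thesis using integrable_mult_indicator[of B lborel "restr A G"] G by simp
qed

lemma synth_restr_diff:
  assumes A: "integrable lborel (restr A G)" and B: "B \<in> sets borel" "B \<subseteq> A"
  shows "synth (restr A G) x - synth (restr B G) x = synth (restr (A - B) G) x"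
proof -
  have iB: "integrable lborel (restr B G)" by (rule integrable_restr_mono[OF A B])
  have "synth (restr A G) x - synth (restr B G) x
     = (LINT \<omega>|lborel. restr A G \<omega> * cis (2 * pi * \<omega> * x) - restr B G \<omega> * cis (2 * pi * \<omega> * x))"
    unfolding synth_def
    by (rule Bochner_Integration.integral_diff[OF integrable_mult_cis[OF A] integrable_mult_cis[OF iB], symmetric])
  also have "\<dots> = synth (restr (A - B) G) x"
    unfolding synth_def using B(2) by (intro Bochner_Integration.integral_cong refl) (auto simp: restr_def)
  finally show ?thesis .
qed

text \<open>
  Writing the index in binary, the value at \<open>b\<close> is the value at 0 plus one increment for each binary digit.
  For a fixed digit the increments form a step function whose values belong to disjoint frequency sets, so
  its square function is bounded by the energy; there are \<open>s\<close> digits.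
\<close>

lemma rademacher_menshov:
  fixes S :: "nat \<Rightarrow> real set"
  assumes r: "2 \<le> r" and Gm[measurable]: "G \<in> borel_measurable borel"
    and Sm[measurable]: "\<And>b. S b \<in> sets borel" and dec: "antimono S"
    and int: "integrable lborel (restr (S 0) G)" and p: "p < 2 ^ s"
  obtains X :: "real \<Rightarrow> real" where "X \<in> borel_measurable borel"
    "\<And>x. var_le r (\<lambda>b. synth (restr (S (min b p)) G) x) (X x)"
    "(\<integral>\<^sup>+x. ennreal ((X x)\<^sup>2) \<partial>lborel) \<le> ennreal (64 * (real s)\<^sup>2) * energy G"
proof -
  define Q where "Q = (\<lambda>b. synth (restr (S b) G))"
  define D where "D = (\<lambda>\<sigma> c x. Q (c * 2 ^ \<sigma>) x - Q ((c div 2) * 2 ^ Suc \<sigma>) x)"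
  define Z where "Z = (\<lambda>\<sigma> x. \<Sum>c\<le>p. (cmod (D \<sigma> c x))\<^sup>2)"
  define X where "X = (\<lambda>x. \<Sum>\<sigma><s. 8 * sqrt (Z \<sigma> x))"
  have Qm[measurable]: "Q b \<in> borel_measurable borel" for b unfolding Q_def by (intro measurable_synth restr_measurable) auto
  have Dm[measurable]: "D \<sigma> c \<in> borel_measurable borel" for \<sigma> c unfolding D_def by measurable
  have Zm[measurable]: "Z \<sigma> \<in> borel_measurable borel" for \<sigma> unfolding Z_def by measurable
  have Z0: "0 \<le> Z \<sigma> x" for \<sigma> x by (simp add: Z_def sum_nonneg)
  have iS: "integrable lborel (restr (S b) G)" for b
    by (rule integrable_restr_mono[OF int]) (use dec in \<open>auto simp: antimono_def\<close>)
  have tele: "Q (min b p) x = Q 0 x + (\<Sum>\<sigma><s. D \<sigma> (min b p div 2 ^ \<sigma>) x)" for b x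
  proof -
    let ?b = "min b p"
    have "(\<Sum>\<sigma><s. D \<sigma> (?b div 2 ^ \<sigma>) x) = (\<Sum>\<sigma><s. Q ((?b div 2 ^ \<sigma>) * 2 ^ \<sigma>) x - Q ((?b div 2 ^ Suc \<sigma>) * 2 ^ Suc \<sigma>) x)"
      unfolding D_def power_Suc2 div_mult2_eq ..
    also have "\<dots> = Q ((?b div 2 ^ 0) * 2 ^ 0) x - Q ((?b div 2 ^ s) * 2 ^ s) x"
      by (rule sum_lessThan_telescope')
    also have "?b div 2 ^ s = 0" using p by (intro div_less) (auto simp: min_def)
    finally show ?thesis by simp
  qed
  have lev: "var_le r (\<lambda>b. D \<sigma> (min b p div 2 ^ \<sigma>) x) (8 * sqrt (Z \<sigma> x))" for \<sigma> x
  proof -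
    have "mono (\<lambda>b::nat. min b p div 2 ^ \<sigma>)" by (intro monoI div_le_mono) auto
    moreover have "min b p div 2 ^ \<sigma> \<le> p" for b by (rule order_trans[OF div_le_dividend]) simp
    ultimately have "var_le r (\<lambda>b. D \<sigma> (min b p div 2 ^ \<sigma>) x) (8 * (\<Sum>c\<le>p. cmod (D \<sigma> c x) powr r) powr (1 / r))"
      using r by (intro var_le_step[where D="\<lambda>c. D \<sigma> c x"]) auto
    moreover have "(\<Sum>c\<le>p. cmod (D \<sigma> c x) powr r) powr (1 / r) \<le> sqrt (Z \<sigma> x)"
      unfolding Z_def using r by (intro powr_sum_le_l2) auto
    ultimately show ?thesis using r by (elim var_le_weaken) auto
  qed
  have Zint: "(\<integral>\<^sup>+x. ennreal (Z \<sigma> x) \<partial>lborel) \<le> energy G" for \<sigma>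
  proof -
    have "(\<integral>\<^sup>+x. ennreal (Z \<sigma> x) \<partial>lborel) = (\<Sum>c\<le>p. energy (D \<sigma> c))"
      unfolding energy_def Z_def by (subst nn_integral_sum[symmetric]) auto
    also have "\<dots> \<le> (\<Sum>c\<le>p. energy (restr (S ((c - 1) * 2 ^ \<sigma>) - S (c * 2 ^ \<sigma>)) G))"
    proof (rule sum_mono)
      fix c :: nat
      let ?e = "(c div 2) * 2 ^ Suc \<sigma>"
      have "c div 2 * 2 \<le> c" "c - 1 \<le> c div 2 * 2" by auto
      then have e: "?e \<le> c * 2 ^ \<sigma>" "(c - 1) * 2 ^ \<sigma> \<le> ?e"
        using mult_right_mono[of "c div 2 * 2" c "2 ^ \<sigma>"] mult_right_mono[of "c - 1" "c div 2 * 2" "2 ^ \<sigma>"] by auto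
      then have sub: "S (c * 2 ^ \<sigma>) \<subseteq> S ?e" "S ?e \<subseteq> S ((c - 1) * 2 ^ \<sigma>)" using dec by (auto simp: antimono_def)
      have "energy (D \<sigma> c) = energy (\<lambda>x. - D \<sigma> c x)" by (simp only: energy_uminus)
      also have "(\<lambda>x. - D \<sigma> c x) = synth (restr (S ?e - S (c * 2 ^ \<sigma>)) G)"
        using synth_restr_diff[OF iS Sm sub(1)] unfolding D_def Q_def by (intro ext) simp
      also have "energy \<dots> \<le> energy (restr (S ?e - S (c * 2 ^ \<sigma>)) G)"
        by (intro energy_synth_le integrable_restr_mono[OF iS[of ?e]]) auto
      also have "\<dots> \<le> energy (restr (S ((c - 1) * 2 ^ \<sigma>) - S (c * 2 ^ \<sigma>)) G)"
        using sub(2) by (intro energy_mono) (auto simp: restr_def)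
      finally show "energy (D \<sigma> c) \<le> energy (restr (S ((c - 1) * 2 ^ \<sigma>) - S (c * 2 ^ \<sigma>)) G)" .
    qed
    also have "\<dots> \<le> energy G"
    proof (rule sum_energy_disjoint_le)
      have *: "(S ((c - 1) * 2 ^ \<sigma>) - S (c * 2 ^ \<sigma>)) \<inter> (S ((d - 1) * 2 ^ \<sigma>) - S (d * 2 ^ \<sigma>)) = {}" if "c < d" for c d :: nat
      proof -
        have "c * 2 ^ \<sigma> \<le> (d - 1) * 2 ^ \<sigma>" using that by (intro mult_right_mono) auto
        then have "S ((d - 1) * 2 ^ \<sigma>) \<subseteq> S (c * 2 ^ \<sigma>)" using dec by (auto simp: antimono_def)
        then show ?thesis by auto
      qed
      show "(S ((c - 1) * 2 ^ \<sigma>) - S (c * 2 ^ \<sigma>)) \<inter> (S ((d - 1) * 2 ^ \<sigma>) - S (d * 2 ^ \<sigma>)) = {}" if "c \<noteq> d" for c d :: nat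
        using *[of c d] *[of d c] that by (metis Int_commute nat_neq_iff)
    qed auto
    finally show ?thesis .
  qed
  show ?thesis
  proof (rule that[of X])
    show "X \<in> borel_measurable borel" unfolding X_def by measurable
    show "var_le r (\<lambda>b. synth (restr (S (min b p)) G) x) (X x)" for x
    proof -
      have "var_le r (\<lambda>b. Q 0 x + (\<Sum>\<sigma><s. D \<sigma> (min b p div 2 ^ \<sigma>) x)) (0 + (\<Sum>\<sigma><s. 8 * sqrt (Z \<sigma> x)))"
        using r by (intro var_le_add var_le_sum var_le_const lev) auto
      then show ?thesis unfolding tele[symmetric] by (simp add: X_def Q_def)
    qed
    have "(\<integral>\<^sup>+x. ennreal ((X x)\<^sup>2) \<partial>lborel) \<le> (\<integral>\<^sup>+x. ennreal (64 * real s) * (\<Sum>\<sigma><s. ennreal (Z \<sigma> x)) \<partial>lborel)"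
    proof (rule nn_integral_mono)
      fix x
      have "(X x)\<^sup>2 = 64 * (\<Sum>\<sigma><s. 1 * sqrt (Z \<sigma> x))\<^sup>2"
        by (simp add: X_def sum_distrib_left[symmetric] power_mult_distrib)
      also have "\<dots> \<le> 64 * ((\<Sum>\<sigma><s. 1) * (\<Sum>\<sigma><s. 1 * (sqrt (Z \<sigma> x))\<^sup>2))"
        by (intro mult_left_mono weighted_cauchy_schwarz) auto
      also have "\<dots> = 64 * real s * (\<Sum>\<sigma><s. Z \<sigma> x)" using Z0 by simp
      finally have "ennreal ((X x)\<^sup>2) \<le> ennreal (64 * real s * (\<Sum>\<sigma><s. Z \<sigma> x))" by (rule ennreal_leI)
      also have "\<dots> = ennreal (64 * real s) * (\<Sum>\<sigma><s. ennreal (Z \<sigma> x))"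
        using Z0 by (subst ennreal_mult) (auto simp: sum_nonneg)
      finally show "ennreal ((X x)\<^sup>2) \<le> ennreal (64 * real s) * (\<Sum>\<sigma><s. ennreal (Z \<sigma> x))" .
    qed
    also have "\<dots> = ennreal (64 * real s) * (\<integral>\<^sup>+x. (\<Sum>\<sigma><s. ennreal (Z \<sigma> x)) \<partial>lborel)"
      by (rule nn_integral_cmult) measurable
    also have "(\<integral>\<^sup>+x. (\<Sum>\<sigma><s. ennreal (Z \<sigma> x)) \<partial>lborel) = (\<Sum>\<sigma><s. \<integral>\<^sup>+x. ennreal (Z \<sigma> x) \<partial>lborel)"
      by (rule nn_integral_sum) measurable
    also have "ennreal (64 * real s) * (\<Sum>\<sigma><s. \<integral>\<^sup>+x. ennreal (Z \<sigma> x) \<partial>lborel) \<le> ennreal (64 * real s) * (\<Sum>\<sigma><s. energy G)"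
      by (intro mult_left_mono sum_mono Zint) auto
    also have "\<dots> = ennreal (64 * (real s)\<^sup>2) * energy G"
    proof -
      have "(\<Sum>\<sigma><s. energy G) = ennreal (real s) * energy G" by (simp add: ennreal_of_nat_eq_real_of_nat)
      then show ?thesis by (simp add: mult.assoc[symmetric] ennreal_mult[symmetric] power2_eq_square)
    qed
    finally show "(\<integral>\<^sup>+x. ennreal ((X x)\<^sup>2) \<partial>lborel) \<le> ennreal (64 * (real s)\<^sup>2) * energy G" .
  qed
qed

section \<open>Shells around clusters of frequencies\<close>

definition freq_union :: "nat \<Rightarrow> (nat \<Rightarrow> real) \<Rightarrow> real \<Rightarrow> real set" where
  "freq_union N \<xi> d = (\<Union>j\<in>{1..N}. {\<xi> j - d<..<\<xi> j + d})"

text \<open>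
  The last elements of the clusters that form when intervals of radius \<open>a\<close> are put around the frequencies:
  the next frequency, if there is one, is too far away for an overlap. Similarly below for the first elements.
\<close>

definition right_ends :: "nat \<Rightarrow> (nat \<Rightarrow> real) \<Rightarrow> real \<Rightarrow> nat set" where
  "right_ends N \<xi> a = {j\<in>{1..N}. j < N \<longrightarrow> 2 * a \<le> \<xi> (Suc j) - \<xi> j}"

definition left_ends :: "nat \<Rightarrow> (nat \<Rightarrow> real) \<Rightarrow> real \<Rightarrow> nat set" where
  "left_ends N \<xi> a = {j\<in>{1..N}. 1 < j \<longrightarrow> 2 * a \<le> \<xi> j - \<xi> (j - 1)}"

context
  fixes N :: nat and \<xi> :: "nat \<Rightarrow> real" and a c :: real
  assumes mono: "strict_mono_on {1..N} \<xi>" and c: "0 < c" "c \<le> a"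
    and gaps: "\<And>j. 1 \<le> j \<Longrightarrow> j < N \<Longrightarrow> 2 * c \<le> \<xi> (Suc j) - \<xi> j \<Longrightarrow> 2 * a \<le> \<xi> (Suc j) - \<xi> j"
begin

lemma freq_less: "i \<in> {1..N} \<Longrightarrow> j \<in> {1..N} \<Longrightarrow> i < j \<Longrightarrow> \<xi> i < \<xi> j"
  using mono by (auto simp: strict_mono_on_def)

lemma freq_le: "i \<in> {1..N} \<Longrightarrow> j \<in> {1..N} \<Longrightarrow> i \<le> j \<Longrightarrow> \<xi> i \<le> \<xi> j"
  using freq_less[of i j] by (cases "i = j") auto

lemma right_ends_gap:
  assumes "j \<in> right_ends N \<xi> a" "i \<in> {1..N}" "j < i"
  shows "\<xi> j + 2 * a \<le> \<xi> i"
proof -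
  have "\<xi> (Suc j) \<le> \<xi> i" using assms by (intro freq_le) (auto simp: right_ends_def)
  then show ?thesis using assms by (auto simp: right_ends_def)
qed

lemma left_ends_gap:
  assumes "j \<in> left_ends N \<xi> a" "i \<in> {1..N}" "i < j"
  shows "\<xi> i + 2 * a \<le> \<xi> j"
proof -
  have "\<xi> i \<le> \<xi> (j - 1)" using assms by (intro freq_le) (auto simp: left_ends_def)
  then show ?thesis using assms by (auto simp: left_ends_def)
qed

lemma right_shell_subset:
  assumes d: "c \<le> d" "d \<le> a" and j: "j \<in> right_ends N \<xi> a" and \<omega>: "\<xi> j + c \<le> \<omega>" "\<omega> < \<xi> j + d"
  shows "\<omega> \<in> freq_union N \<xi> d - freq_union N \<xi> c"
proof -
  have jN: "j \<in> {1..N}" using j by (simp add: right_ends_def)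
  have "\<omega> \<notin> {\<xi> i - c<..<\<xi> i + c}" if "i \<in> {1..N}" for i
    using freq_le[OF that jN] right_ends_gap[OF j that] \<omega> d c by (cases "i \<le> j") auto
  moreover have "\<omega> \<in> {\<xi> j - d<..<\<xi> j + d}" using \<omega> c d by auto
  ultimately show ?thesis using jN unfolding freq_union_def by blast
qed

lemma left_shell_subset:
  assumes d: "c \<le> d" "d \<le> a" and j: "j \<in> left_ends N \<xi> a" and \<omega>: "\<omega> \<le> \<xi> j - c" "\<xi> j - d < \<omega>"
  shows "\<omega> \<in> freq_union N \<xi> d - freq_union N \<xi> c"
proof -
  have jN: "j \<in> {1..N}" using j by (simp add: left_ends_def)
  have "\<omega> \<notin> {\<xi> i - c<..<\<xi> i + c}" if "i \<in> {1..N}" for i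
    using freq_le[OF jN that] left_ends_gap[OF j that] \<omega> d c by (cases "j \<le> i") auto
  moreover have "\<omega> \<in> {\<xi> j - d<..<\<xi> j + d}" using \<omega> c d by auto
  ultimately show ?thesis using jN unfolding freq_union_def by blast
qed

text \<open>
  A frequency that belongs to the larger set and not to the smaller one lies beyond the nearest \<open>\<xi>\<^sub>j\<close> on one of
  its sides. The gap in which it lies is not covered by the intervals of radius \<open>c\<close>, so by the assumption on
  gaps it is not covered by those of radius \<open>a\<close> either, and \<open>\<xi>\<^sub>j\<close> is an end of a cluster.
\<close>

lemma shells_cover:
  assumes d: "c \<le> d" "d \<le> a" and \<omega>: "\<omega> \<in> freq_union N \<xi> d - freq_union N \<xi> c"
  shows "(\<exists>j\<in>right_ends N \<xi> a. \<xi> j + c \<le> \<omega> \<and> \<omega> < \<xi> j + d) \<or> (\<exists>j\<in>left_ends N \<xi> a. \<omega> \<le> \<xi> j - c \<and> \<xi> j - d < \<omega>)"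
proof -
  obtain i where i: "i \<in> {1..N}" "\<xi> i - d < \<omega>" "\<omega> < \<xi> i + d" using \<omega> by (auto simp: freq_union_def)
  have out: "\<omega> \<le> \<xi> j - c \<or> \<xi> j + c \<le> \<omega>" if "j \<in> {1..N}" for j
    using \<omega> that unfolding freq_union_def by (auto simp: not_less)
  show ?thesis
  proof (cases "\<xi> i < \<omega>")
    case True
    define T where "T = {j\<in>{1..N}. \<xi> j < \<omega>}"
    define j where "j = Max T"
    have T: "finite T" "i \<in> T" using i True by (auto simp: T_def)
    have jT: "j \<in> T" unfolding j_def using T by (intro Max_in) auto
    have ij: "i \<le> j" unfolding j_def using T by (intro Max_ge) auto
    have j: "j \<in> {1..N}" "\<xi> j < \<omega>" using jT by (auto simp: T_def)
    have "\<xi> i \<le> \<xi> j" by (rule freq_le[OF i(1) j(1) ij])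
    then have 1: "\<omega> < \<xi> j + d" using i by linarith
    have 2: "\<xi> j + c \<le> \<omega>" using out[OF j(1)] j(2) c by linarith
    have "2 * a \<le> \<xi> (Suc j) - \<xi> j" if "j < N"
    proof (rule gaps)
      have "Suc j \<notin> T" using Max_ge[OF T(1), of "Suc j"] unfolding j_def by auto
      then have "\<omega> \<le> \<xi> (Suc j)" using that by (auto simp: T_def)
      then have "\<omega> \<le> \<xi> (Suc j) - c" using out[of "Suc j"] that c by auto
      then show "2 * c \<le> \<xi> (Suc j) - \<xi> j" using 2 by linarith
    qed (use j that in auto)
    then have "j \<in> right_ends N \<xi> a" using j by (simp add: right_ends_def)
    then show ?thesis using 1 2 by blast
  next
    case False
    define T where "T = {j\<in>{1..N}. \<omega> \<le> \<xi> j}"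
    define j where "j = Min T"
    have T: "finite T" "i \<in> T" using i False by (auto simp: T_def)
    have jT: "j \<in> T" unfolding j_def using T by (intro Min_in) auto
    have ij: "j \<le> i" unfolding j_def using T by (intro Min_le) auto
    have j: "j \<in> {1..N}" "\<omega> \<le> \<xi> j" using jT by (auto simp: T_def)
    have "\<xi> j \<le> \<xi> i" by (rule freq_le[OF j(1) i(1) ij])
    then have 1: "\<xi> j - d < \<omega>" using i by linarith
    have 2: "\<omega> \<le> \<xi> j - c" using out[OF j(1)] j(2) c by linarith
    have "2 * a \<le> \<xi> j - \<xi> (j - 1)" if "1 < j"
    proof -
      have "j - 1 \<notin> T" using that Min_le[OF T(1), of "j - 1"] by (auto simp: j_def)
      then have "\<xi> (j - 1) < \<omega>" using that j by (auto simp: T_def)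
      moreover have "j - 1 \<in> {1..N}" using that j by auto
      ultimately have "\<xi> (j - 1) + c \<le> \<omega>" using out[of "j - 1"] c by linarith
      then have "2 * c \<le> \<xi> (Suc (j - 1)) - \<xi> (j - 1)" using 2 that by auto
      then show ?thesis using gaps[of "j - 1"] that j by auto
    qed
    then have "j \<in> left_ends N \<xi> a" using j by (simp add: left_ends_def)
    then show ?thesis using 1 2 by blast
  qed
qed

lemma restr_shells:
  fixes G :: "real \<Rightarrow> 'b::comm_monoid_add"
  assumes d: "c \<le> d" "d \<le> a"
  shows "restr (freq_union N \<xi> d - freq_union N \<xi> c) G \<omega>
    = (\<Sum>j\<in>right_ends N \<xi> a. restr {\<omega>. \<xi> j + c \<le> \<omega> \<and> \<omega> < \<xi> j + d} G \<omega>)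
    + (\<Sum>j\<in>left_ends N \<xi> a. restr {\<omega>. \<omega> \<le> \<xi> j - c \<and> \<xi> j - d < \<omega>} G \<omega>)"
proof -
  let ?A = "\<lambda>j. \<xi> j + c \<le> \<omega> \<and> \<omega> < \<xi> j + d" and ?B = "\<lambda>j. \<omega> \<le> \<xi> j - c \<and> \<xi> j - d < \<omega>"
  have fin: "finite (right_ends N \<xi> a)" "finite (left_ends N \<xi> a)" by (auto simp: right_ends_def left_ends_def)
  have rN: "j \<in> {1..N}" if "j \<in> right_ends N \<xi> a" for j using that by (simp add: right_ends_def)
  have lN: "j \<in> {1..N}" if "j \<in> left_ends N \<xi> a" for j using that by (simp add: left_ends_def)
  have A1: "\<not> (i < j)" if "i \<in> right_ends N \<xi> a" "j \<in> right_ends N \<xi> a" "?A i" "?A j" for i j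
    using right_ends_gap[OF that(1) rN[OF that(2)]] that(3,4) c d by linarith
  have B1: "\<not> (i < j)" if "i \<in> left_ends N \<xi> a" "j \<in> left_ends N \<xi> a" "?B i" "?B j" for i j
    using left_ends_gap[OF that(2) lN[OF that(1)]] that(3,4) c d by linarith
  have AB: False if "i \<in> right_ends N \<xi> a" "j \<in> left_ends N \<xi> a" "?A i" "?B j" for i j
  proof -
    have "i < j" using freq_le[OF lN[OF that(2)] rN[OF that(1)]] that(3,4) c by linarith
    then show False using right_ends_gap[OF that(1) lN[OF that(2)]] that(3,4) c d by linarith
  qed
  have "(\<Sum>j\<in>right_ends N \<xi> a. restr {\<omega>. \<xi> j + c \<le> \<omega> \<and> \<omega> < \<xi> j + d} G \<omega>)
     = (if \<exists>j\<in>right_ends N \<xi> a. ?A j then G \<omega> else 0)"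
    unfolding restr_def mem_Collect_eq using A1 by (intro sum_if_unique fin) (metis nat_neq_iff)
  moreover have "(\<Sum>j\<in>left_ends N \<xi> a. restr {\<omega>. \<omega> \<le> \<xi> j - c \<and> \<xi> j - d < \<omega>} G \<omega>)
     = (if \<exists>j\<in>left_ends N \<xi> a. ?B j then G \<omega> else 0)"
    unfolding restr_def mem_Collect_eq using B1 by (intro sum_if_unique fin) (metis nat_neq_iff)
  moreover have "\<omega> \<in> freq_union N \<xi> d - freq_union N \<xi> c
      \<longleftrightarrow> (\<exists>j\<in>right_ends N \<xi> a. ?A j) \<or> (\<exists>j\<in>left_ends N \<xi> a. ?B j)"
    using right_shell_subset[OF d] left_shell_subset[OF d] shells_cover[OF d] by blast
  ultimately show ?thesis using AB by (auto simp: restr_def)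
qed

lemma right_ends_separated:
  assumes "i \<in> right_ends N \<xi> a" "j \<in> right_ends N \<xi> a" "i \<noteq> j"
  shows "a \<le> \<bar>\<xi> i - \<xi> j\<bar>"
proof -
  have N: "i \<in> {1..N}" "j \<in> {1..N}" using assms by (auto simp: right_ends_def)
  show ?thesis
    using right_ends_gap[OF assms(1) N(2)] right_ends_gap[OF assms(2) N(1)] assms(3) c by (cases "i < j") auto
qed

lemma left_ends_separated:
  assumes "i \<in> left_ends N \<xi> a" "j \<in> left_ends N \<xi> a" "i \<noteq> j"
  shows "a \<le> \<bar>\<xi> i - \<xi> j\<bar>"
proof -
  have N: "i \<in> {1..N}" "j \<in> {1..N}" using assms by (auto simp: left_ends_def)
  show ?thesis
    using left_ends_gap[OF assms(1) N(2)] left_ends_gap[OF assms(2) N(1)] assms(3) c by (cases "i < j") auto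
qed

end


section \<open>Blocks of scales without merging\<close>

lemma weight_total_mono:
  assumes r: "2 < r" and "m \<le> n"
  shows "weight_total r m \<le> weight_total r n"
  unfolding weight_total_def using half_powr_less[OF r] assms
  by (intro divide_right_mono powr_mono2) auto

lemma block_const_mono:
  assumes r: "2 < r" and "m \<le> n"
  shows "block_const r m \<le> block_const r n"
proof -
  have "(weight_total r m)\<^sup>2 \<le> (weight_total r n)\<^sup>2"
    using weight_total_mono[OF assms] weight_total_nonneg[OF r] by (intro power_mono) auto
  then show ?thesis
    unfolding block_const_def martingale_const_def using sieve_const_pos by (simp add: mult_right_mono)
qed

lemma integrable_restr_bounded:
  assumes "G \<in> borel_measurable borel" "energy G < \<infinity>" "S \<in> sets borel" "S \<subseteq> {-R..R}"
  shows "integrable lborel (restr S G)"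
proof (rule bandlim_integrable[where R=R], rule bandlim_restr[OF assms(1,3,2)])
  show "\<bar>\<omega>\<bar> \<le> R" if "\<omega> \<in> S" for \<omega> using subsetD[OF assms(4) that] by auto
qed

lemma freq_union_sets[measurable]: "freq_union N \<xi> d \<in> sets borel"
  unfolding freq_union_def by (intro sets.finite_UN) auto

lemma freq_union_mono: "d \<le> e \<Longrightarrow> freq_union N \<xi> d \<subseteq> freq_union N \<xi> e"
  unfolding freq_union_def by force

lemma freq_union_bounded: "freq_union N \<xi> d \<subseteq> {- ((\<Sum>j\<in>{1..N}. \<bar>\<xi> j\<bar>) + d)..(\<Sum>j\<in>{1..N}. \<bar>\<xi> j\<bar>) + d}"
proof
  fix \<omega> assume "\<omega> \<in> freq_union N \<xi> d"
  then obtain j where j: "j \<in> {1..N}" "\<xi> j - d < \<omega>" "\<omega> < \<xi> j + d" by (auto simp: freq_union_def)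
  have "\<bar>\<xi> j\<bar> \<le> (\<Sum>j\<in>{1..N}. \<bar>\<xi> j\<bar>)" using j by (intro member_le_sum) auto
  then show "\<omega> \<in> {- ((\<Sum>j\<in>{1..N}. \<bar>\<xi> j\<bar>) + d)..(\<Sum>j\<in>{1..N}. \<bar>\<xi> j\<bar>) + d}" using j by auto
qed

lemma integrable_restr_freq_union:
  assumes "G \<in> borel_measurable borel" "energy G < \<infinity>" "S \<in> sets borel" "S \<subseteq> freq_union N \<xi> d"
  shows "integrable lborel (restr S G)"
  using assms(4) freq_union_bounded[of N \<xi> d] by (intro integrable_restr_bounded assms(1-3)) blast

abbreviation freq_scale :: "nat \<Rightarrow> (nat \<Rightarrow> real) \<Rightarrow> int \<Rightarrow> real set" where
  "freq_scale N \<xi> k \<equiv> freq_union N \<xi> (2 powi (- k))"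

lemma two_powi_antimono: "k \<le> l \<Longrightarrow> (2::real) powi (- l) \<le> 2 powi (- k)"
  by (intro power_int_increasing) auto

lemma freq_scale_antimono: "k \<le> l \<Longrightarrow> freq_scale N \<xi> l \<subseteq> freq_scale N \<xi> k"
  by (intro freq_union_mono two_powi_antimono)

lemma square_sum_le: "(x + y)\<^sup>2 \<le> 2 * x\<^sup>2 + 2 * (y::real)\<^sup>2"
  using sum_squares_bound[of x y] by (simp add: power2_sum)

lemma nn_integral_square_sum_le:
  fixes X Y :: "real \<Rightarrow> real"
  assumes [measurable]: "X \<in> borel_measurable borel" "Y \<in> borel_measurable borel"
  shows "(\<integral>\<^sup>+x. ennreal ((X x + Y x)\<^sup>2) \<partial>lborel)
    \<le> 2 * (\<integral>\<^sup>+x. ennreal ((X x)\<^sup>2) \<partial>lborel) + 2 * (\<integral>\<^sup>+x. ennreal ((Y x)\<^sup>2) \<partial>lborel)"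
proof -
  have "(\<integral>\<^sup>+x. ennreal ((X x + Y x)\<^sup>2) \<partial>lborel) \<le> (\<integral>\<^sup>+x. 2 * ennreal ((X x)\<^sup>2) + 2 * ennreal ((Y x)\<^sup>2) \<partial>lborel)"
  proof (rule nn_integral_mono)
    fix x
    have "ennreal ((X x + Y x)\<^sup>2) \<le> ennreal (2 * (X x)\<^sup>2 + 2 * (Y x)\<^sup>2)" by (intro ennreal_leI square_sum_le)
    also have "\<dots> = 2 * ennreal ((X x)\<^sup>2) + 2 * ennreal ((Y x)\<^sup>2)" by (simp add: ennreal_plus ennreal_mult)
    finally show "ennreal ((X x + Y x)\<^sup>2) \<le> 2 * ennreal ((X x)\<^sup>2) + 2 * ennreal ((Y x)\<^sup>2)" .
  qed
  then show ?thesis by (simp add: nn_integral_add nn_integral_cmult)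
qed

text \<open>
  The assumption says that no two intervals merge between the scales \<open>\<mu>\<close> and \<open>\<kappa>\<close>: a gap that is open at the
  finest scale \<open>\<kappa>\<close> is open at the coarsest scale \<open>\<mu>\<close>.
\<close>

lemma block_variation:
  fixes \<mu> \<kappa> :: int
  assumes r: "2 < r" and mono: "strict_mono_on {1..N} \<xi>"
    and Gm[measurable]: "G \<in> borel_measurable borel" and Gfin: "energy G < \<infinity>" and le: "\<mu> \<le> \<kappa>"
    and gaps: "\<And>j. 1 \<le> j \<Longrightarrow> j < N \<Longrightarrow> 2 * 2 powi (- \<kappa>) \<le> \<xi> (Suc j) - \<xi> j \<Longrightarrow> 2 * 2 powi (- \<mu>) \<le> \<xi> (Suc j) - \<xi> j"
  obtains X :: "real \<Rightarrow> real" where "X \<in> borel_measurable borel"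
    "\<And>x. var_le r (\<lambda>k. synth (restr (freq_scale N \<xi> (max \<mu> (min \<kappa> k)) - freq_scale N \<xi> \<kappa>) G) x) (X x)"
    "(\<integral>\<^sup>+x. ennreal ((X x)\<^sup>2) \<partial>lborel)
      \<le> ennreal (2 * block_const r N) * energy (restr (freq_scale N \<xi> \<mu> - freq_scale N \<xi> \<kappa>) G)"
proof -
  define L where "L = (2::real) powi \<mu>"
  define a where "a = (2::real) powi (- \<mu>)"
  define c where "c = (2::real) powi (- \<kappa>)"
  define n where "n = nat (\<kappa> - \<mu>)"
  have L: "0 < L" by (simp add: L_def)
  have aL: "a = 1 / L" by (simp add: a_def L_def power_int_minus divide_inverse)
  have c: "0 < c" "c \<le> a" using two_powi_antimono[OF le] by (simp_all add: a_def c_def)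
  note gaps' = gaps[folded a_def c_def]
  note geo = mono c gaps'
  define JR where "JR = right_ends N \<xi> a"
  define JL where "JL = left_ends N \<xi> a"
  have J: "finite JR" "finite JL" "card JR \<le> N" "card JL \<le> N"
  proof -
    have "JR \<subseteq> {1..N}" "JL \<subseteq> {1..N}" by (auto simp: JR_def JL_def right_ends_def left_ends_def)
    then show "finite JR" "finite JL" "card JR \<le> N" "card JL \<le> N"
      using card_mono[of "{1..N}" JR] card_mono[of "{1..N}" JL] by (auto intro: finite_subset)
  qed
  define SR where "SR = (\<lambda>j. {\<omega>. \<xi> j + c \<le> \<omega> \<and> \<omega> < \<xi> j + a})"
  define SL where "SL = (\<lambda>j. {\<omega>. \<omega> \<le> \<xi> j - c \<and> \<xi> j - a < \<omega>})"
  have Sm: "SR j \<in> sets borel" "SL j \<in> sets borel" for j unfolding SR_def SL_def by measurable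
  have sepR: "1 / L \<le> \<bar>\<xi> i - \<xi> j\<bar>" if "i \<in> JR" "j \<in> JR" "i \<noteq> j" for i j
    using right_ends_separated[OF geo] that unfolding JR_def aL[symmetric] by blast
  have sepL: "1 / L \<le> \<bar>\<xi> i - \<xi> j\<bar>" if "i \<in> JL" "j \<in> JL" "i \<noteq> j" for i j
    using left_ends_separated[OF geo] that unfolding JL_def aL[symmetric] by blast
  obtain X1 where X1[measurable]: "X1 \<in> borel_measurable borel"
    and V1: "\<And>x. var_le r (\<lambda>i. \<Sum>j\<in>JR. synth (restr {\<omega>\<in>SR j. \<bar>\<omega> - \<xi> j\<bar> < 1 / (L * 2 ^ min i n)} G) x) (X1 x)"
    and I1: "(\<integral>\<^sup>+x. ennreal ((X1 x)\<^sup>2) \<partial>lborel) \<le> ennreal (block_const r (card JR)) * (\<Sum>j\<in>JR. energy (restr (SR j) G))"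
    by (rule shell_variation[where S=SR and n=n, OF r J(1) L sepR Gm Gfin Sm(1)]) auto
  obtain X2 where X2[measurable]: "X2 \<in> borel_measurable borel"
    and V2: "\<And>x. var_le r (\<lambda>i. \<Sum>j\<in>JL. synth (restr {\<omega>\<in>SL j. \<bar>\<omega> - \<xi> j\<bar> < 1 / (L * 2 ^ min i n)} G) x) (X2 x)"
    and I2: "(\<integral>\<^sup>+x. ennreal ((X2 x)\<^sup>2) \<partial>lborel) \<le> ennreal (block_const r (card JL)) * (\<Sum>j\<in>JL. energy (restr (SL j) G))"
    by (rule shell_variation[where S=SL and n=n, OF r J(2) L sepL Gm Gfin Sm(2)]) auto
  have split: "synth (restr (freq_scale N \<xi> (max \<mu> (min \<kappa> k)) - freq_scale N \<xi> \<kappa>) G) x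
      = (\<Sum>j\<in>JR. synth (restr {\<omega>\<in>SR j. \<bar>\<omega> - \<xi> j\<bar> < 1 / (L * 2 ^ min (nat (max \<mu> (min \<kappa> k) - \<mu>)) n)} G) x)
      + (\<Sum>j\<in>JL. synth (restr {\<omega>\<in>SL j. \<bar>\<omega> - \<xi> j\<bar> < 1 / (L * 2 ^ min (nat (max \<mu> (min \<kappa> k) - \<mu>)) n)} G) x)"
    for k x
  proof -
    define k' where "k' = max \<mu> (min \<kappa> k)"
    define d where "d = (2::real) powi (- k')"
    have k': "\<mu> \<le> k'" "k' \<le> \<kappa>" using le by (auto simp: k'_def)
    have d: "c \<le> d" "d \<le> a" using two_powi_antimono[OF k'(1)] two_powi_antimono[OF k'(2)] by (simp_all add: a_def c_def d_def)
    have "1 / (L * 2 ^ min (nat (k' - \<mu>)) n) = d"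
    proof -
      have "min (nat (k' - \<mu>)) n = nat (k' - \<mu>)" using k' by (simp add: n_def)
      moreover have "(2::real) powi k' = 2 powi \<mu> * 2 ^ nat (k' - \<mu>)"
      proof -
        define m where "m = nat (k' - \<mu>)"
        have "k' = \<mu> + int m" using k' by (simp add: m_def)
        then have "(2::real) powi k' = 2 powi \<mu> * 2 ^ m" by (simp add: power_int_add)
        then show ?thesis by (simp only: m_def)
      qed
      ultimately show ?thesis by (simp add: d_def L_def power_int_minus divide_inverse)
    qed
    moreover have "{\<omega>\<in>SR j. \<bar>\<omega> - \<xi> j\<bar> < d} = {\<omega>. \<xi> j + c \<le> \<omega> \<and> \<omega> < \<xi> j + d}" for j
      using c d by (auto simp: SR_def)
    moreover have "{\<omega>\<in>SL j. \<bar>\<omega> - \<xi> j\<bar> < d} = {\<omega>. \<omega> \<le> \<xi> j - c \<and> \<xi> j - d < \<omega>}" for j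
      using c d by (auto simp: SL_def)
    moreover have "synth (restr (freq_union N \<xi> d - freq_union N \<xi> c) G) x
      = (\<Sum>j\<in>JR. synth (restr {\<omega>. \<xi> j + c \<le> \<omega> \<and> \<omega> < \<xi> j + d} G) x)
      + (\<Sum>j\<in>JL. synth (restr {\<omega>. \<omega> \<le> \<xi> j - c \<and> \<xi> j - d < \<omega>} G) x)"
    proof -
      have iR: "integrable lborel (restr {\<omega>. \<xi> j + c \<le> \<omega> \<and> \<omega> < \<xi> j + d} G)" for j
        using c d by (intro integrable_restr_bounded[where R="\<bar>\<xi> j\<bar> + d"] Gm Gfin) auto
      have iL: "integrable lborel (restr {\<omega>. \<omega> \<le> \<xi> j - c \<and> \<xi> j - d < \<omega>} G)" for j
        using c d by (intro integrable_restr_bounded[where R="\<bar>\<xi> j\<bar> + d"] Gm Gfin) auto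
      let ?g1 = "\<lambda>\<omega>. \<Sum>j\<in>JR. 1 * restr {\<omega>. \<xi> j + c \<le> \<omega> \<and> \<omega> < \<xi> j + d} G \<omega>"
      let ?g2 = "\<lambda>\<omega>. \<Sum>j\<in>JL. 1 * restr {\<omega>. \<omega> \<le> \<xi> j - c \<and> \<xi> j - d < \<omega>} G \<omega>"
      have "restr (freq_union N \<xi> d - freq_union N \<xi> c) G = (\<lambda>\<omega>. ?g1 \<omega> + ?g2 \<omega>)"
        using restr_shells[OF geo d, of G] by (intro ext) (simp add: JR_def JL_def)
      then have "synth (restr (freq_union N \<xi> d - freq_union N \<xi> c) G) x
         = (LINT \<omega>|lborel. ?g1 \<omega> * cis (2 * pi * \<omega> * x) + ?g2 \<omega> * cis (2 * pi * \<omega> * x))"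
        by (simp add: synth_def distrib_right)
      also have "\<dots> = synth ?g1 x + synth ?g2 x"
        unfolding synth_def
        by (intro Bochner_Integration.integral_add integrable_mult_cis Bochner_Integration.integrable_sum integrable_mult_right iR iL)
      also have "synth ?g1 x = (\<Sum>j\<in>JR. 1 * synth (restr {\<omega>. \<xi> j + c \<le> \<omega> \<and> \<omega> < \<xi> j + d} G) x)"
        by (rule synth_sum[OF J(1) iR])
      also have "synth ?g2 x = (\<Sum>j\<in>JL. 1 * synth (restr {\<omega>. \<omega> \<le> \<xi> j - c \<and> \<xi> j - d < \<omega>} G) x)"
        by (rule synth_sum[OF J(2) iL])
      finally show ?thesis by simp
    qed
    ultimately show ?thesis by (simp add: k'_def[symmetric] d_def[symmetric] c_def[symmetric])
  qed
  define \<phi> where "\<phi> = (\<lambda>k. nat (max \<mu> (min \<kappa> k) - \<mu>))"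
  have \<phi>: "mono \<phi>" unfolding \<phi>_def by (intro monoI nat_mono) auto
  show ?thesis
  proof (rule that[of "\<lambda>x. X1 x + X2 x"])
    show "(\<lambda>x. X1 x + X2 x) \<in> borel_measurable borel" by measurable
    show "var_le r (\<lambda>k. synth (restr (freq_scale N \<xi> (max \<mu> (min \<kappa> k)) - freq_scale N \<xi> \<kappa>) G) x) (X1 x + X2 x)" for x
      unfolding split using r var_le_comp_mono[OF V1[of x] \<phi>] var_le_comp_mono[OF V2[of x] \<phi>]
      unfolding \<phi>_def by (intro var_le_add) auto
    have E: "(\<Sum>j\<in>JR. energy (restr (SR j) G)) + (\<Sum>j\<in>JL. energy (restr (SL j) G))
      = energy (restr (freq_scale N \<xi> \<mu> - freq_scale N \<xi> \<kappa>) G)"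
    proof -
      have sq: "ennreal ((cmod (restr S G x))\<^sup>2) = restr S (\<lambda>x. ennreal ((cmod (G x))\<^sup>2)) x" for S x
        by (simp add: restr_def)
      have m: "(\<lambda>x. ennreal ((cmod (restr (SR j) G x))\<^sup>2)) \<in> borel_measurable lborel"
        "(\<lambda>x. ennreal ((cmod (restr (SL j) G x))\<^sup>2)) \<in> borel_measurable lborel" for j
        using restr_measurable[OF Gm Sm(1)[of j]] restr_measurable[OF Gm Sm(2)[of j]] by measurable
      have "energy (restr (freq_scale N \<xi> \<mu> - freq_scale N \<xi> \<kappa>) G)
        = (\<integral>\<^sup>+x. (\<Sum>j\<in>JR. ennreal ((cmod (restr (SR j) G x))\<^sup>2)) + (\<Sum>j\<in>JL. ennreal ((cmod (restr (SL j) G x))\<^sup>2)) \<partial>lborel)"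
        unfolding energy_def sq SR_def SL_def JR_def JL_def a_def[symmetric] c_def[symmetric]
        by (intro nn_integral_cong) (rule restr_shells[OF geo c(2) order_refl])
      also have "\<dots> = (\<Sum>j\<in>JR. energy (restr (SR j) G)) + (\<Sum>j\<in>JL. energy (restr (SL j) G))"
        unfolding energy_def using m
        by (subst nn_integral_add) (auto intro!: borel_measurable_sum simp only: nn_integral_sum)
      finally show ?thesis by simp
    qed
    have bc: "ennreal (block_const r (card JR)) \<le> ennreal (block_const r N)" "ennreal (block_const r (card JL)) \<le> ennreal (block_const r N)"
      using J block_const_mono[OF r] by (auto intro: ennreal_leI)
    have "(\<integral>\<^sup>+x. ennreal ((X1 x + X2 x)\<^sup>2) \<partial>lborel)
      \<le> 2 * (\<integral>\<^sup>+x. ennreal ((X1 x)\<^sup>2) \<partial>lborel) + 2 * (\<integral>\<^sup>+x. ennreal ((X2 x)\<^sup>2) \<partial>lborel)"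
      by (rule nn_integral_square_sum_le) measurable
    also have "\<dots> \<le> 2 * (ennreal (block_const r N) * (\<Sum>j\<in>JR. energy (restr (SR j) G)))
      + 2 * (ennreal (block_const r N) * (\<Sum>j\<in>JL. energy (restr (SL j) G)))"
      by (intro add_mono mult_left_mono order_trans[OF I1] order_trans[OF I2] mult_right_mono bc) auto
    also have "\<dots> = 2 * ennreal (block_const r N) * energy (restr (freq_scale N \<xi> \<mu> - freq_scale N \<xi> \<kappa>) G)"
      unfolding E[symmetric] by (simp only: distrib_left mult.assoc)
    also have "2 * ennreal (block_const r N) = ennreal (2 * block_const r N)"
      using martingale_const_nonneg[of r N] sieve_const_pos by (simp add: ennreal_mult block_const_def)
    finally show "(\<integral>\<^sup>+x. ennreal ((X1 x + X2 x)\<^sup>2) \<partial>lborel)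
      \<le> ennreal (2 * block_const r N) * energy (restr (freq_scale N \<xi> \<mu> - freq_scale N \<xi> \<kappa>) G)" .
  qed
qed

definition clamp_scale :: "nat \<Rightarrow> int \<Rightarrow> int" where
  "clamp_scale K k = max (- int K) (min (int K) k)"

lemma clamp_scale_range: "clamp_scale K k \<in> {- int K..int K}" by (auto simp: clamp_scale_def)
lemma clamp_scale_id: "k \<in> {- int K..int K} \<Longrightarrow> clamp_scale K k = k" by (auto simp: clamp_scale_def)
lemma clamp_scale_mono: "mono (clamp_scale K)" by (intro monoI) (auto simp: clamp_scale_def)

text \<open>
  A scale is labelled by the number of gaps that are open at it. Since a gap that is open at a scale is open at
  all finer scales, equal labels mean equal sets of open gaps, and the labels are monotone with at most \<open>N\<close>
  values. Thus the labels describe the blocks.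
\<close>

lemma window_variation:
  assumes r: "2 < r" and N: "1 \<le> N" "N \<le> 2 ^ s" and mono: "strict_mono_on {1..N} \<xi>"
    and Gm[measurable]: "G \<in> borel_measurable borel" and Gfin: "energy G < \<infinity>"
  obtains X :: "real \<Rightarrow> real" where "X \<in> borel_measurable borel"
    "\<And>x. var_le r (\<lambda>k. synth (restr (freq_scale N \<xi> (clamp_scale K k)) G) x) (X x)"
    "(\<integral>\<^sup>+x. ennreal ((X x)\<^sup>2) \<partial>lborel) \<le> ennreal (128 * (real s)\<^sup>2 + 256 * block_const r N) * energy G"
proof -
  define p where "p = N - 1"
  have p2: "p < 2 ^ s" using N by (simp add: p_def)
  define R where "R = freq_scale N \<xi>"
  have Rm[measurable]: "R k \<in> sets borel" for k unfolding R_def by measurable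
  have Rdec: "R l \<subseteq> R k" if "k \<le> l" for k l unfolding R_def by (rule freq_scale_antimono[OF that])
  have Ri: "integrable lborel (restr S G)" if "S \<in> sets borel" "S \<subseteq> R k" for S k
    using that unfolding R_def by (intro integrable_restr_freq_union[OF Gm Gfin])
  define B where "B = (\<lambda>k::int. {j\<in>{1..<N}. 2 * 2 powi (- k) \<le> \<xi> (Suc j) - \<xi> j})"
  define \<beta> where "\<beta> = (\<lambda>k. card (B k))"
  have Bfin: "finite (B k)" for k by (simp add: B_def)
  have Bmono: "B k \<subseteq> B l" if "k \<le> l" for k l
    using two_powi_antimono[OF that] by (auto simp: B_def)
  have \<beta>mono: "\<beta> k \<le> \<beta> l" if "k \<le> l" for k l
    unfolding \<beta>_def by (rule card_mono[OF Bfin Bmono[OF that]])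
  have \<beta>p: "\<beta> k \<le> p" for k
  proof -
    have "B k \<subseteq> {1..<N}" by (auto simp: B_def)
    then have "card (B k) \<le> card {1..<N}" by (intro card_mono) auto
    then show ?thesis by (simp add: \<beta>_def p_def)
  qed
  define W where "W = {- int K..int K}"
  define \<kappa> where "\<kappa> = (\<lambda>b. Max (insert (- int K) {k\<in>W. \<beta> k \<le> b}))"
  have Wfin: "finite W" "finite {k\<in>W. Q k}" for Q unfolding W_def by (rule finite_atLeastAtMost_int, rule finite_subset[of _ "{- int K..int K}"]) auto
  have \<kappa>mono: "\<kappa> b \<le> \<kappa> b'" if "b \<le> b'" for b b'
    unfolding \<kappa>_def using that Wfin by (intro Max_mono) auto
  have \<kappa>top: "t \<le> \<kappa> (\<beta> t)" "\<kappa> (\<beta> t) \<in> W" "\<beta> (\<kappa> (\<beta> t)) = \<beta> t" if t: "t \<in> W" for t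
  proof -
    have K: "- int K \<in> W" "- int K \<le> t" using t by (auto simp: W_def)
    have ins: "insert (- int K) {k\<in>W. \<beta> k \<le> \<beta> t} = {k\<in>W. \<beta> k \<le> \<beta> t}"
      using K \<beta>mono[OF K(2)] by auto
    show "t \<le> \<kappa> (\<beta> t)" unfolding \<kappa>_def ins using t Wfin by (intro Max_ge) auto
    moreover have "\<kappa> (\<beta> t) \<in> {k\<in>W. \<beta> k \<le> \<beta> t}" unfolding \<kappa>_def ins using t Wfin by (intro Max_in) auto
    ultimately show "\<kappa> (\<beta> t) \<in> W" "\<beta> (\<kappa> (\<beta> t)) = \<beta> t" using \<beta>mono[of t "\<kappa> (\<beta> t)"] by auto
  qed
  define P where "P = (\<lambda>k x. synth (restr (R k) G) x)"
  (* The values at the last scales of the blocks. *)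
  obtain Y where Ym[measurable]: "Y \<in> borel_measurable borel"
    and Yvar: "\<And>x. var_le r (\<lambda>b. synth (restr (R (\<kappa> (min b p))) G) x) (Y x)"
    and Yint: "(\<integral>\<^sup>+x. ennreal ((Y x)\<^sup>2) \<partial>lborel) \<le> ennreal (64 * (real s)\<^sup>2) * energy G"
  proof (rule rademacher_menshov[where S="\<lambda>b. R (\<kappa> b)" and p=p and s=s and r=r, OF _ Gm])
    show "antimono (\<lambda>b. R (\<kappa> b))" using Rdec \<kappa>mono by (intro antimonoI) auto
    show "integrable lborel (restr (R (\<kappa> 0)) G)" by (rule Ri) auto
  qed (use r p2 in auto)
  define \<beta>' where "\<beta>' = (\<lambda>k. \<beta> (clamp_scale K k))"
  have cW: "clamp_scale K k \<in> W" for k unfolding W_def by (rule clamp_scale_range)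
  have \<beta>'mono: "mono \<beta>'" unfolding \<beta>'_def
    by (intro monoI \<beta>mono) (use clamp_scale_mono[of K] in \<open>auto simp: mono_def\<close>)
  have long: "var_le r (\<lambda>k. P (\<kappa> (\<beta>' k)) x) (Y x)" for x
    using var_le_comp_mono[OF Yvar[of x] \<beta>'mono] \<beta>p by (simp add: P_def \<beta>'_def min_absorb1)
  (* Within a block the difference to its last scale is taken, so that only the frequencies
     between the first and the last set of the block occur. *)
  define T where "T = (\<lambda>b. {k\<in>W. \<beta> k = b})"
  define lo where "lo = (\<lambda>b. Min (T b))"
  define E where "E = (\<lambda>b. if T b = {} then {} else R (lo b) - R (\<kappa> b))"
  define A where "A = (\<lambda>b x k. if T b = {} then 0 else synth (restr (R (max (lo b) (min (\<kappa> b) k)) - R (\<kappa> b)) G) x)"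
  have loT: "lo b \<in> T b" "\<And>k. k \<in> T b \<Longrightarrow> lo b \<le> k" if "T b \<noteq> {}" for b
  proof -
    have fin: "finite (T b)" unfolding T_def by (rule Wfin(2))
    show "lo b \<in> T b" unfolding lo_def by (rule Min_in[OF fin that])
    show "lo b \<le> k" if "k \<in> T b" for k unfolding lo_def by (rule Min_le[OF fin that])
  qed
  have \<kappa>T: "\<kappa> b \<in> T b" "\<And>k. k \<in> T b \<Longrightarrow> k \<le> \<kappa> b" if ne: "T b \<noteq> {}" for b
    using ne \<kappa>top by (auto simp: T_def)
  have "\<exists>X. X \<in> borel_measurable borel \<and> (\<forall>x. var_le r (A b x) (X x)) \<and>
      (\<integral>\<^sup>+x. ennreal ((X x)\<^sup>2) \<partial>lborel) \<le> ennreal (2 * block_const r N) * energy (restr (E b) G)" for b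
  proof (cases "T b = {}")
    case True
    have "var_le r (A b x) 0" for x using True var_le_const[of r 0] r by (simp add: A_def)
    then show ?thesis by (intro exI[of _ "\<lambda>x. 0"]) auto
  next
    case False
    have "lo b \<le> \<kappa> b" using loT[OF False] \<kappa>T[OF False] by auto
    moreover have "2 * 2 powi (- lo b) \<le> \<xi> (Suc j) - \<xi> j"
      if "1 \<le> j" "j < N" "2 * 2 powi (- \<kappa> b) \<le> \<xi> (Suc j) - \<xi> j" for j
    proof -
      have "\<beta> (lo b) = \<beta> (\<kappa> b)" using loT(1)[OF False] \<kappa>T(1)[OF False] by (simp add: T_def)
      then have "B (lo b) = B (\<kappa> b)"
        using card_subset_eq[OF Bfin Bmono] \<open>lo b \<le> \<kappa> b\<close> by (simp add: \<beta>_def)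
      moreover have "j \<in> B (\<kappa> b)" using that by (simp add: B_def)
      ultimately show ?thesis by (auto simp: B_def)
    qed
    ultimately obtain X where "X \<in> borel_measurable borel"
      "\<And>x. var_le r (\<lambda>k. synth (restr (freq_scale N \<xi> (max (lo b) (min (\<kappa> b) k)) - freq_scale N \<xi> (\<kappa> b)) G) x) (X x)"
      "(\<integral>\<^sup>+x. ennreal ((X x)\<^sup>2) \<partial>lborel)
        \<le> ennreal (2 * block_const r N) * energy (restr (freq_scale N \<xi> (lo b) - freq_scale N \<xi> (\<kappa> b)) G)"
      using block_variation[OF r mono Gm Gfin] by metis
    then show ?thesis using False by (intro exI[of _ X]) (simp add: A_def E_def R_def)
  qed
  then obtain X where Xm[measurable]: "\<And>b. X b \<in> borel_measurable borel"
    and Xvar: "\<And>b x. var_le r (A b x) (X b x)"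
    and Xint: "\<And>b. (\<integral>\<^sup>+x. ennreal ((X b x)\<^sup>2) \<partial>lborel) \<le> ennreal (2 * block_const r N) * energy (restr (E b) G)"
    by metis
  define Z where "Z = (\<lambda>x. 8 * sqrt (\<Sum>b\<le>p. (X b x)\<^sup>2))"
  have Zm[measurable]: "Z \<in> borel_measurable borel" unfolding Z_def by measurable
  have short: "var_le r (\<lambda>k. P (clamp_scale K k) x - P (\<kappa> (\<beta>' k)) x) (Z x)" for x
  proof -
    let ?a = "\<lambda>k. P (clamp_scale K k) x - P (\<kappa> (\<beta>' k)) x"
    have aA: "?a k = A (\<beta>' k) x (clamp_scale K k)" and A\<kappa>: "A (\<beta>' k) x (\<kappa> (\<beta>' k)) = 0" for k
    proof -
      let ?t = "clamp_scale K k"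
      have t: "?t \<in> T (\<beta>' k)" using cW[of k] by (simp add: T_def \<beta>'_def)
      then have ne: "T (\<beta>' k) \<noteq> {}" by auto
      have b: "lo (\<beta>' k) \<le> ?t" "?t \<le> \<kappa> (\<beta>' k)" "lo (\<beta>' k) \<le> \<kappa> (\<beta>' k)"
        using loT(2)[OF ne t] \<kappa>T(2)[OF ne t] by auto
      have "?a k = synth (restr (R ?t - R (\<kappa> (\<beta>' k))) G) x"
        unfolding P_def using b by (intro synth_restr_diff Ri[OF _ order_refl] Rdec) auto
      then show "?a k = A (\<beta>' k) x ?t" using ne b by (simp add: A_def min_absorb2 max_absorb2)
      have "restr {} G = (\<lambda>\<omega>. 0)" by (auto simp: restr_def)
      then show "A (\<beta>' k) x (\<kappa> (\<beta>' k)) = 0" using b by (simp add: A_def max_absorb2 synth_def)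
    qed
    have bound: "cmod (?a k) \<le> X (\<beta>' k) x" for k
      using var_le_increment[OF Xvar[of "\<beta>' k" x], of "clamp_scale K k" "\<kappa> (\<beta>' k)"] A\<kappa>[of k] r by (simp add: aA)
    have "var_le r ?a (8 * (\<Sum>b\<le>p. X b x powr r) powr (1 / r))"
    proof (rule var_le_blocks[where \<beta>=\<beta>' and A="\<lambda>b k. A b x (clamp_scale K k)"])
      show "var_le r (\<lambda>k. A b x (clamp_scale K k)) (X b x)" for b
        by (rule var_le_comp_mono[OF Xvar clamp_scale_mono])
    qed (use r \<beta>'mono \<beta>p aA bound in \<open>auto simp: \<beta>'_def\<close>)
    moreover have "(\<Sum>b\<le>p. X b x powr r) powr (1 / r) \<le> sqrt (\<Sum>b\<le>p. (X b x)\<^sup>2)"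
      using r var_le_nonneg[OF Xvar] by (intro powr_sum_le_l2) auto
    ultimately show ?thesis unfolding Z_def using r by (elim var_le_weaken) auto
  qed
  have bc0: "0 \<le> block_const r N"
    using martingale_const_nonneg[of r N] sieve_const_pos by (simp add: block_const_def)
  have Zint: "(\<integral>\<^sup>+x. ennreal ((Z x)\<^sup>2) \<partial>lborel) \<le> ennreal (128 * block_const r N) * energy G"
  proof -
    have "(\<integral>\<^sup>+x. ennreal ((Z x)\<^sup>2) \<partial>lborel) = (\<integral>\<^sup>+x. ennreal 64 * (\<Sum>b\<le>p. ennreal ((X b x)\<^sup>2)) \<partial>lborel)"
    proof (rule nn_integral_cong)
      fix x
      have "(Z x)\<^sup>2 = 64 * (\<Sum>b\<le>p. (X b x)\<^sup>2)" by (simp add: Z_def power_mult_distrib sum_nonneg)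
      then show "ennreal ((Z x)\<^sup>2) = ennreal 64 * (\<Sum>b\<le>p. ennreal ((X b x)\<^sup>2))"
        by (simp add: ennreal_mult sum_nonneg)
    qed
    also have "\<dots> = ennreal 64 * (\<Sum>b\<le>p. \<integral>\<^sup>+x. ennreal ((X b x)\<^sup>2) \<partial>lborel)"
      by (subst nn_integral_cmult, measurable, subst nn_integral_sum) auto
    also have "\<dots> \<le> ennreal 64 * (\<Sum>b\<le>p. ennreal (2 * block_const r N) * energy (restr (E b) G))"
      by (intro mult_left_mono sum_mono Xint) auto
    also have "\<dots> = ennreal (128 * block_const r N) * (\<Sum>b\<le>p. energy (restr (E b) G))"
    proof -
      have "ennreal 64 * ennreal (2 * block_const r N) = ennreal (128 * block_const r N)"
        using bc0 by (subst ennreal_mult[symmetric]) auto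
      then show ?thesis by (simp only: sum_distrib_left[symmetric] mult.assoc[symmetric])
    qed
    also have "\<dots> \<le> ennreal (128 * block_const r N) * energy G"
    proof (intro mult_left_mono sum_energy_disjoint_le Gm)
      show "E b \<in> sets borel" for b by (simp add: E_def)
      have *: "E b \<inter> E b' = {}" if "b < b'" for b b'
      proof (cases "T b = {} \<or> T b' = {}")
        case False
        then have ne: "T b \<noteq> {}" "T b' \<noteq> {}" by auto
        have "\<kappa> b \<le> lo b'"
          using \<beta>mono[of "lo b'" "\<kappa> b"] \<kappa>T(1)[OF ne(1)] loT(1)[OF ne(2)] that by (force simp: T_def)
        then show ?thesis using Rdec[of "\<kappa> b" "lo b'"] by (auto simp: E_def)
      qed (auto simp: E_def)
      show "E b \<inter> E b' = {}" if "b \<noteq> b'" for b b'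
        using *[of b b'] *[of b' b] that by (metis Int_commute nat_neq_iff)
    qed auto
    finally show ?thesis .
  qed
  show ?thesis
  proof (rule that[of "\<lambda>x. Y x + Z x"])
    show "(\<lambda>x. Y x + Z x) \<in> borel_measurable borel" by measurable
    show "var_le r (\<lambda>k. synth (restr (freq_scale N \<xi> (clamp_scale K k)) G) x) (Y x + Z x)" for x
      using var_le_add[OF _ long[of x] short[of x]] r by (simp add: P_def R_def)
    have "(\<integral>\<^sup>+x. ennreal ((Y x + Z x)\<^sup>2) \<partial>lborel)
      \<le> 2 * (\<integral>\<^sup>+x. ennreal ((Y x)\<^sup>2) \<partial>lborel) + 2 * (\<integral>\<^sup>+x. ennreal ((Z x)\<^sup>2) \<partial>lborel)"
      by (rule nn_integral_square_sum_le) measurable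
    also have "\<dots> \<le> 2 * (ennreal (64 * (real s)\<^sup>2) * energy G) + 2 * (ennreal (128 * block_const r N) * energy G)"
      by (intro add_mono mult_left_mono Yint Zint) auto
    also have "\<dots> = (2 * ennreal (64 * (real s)\<^sup>2) + 2 * ennreal (128 * block_const r N)) * energy G"
      by (simp only: distrib_right mult.assoc)
    also have "2 * ennreal (64 * (real s)\<^sup>2) + 2 * ennreal (128 * block_const r N)
        = ennreal (128 * (real s)\<^sup>2 + 256 * block_const r N)"
    proof -
      have e2: "(2 :: ennreal) = ennreal 2" by simp
      have "2 * ennreal (64 * (real s)\<^sup>2) = ennreal (128 * (real s)\<^sup>2)"
        unfolding e2 by (subst ennreal_mult[symmetric]) auto
      moreover have "2 * ennreal (128 * block_const r N) = ennreal (256 * block_const r N)"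
        unfolding e2 using bc0 by (subst ennreal_mult[symmetric]) auto
      ultimately show ?thesis using bc0 by (simp add: ennreal_plus)
    qed
    finally show "(\<integral>\<^sup>+x. ennreal ((Y x + Z x)\<^sup>2) \<partial>lborel)
      \<le> ennreal (128 * (real s)\<^sup>2 + 256 * block_const r N) * energy G" .
  qed
qed


section \<open>The variational estimate\<close>

lemma powr_add_powr_le:
  fixes x y :: real
  assumes r: "1 \<le> r" and "0 \<le> x" "0 \<le> y"
  shows "x powr r + y powr r \<le> (x + y) powr r"
proof -
  define f where "f = (\<lambda>i. if i then x else y)"
  have "(\<Sum>i\<in>{True, False}. f i powr r) \<le> (x + y) powr r"
    using assms by (intro sum_powr_le[of 1 r]) (auto simp: f_def)
  then show ?thesis by (simp add: f_def)
qed

text \<open>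
  The first term of the variation norm is compared with the value at the finest scale of the window.
\<close>

lemma chain_le_of_var_le:
  fixes t :: "nat \<Rightarrow> int"
  assumes r: "1 \<le> r" and var: "var_le r (\<lambda>k. a (clamp_scale K k)) X"
    and t: "strict_mono_on {..n} t" and range: "t ` {..n} \<subseteq> {- int K..int K}"
  shows "(cmod (a (t 0)) powr r + (\<Sum>j=1..n. cmod (a (t j) - a (t (j - 1))) powr r)) powr (1 / r)
    \<le> cmod (a (int K)) + 2 * X"
proof -
  define t' where "t' = (\<lambda>j. t (min j n))"
  have "mono t'"
  proof (rule monoI)
    fix i j :: nat assume "i \<le> j"
    then have "min i n = min j n \<or> min i n < min j n" by linarith
    then show "t' i \<le> t' j"
    proof
      assume "min i n < min j n"
      then have "t (min i n) < t (min j n)" by (intro strict_mono_onD[OF t]) auto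
      then show ?thesis by (simp add: t'_def)
    qed (simp add: t'_def)
  qed
  have cl: "clamp_scale K (t j) = t j" if "j \<le> n" for j
    using range that by (intro clamp_scale_id) auto
  have X0: "0 \<le> X" by (rule var_le_nonneg[OF var])
  have "(\<Sum>j<n. cmod (a (clamp_scale K (t' (Suc j))) - a (clamp_scale K (t' j))) powr r) \<le> X powr r"
    by (rule var_leD[OF var \<open>mono t'\<close>])
  also have "(\<Sum>j<n. cmod (a (clamp_scale K (t' (Suc j))) - a (clamp_scale K (t' j))) powr r)
     = (\<Sum>j=1..n. cmod (a (t j) - a (t (j - 1))) powr r)"
    by (rule sum.reindex_bij_witness[where i="\<lambda>j. j - 1" and j=Suc]) (auto simp: t'_def cl min_def)
  finally have inc: "(\<Sum>j=1..n. cmod (a (t j) - a (t (j - 1))) powr r) \<le> X powr r" .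
  have "cmod (a (t 0) - a (int K)) \<le> X"
    using var_le_increment[OF var, of "t 0" "int K"] r cl[of 0] clamp_scale_id[of "int K" K] by simp
  then have first: "cmod (a (t 0)) \<le> cmod (a (int K)) + X"
    using norm_triangle_sub[of "a (t 0)" "a (int K)"] by linarith
  have "cmod (a (t 0)) powr r + (\<Sum>j=1..n. cmod (a (t j) - a (t (j - 1))) powr r)
      \<le> (cmod (a (int K)) + X) powr r + X powr r"
    using first r by (intro add_mono powr_mono2 inc) auto
  also have "\<dots> \<le> (cmod (a (int K)) + X + X) powr r"
    using X0 by (intro powr_add_powr_le r) auto
  finally have "(cmod (a (t 0)) powr r + (\<Sum>j=1..n. cmod (a (t j) - a (t (j - 1))) powr r)) powr (1 / r)
      \<le> ((cmod (a (int K)) + X + X) powr r) powr (1 / r)"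
    using r by (intro powr_mono2 add_nonneg_nonneg sum_nonneg) auto
  also have "\<dots> = cmod (a (int K)) + 2 * X" using r X0 by (simp add: powr_powr)
  finally show ?thesis .
qed

lemma ennreal_square_le_of_bounds:
  fixes l :: ennreal
  assumes "\<And>v. v \<in> V \<Longrightarrow> v\<^sup>2 \<le> l"
  shows "(Sup V)\<^sup>2 \<le> l"
proof (cases "l = \<infinity>")
  case False
  define q where "q = ennreal (sqrt (enn2real l))"
  have "q\<^sup>2 = ennreal ((sqrt (enn2real l))\<^sup>2)" unfolding q_def by (rule ennreal_power) simp
  also have "\<dots> = l" using False by (simp add: less_top)
  finally have q: "q\<^sup>2 = l" .
  have "Sup V \<le> q"
  proof (rule Sup_least)
    fix v assume "v \<in> V"
    then have "v\<^sup>2 \<le> q\<^sup>2" unfolding q by (rule assms)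
    then show "v \<le> q" by (rule ennreal_le_of_square_le)
  qed
  then have "(Sup V)\<^sup>2 \<le> q\<^sup>2" by (intro power_mono) auto
  then show ?thesis by (simp add: q)
qed simp

text \<open>
  Every chain of scales lies in all sufficiently large windows, so that the variation norm is at most the lower
  limit of the bounds for the windows. Fatou's lemma for these measurable bounds avoids discussing the
  measurability of the variation norm itself.
\<close>

lemma Vnorm_energy_le:
  assumes r: "2 < r'" "r' \<le> r" and N: "1 \<le> N" "N \<le> 2 ^ s" and mono: "strict_mono_on {1..N} \<xi>"
    and Gm[measurable]: "G \<in> borel_measurable borel" and Gfin: "energy G < \<infinity>"
  shows "(\<integral>\<^sup>+x. (Vnorm r UNIV (\<lambda>k. synth (restr (freq_scale N \<xi> k) G) x))\<^sup>2 \<partial>lborel)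
    \<le> ennreal (2 + 8 * (128 * (real s)\<^sup>2 + 256 * block_const r' N)) * energy G"
proof -
  define P where "P = (\<lambda>k x. synth (restr (freq_scale N \<xi> k) G) x)"
  define C where "C = 128 * (real s)\<^sup>2 + 256 * block_const r' N"
  have C0: "0 \<le> C"
    using martingale_const_nonneg[of r' N] sieve_const_pos by (simp add: C_def block_const_def)
  have Pm[measurable]: "P k \<in> borel_measurable borel" for k
    unfolding P_def by (intro measurable_synth restr_measurable) auto
  have Pi: "energy (P k) \<le> energy G" for k
    unfolding P_def
    by (rule order_trans[OF energy_synth_le energy_restr_le])
       (rule integrable_restr_freq_union[OF Gm Gfin _ order_refl], measurable)
  have "\<exists>X. X \<in> borel_measurable borel \<and> (\<forall>x. var_le r' (\<lambda>k. P (clamp_scale K k) x) (X x)) \<and>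
      (\<integral>\<^sup>+x. ennreal ((X x)\<^sup>2) \<partial>lborel) \<le> ennreal C * energy G" for K
    unfolding P_def C_def by (rule window_variation[OF r(1) N mono Gm Gfin, where K=K]) blast
  then obtain X where Xm[measurable]: "\<And>K. X K \<in> borel_measurable borel"
    and Xvar: "\<And>K x. var_le r' (\<lambda>k. P (clamp_scale K k) x) (X K x)"
    and Xint: "\<And>K. (\<integral>\<^sup>+x. ennreal ((X K x)\<^sup>2) \<partial>lborel) \<le> ennreal C * energy G"
    by metis
  define W where "W = (\<lambda>K x. cmod (P (int K) x) + 2 * X K x)"
  have Wm[measurable]: "W K \<in> borel_measurable borel" for K unfolding W_def by measurable
  have X0: "0 \<le> X K x" for K x by (rule var_le_nonneg[OF Xvar])
  have pt: "(Vnorm r UNIV (\<lambda>k. P k x))\<^sup>2 \<le> liminf (\<lambda>K. ennreal ((W K x)\<^sup>2))" for x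
    unfolding Vnorm_def
  proof (rule ennreal_square_le_of_bounds)
    fix v assume "v \<in> (\<lambda>(n, t). ennreal ((cmod (P (t 0) x) powr r + (\<Sum>j=1..n. cmod (P (t j) x - P (t (j - 1)) x) powr r)) powr (1 / r)))
      ` {(n::nat, t::nat \<Rightarrow> int). strict_mono_on {..n} t \<and> t ` {..n} \<subseteq> UNIV}"
    then obtain n and t :: "nat \<Rightarrow> int" where t: "strict_mono_on {..n} t"
      and v: "v = ennreal ((cmod (P (t 0) x) powr r + (\<Sum>j=1..n. cmod (P (t j) x - P (t (j - 1)) x) powr r)) powr (1 / r))"
      by auto
    define K0 where "K0 = nat (\<Sum>j\<le>n. \<bar>t j\<bar>)"
    have tK: "t ` {..n} \<subseteq> {- int K..int K}" if "K0 \<le> K" for K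
    proof
      fix k assume "k \<in> t ` {..n}"
      then obtain j where j: "j \<le> n" "k = t j" by auto
      have "\<bar>t j\<bar> \<le> (\<Sum>j\<le>n. \<bar>t j\<bar>)" using j by (intro member_le_sum) auto
      then show "k \<in> {- int K..int K}" using that j by (auto simp: K0_def)
    qed
    have "v\<^sup>2 \<le> ennreal ((W K x)\<^sup>2)" if "K0 \<le> K" for K
    proof -
      have "v \<le> ennreal (W K x)"
        unfolding v W_def using r
        by (intro ennreal_leI chain_le_of_var_le[OF _ var_le_exponent[OF Xvar] t tK[OF that]]) auto
      then have "v\<^sup>2 \<le> (ennreal (W K x))\<^sup>2" by (intro power_mono) auto
      moreover have "(ennreal (W K x))\<^sup>2 = ennreal ((W K x)\<^sup>2)"
        using X0[of K x] by (intro ennreal_power) (simp add: W_def)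
      ultimately show ?thesis by simp
    qed
    then show "v\<^sup>2 \<le> liminf (\<lambda>K. ennreal ((W K x)\<^sup>2))"
      by (intro Liminf_bounded) (auto simp: eventually_sequentially)
  qed
  have "(\<integral>\<^sup>+x. (Vnorm r UNIV (\<lambda>k. P k x))\<^sup>2 \<partial>lborel) \<le> (\<integral>\<^sup>+x. liminf (\<lambda>K. ennreal ((W K x)\<^sup>2)) \<partial>lborel)"
    by (intro nn_integral_mono pt)
  also have "\<dots> \<le> liminf (\<lambda>K. \<integral>\<^sup>+x. ennreal ((W K x)\<^sup>2) \<partial>lborel)"
    by (rule nn_integral_liminf) measurable
  also have "\<dots> \<le> ennreal (2 + 8 * C) * energy G"
  proof (rule Liminf_le, simp, rule always_eventually, rule allI)
    fix K
    have "(\<integral>\<^sup>+x. ennreal ((W K x)\<^sup>2) \<partial>lborel)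
      \<le> 2 * (\<integral>\<^sup>+x. ennreal ((cmod (P (int K) x))\<^sup>2) \<partial>lborel) + 2 * (\<integral>\<^sup>+x. ennreal ((2 * X K x)\<^sup>2) \<partial>lborel)"
      unfolding W_def by (rule nn_integral_square_sum_le) measurable
    also have "(\<integral>\<^sup>+x. ennreal ((2 * X K x)\<^sup>2) \<partial>lborel) = 4 * (\<integral>\<^sup>+x. ennreal ((X K x)\<^sup>2) \<partial>lborel)"
      by (subst nn_integral_cmult[symmetric]) (auto simp: power_mult_distrib ennreal_mult)
    also have "2 * (\<integral>\<^sup>+x. ennreal ((cmod (P (int K) x))\<^sup>2) \<partial>lborel) + 2 * (4 * (\<integral>\<^sup>+x. ennreal ((X K x)\<^sup>2) \<partial>lborel))
      \<le> 2 * energy G + 2 * (4 * (ennreal C * energy G))"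
      using Pi[of "int K"] by (intro add_mono mult_left_mono Xint) (auto simp: energy_def)
    also have "\<dots> = (2 + 8 * ennreal C) * energy G"
      by (simp add: distrib_right mult.assoc[symmetric])
    also have "2 + 8 * ennreal C = ennreal (2 + 8 * C)"
      using C0 by (simp add: ennreal_plus ennreal_mult)
    finally show "(\<integral>\<^sup>+x. ennreal ((W K x)\<^sup>2) \<partial>lborel) \<le> ennreal (2 + 8 * C) * energy G" .
  qed
  finally show ?thesis by (simp add: P_def C_def)
qed

text \<open>
  The number of frequencies enters only through \<open>(\<surd>N)\<^sup>1\<^sup>-\<^sup>2\<^sup>/\<^sup>r\<close>, squared.
\<close>

lemma block_const_powr_bound:
  assumes r: "2 < r"
  obtains c where "0 \<le> c" "\<And>N::nat. 1 \<le> N \<Longrightarrow> block_const r N \<le> c * real N powr (1 - 2 / r)"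
proof -
  define \<theta> where "\<theta> = 1 - 2 / r"
  define w where "w = (3 powr \<theta> / (1 - (1/2) powr \<theta>))\<^sup>2 * (4 + 22 * sieve_const)"
  have K: "0 < sieve_const" by (rule sieve_const_pos)
  have \<theta>: "0 < \<theta>" using r by (simp add: \<theta>_def)
  have w0: "0 \<le> w" using K by (simp add: w_def)
  show ?thesis
  proof (rule that[of "1024 + 512 * w + 393216 * sieve_const"])
    show "0 \<le> 1024 + 512 * w + 393216 * sieve_const" using w0 K by simp
    fix N :: nat assume N: "1 \<le> N"
    have N1: "1 \<le> real N powr \<theta>" using N \<theta> by (intro ge_one_powr_ge_zero) auto
    have "(sqrt N powr \<theta>)\<^sup>2 = real N powr \<theta>"
    proof -
      have "(sqrt N powr \<theta>)\<^sup>2 = (sqrt N powr \<theta>) * (sqrt N powr \<theta>)" by (simp add: power2_eq_square)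
      also have "\<dots> = (sqrt N * sqrt N) powr \<theta>" by (simp only: powr_mult[symmetric])
      finally show ?thesis by simp
    qed
    then have "(weight_total r N)\<^sup>2 = (3 powr \<theta> / (1 - (1/2) powr \<theta>))\<^sup>2 * real N powr \<theta>"
      unfolding weight_total_def \<theta>_def[symmetric] by (simp add: powr_mult power_mult_distrib power_divide)
    then have "block_const r N = 1024 * 1 + 512 * w * real N powr \<theta> + 393216 * sieve_const * 1"
      by (simp add: block_const_def martingale_const_def w_def mult_ac)
    also have "\<dots> \<le> 1024 * real N powr \<theta> + 512 * w * real N powr \<theta> + 393216 * sieve_const * real N powr \<theta>"
      using N1 K by (intro add_mono mult_left_mono order_refl) auto
    also have "\<dots> = (1024 + 512 * w + 393216 * sieve_const) * real N powr \<theta>" by (simp add: distrib_right)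
    finally show "block_const r N \<le> (1024 + 512 * w + 393216 * sieve_const) * real N powr (1 - 2 / r)"
      by (simp add: \<theta>_def)
  qed
qed

lemma dyadic_exponent_powr_bound:
  assumes \<epsilon>: "0 < \<epsilon>" and N: "1 \<le> N"
  obtains s where "N \<le> 2 ^ s" "real s \<le> (1 + 1 / (\<epsilon> * ln 2)) * real N powr \<epsilon>"
proof -
  define s where "s = nat \<lceil>log 2 (real N)\<rceil>"
  have l0: "0 \<le> log 2 (real N)" using N by simp
  have s: "log 2 (real N) \<le> real s" "real s \<le> log 2 (real N) + 1"
    unfolding s_def using l0 by linarith+
  have "real N = 2 powr log 2 (real N)" using N by simp
  also have "\<dots> \<le> 2 powr real s" using s by (intro powr_mono) auto
  also have "\<dots> = real (2 ^ s)" by (simp add: powr_realpow)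
  finally have 1: "N \<le> 2 ^ s" by linarith
  have "ln (real N) \<le> real N powr \<epsilon> / \<epsilon>" using N \<epsilon> by (intro ln_powr_bound) auto
  then have "log 2 (real N) \<le> 1 / (\<epsilon> * ln 2) * real N powr \<epsilon>"
    unfolding log_def using \<epsilon> by (simp add: field_simps)
  moreover have "1 \<le> real N powr \<epsilon>" using N \<epsilon> by (intro ge_one_powr_ge_zero) auto
  ultimately have "real s \<le> (1 + 1 / (\<epsilon> * ln 2)) * real N powr \<epsilon>" using s by (simp add: distrib_right)
  with 1 show ?thesis by (rule that)
qed

theorem theorem8p1:
  fixes r \<epsilon> :: real
  assumes "r > 2" and "\<epsilon> > 0"
  shows "\<exists>C::real. C \<ge> 0 \<and>
    (\<forall>(N::nat) (\<xi>::nat \<Rightarrow> real) (f::real \<Rightarrow> complex).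
       N \<ge> 1 \<longrightarrow> strict_mono_on {1..N} \<xi> \<longrightarrow> f \<in> L2 \<longrightarrow>
       L2norm (\<lambda>x. Vnorm r (UNIV :: int set) (\<lambda>k. freq_proj N \<xi> k f x))
         \<le> ennreal (C * real N powr \<epsilon>) * cL2norm f)"
proof -
  (* With this exponent the loss N powr (1/2 - 1/r') of the martingale part is at most N powr \<epsilon>. *)
  define r' where "r' = min r (2 + \<epsilon>)"
  have r': "2 < r'" "r' \<le> r" "1 - 2 / r' \<le> 2 * \<epsilon>"
  proof -
    show gt: "2 < r'" "r' \<le> r" using assms by (auto simp: r'_def)
    have "1 - 2 / r' = (r' - 2) / r'" using gt by (simp add: field_simps)
    also have "\<dots> \<le> (r' - 2) / 1" using gt by (intro divide_left_mono) auto
    also have "\<dots> \<le> \<epsilon>" by (simp add: r'_def)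
    finally show "1 - 2 / r' \<le> 2 * \<epsilon>" using assms by linarith
  qed
  obtain c where c: "0 \<le> c" "\<And>N::nat. 1 \<le> N \<Longrightarrow> block_const r' N \<le> c * real N powr (1 - 2 / r')"
    by (rule block_const_powr_bound[OF r'(1)]) auto
  define b where "b = 1 + 1 / (\<epsilon> * ln 2)"
  define D where "D = 2 + 1024 * b\<^sup>2 + 2048 * c"
  have D0: "0 \<le> D" using c by (simp add: D_def)
  show ?thesis
  proof (intro exI[of _ "sqrt D"] conjI allI impI)
    show "0 \<le> sqrt D" using D0 by simp
    fix N :: nat and \<xi> :: "nat \<Rightarrow> real" and f :: "real \<Rightarrow> complex"
    assume N: "1 \<le> N" and mono: "strict_mono_on {1..N} \<xi>" and f: "f \<in> L2"
    have fE: "energy f < \<infinity>" using f cL2norm_less_top_iff[of f] by (simp add: L2_def)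
    obtain g where g: "g \<in> borel_measurable borel" "energy g \<le> energy f" "AE x in lborel. fourier_L2 f x = g x"
      "fourier_L2 f \<in> borel_measurable lebesgue"
      by (rule fourier_L2_representative[OF f])
    have proj: "freq_proj N \<xi> k f x = synth (restr (freq_scale N \<xi> k) g) x" for k x
      using freq_proj_eq_synth[OF g(1,3,4), of N \<xi> k x] by (simp add: freq_nbhd_def freq_union_def)
    obtain s where s: "N \<le> 2 ^ s" "real s \<le> b * real N powr \<epsilon>"
      unfolding b_def by (rule dyadic_exponent_powr_bound[OF assms(2) N])
    have const: "2 + 8 * (128 * (real s)\<^sup>2 + 256 * block_const r' N) \<le> (sqrt D * real N powr \<epsilon>)\<^sup>2"
    proof -
      define q where "q = (real N powr \<epsilon>)\<^sup>2"
      have qe: "q = real N powr (2 * \<epsilon>)" by (simp add: q_def power2_eq_square flip: powr_add)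
      have q1: "1 \<le> q" unfolding qe using N assms by (intro ge_one_powr_ge_zero) auto
      have "(real s)\<^sup>2 \<le> (b * real N powr \<epsilon>)\<^sup>2" using s(2) by (intro power_mono) auto
      then have 1: "(real s)\<^sup>2 \<le> b\<^sup>2 * q" by (simp add: q_def power_mult_distrib)
      have "block_const r' N \<le> c * real N powr (1 - 2 / r')" by (rule c(2)[OF N])
      also have "\<dots> \<le> c * q" unfolding qe using N r' c by (intro mult_left_mono powr_mono) auto
      finally have 2: "block_const r' N \<le> c * q" .
      have "2 + 8 * (128 * (real s)\<^sup>2 + 256 * block_const r' N) \<le> 2 * q + 8 * (128 * (b\<^sup>2 * q) + 256 * (c * q))"
        using 1 2 q1 by (intro add_mono mult_left_mono) auto
      also have "\<dots> = D * q" by (simp add: D_def algebra_simps)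
      also have "\<dots> = (sqrt D * real N powr \<epsilon>)\<^sup>2" using D0 by (simp add: q_def power_mult_distrib)
      finally show ?thesis .
    qed
    have "(L2norm (\<lambda>x. Vnorm r (UNIV :: int set) (\<lambda>k. freq_proj N \<xi> k f x)))\<^sup>2
      = (\<integral>\<^sup>+x. (Vnorm r UNIV (\<lambda>k. synth (restr (freq_scale N \<xi> k) g) x))\<^sup>2 \<partial>lborel)"
      by (simp add: L2norm_square nn_integral_completion proj)
    also have "\<dots> \<le> ennreal (2 + 8 * (128 * (real s)\<^sup>2 + 256 * block_const r' N)) * energy g"
      by (rule Vnorm_energy_le[OF r'(1,2) N s(1) mono g(1) le_less_trans[OF g(2) fE]])
    also have "\<dots> \<le> ennreal ((sqrt D * real N powr \<epsilon>)\<^sup>2) * energy f"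
      by (intro mult_mono ennreal_leI const g(2)) auto
    also have "\<dots> = (ennreal (sqrt D * real N powr \<epsilon>) * cL2norm f)\<^sup>2"
    proof -
      have "0 \<le> sqrt D * real N powr \<epsilon>" using D0 by simp
      then show ?thesis by (simp only: power_mult_distrib[of "ennreal _"] cL2norm_square ennreal_power)
    qed
    finally show "L2norm (\<lambda>x. Vnorm r (UNIV :: int set) (\<lambda>k. freq_proj N \<xi> k f x))
      \<le> ennreal (sqrt D * real N powr \<epsilon>) * cL2norm f"
      by (rule ennreal_le_of_square_le)
  qed
qed

end
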